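(* Suppose that $\theta<\kappa$ are regular infinite cardinals, $\eta$ is an infinite cardinal satisfying $\lambda^{<\eta}<\kappa$ for all $\lambda<\kappa$, $\chi=\min\{\eta,\theta\}$, $\diamondsuit(\kappa)$ holds, and $X\subseteq{}^{<\kappa}\kappa$ is a downward-closed $\kappa$-tree (ordered by proper inclusion) that is $\mathrm{P}^-_{14}(\kappa,\sqsubseteq_\theta,\kappa,\{E^\kappa_{\ge\eta}\})$-respecting. Then there exists a $\chi$-free $\eta$-complete $\kappa$-Souslin tree that admits an $(\mathcal F^{\mathrm{bd}}_\theta,X)$-ascent path.
   Context: Trees: a tree is a poset $(T,<_T)$ in which each $x_\downarrow=\{y\mid y<_Tx\}$ is well-ordered; heights and levels $T_\alpha$ are as usual; for a set $Y$ of ordinals, $T\restriction Y=\{t\in T\mid \mathrm{ht}(t)\in Y\}$. A $\kappa$-tree has $\{\alpha\mid T_\alpha\ne\emptyset\}=\kappa$ and all levels of size $<\kappa$; $\kappa$-Souslin means no cofinal branch and no antichain of size $\kappa$. A tree is $\eta$-complete if every $<_T$-increasing sequence of length $<\eta$ has an upper bound. For a downward-closed $X\subseteq{}^{<\kappa}\kappa$ ordered by $\subsetneq$, the height of $x$ is $\mathrm{dom}(x)$ and $X_\alpha=X\cap{}^\alpha\kappa$. $T^\tau=\{f:\tau\to T\mid \mathrm{ht}\circ f$ constant$\}$; for nonzero $\tau$, $\beta<\kappa$ and distinct $\langle w_i\mid i<\tau\rangle\in{}^\tau T_\beta$, the derived tree $\bigotimes_{i<\tau}w_i^\uparrow$ consists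 of $f\in T^\tau$ with each $f(i)$ compatible with $w_i$, ordered coordinatewise by $<_T$. A $\kappa$-Souslin tree is $\chi$-free if for every nonzero $\tau<\chi$, all $\beta<\kappa$ and all distinct $\langle w_i\mid i<\tau\rangle\in{}^\tau T_\beta$, the derived tree is $\kappa$-Souslin. Ascent paths: for a collection of sets $\mathcal F$, an $(\mathcal F,X)$-ascent path through a $\kappa$-tree $(T,<_T)$ is $\langle f_x\mid x\in X\rangle$ where $f_x:\bigcup\mathcal F\to T_{\mathrm{dom}(x)}$, $\{i\mid f_x(i)<_Tf_y(i)\}\in\mathcal F$ for all $x\subsetneq y$ in $X$, and $\{i\mid f_x(i)\ne f_y(i)\}\in\mathcal F$ for distinct $x,y\in X_\alpha$, $\alpha<\kappa$. $\mathcal F^{\mathrm{bd}}_\theta=\{Z\subseteq\theta\mid \sup(\theta\setminus Z)<\theta\}$. Proxy principle: for a set of ordinals $D$, $\mathrm{acc}(D)=\{\alpha\in D\mid\sup(D\cap\alpha)=\alpha>0\}$, $\mathrm{nacc}(D)=D\setminus\mathrm{acc}(D)$, $\mathrm{succ}_\omega(D)=\{\delta\in D\mid 0<\mathrm{otp}(D\cap\delta)<\omega\}$. $E^\kappa_{\ge\eta}=\{\alpha<\kappa\mid\mathrm{cf}(\alpha)\ge\eta\}$. For sets of ordinals, $D\sqsubseteq C$ iff $D=C\cap\beta$ for some $\beta$; $D\sqsubseteq_\nu C$ iff $D\sqsubseteq C$ or ($\mathrm{otp}(C)<\nu$ and $\mathrm{nacc}(C)$ consists only of successor ordinals). For a binary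 relation $\mathcal R$, a cardinal $1\le\mu\le\kappa$ and a nonempty family $\mathcal S$ of stationary subsets of $\kappa$, $\mathrm{P}^-_{14}(\kappa,\mathcal R,\mu,\mathcal S)$ asserts the existence of $\langle C_\alpha\mid\alpha<\kappa\rangle$ such that: each $C_\alpha$ with $\alpha$ limit is club in $\alpha$; for all $\alpha<\kappa$ and $\bar\alpha\in\mathrm{acc}(C_\alpha)$, $C_{\bar\alpha}\mathrel{\mathcal R}C_\alpha$; and for every sequence $\langle A_i\mid i<\mu\rangle$ of cofinal subsets of $\kappa$ and every $S\in\mathcal S$, there are stationarily many $\alpha\in S$ such that for every $i<\min\{\alpha,\mu\}$, $\sup\{\beta\in C_\alpha\mid\mathrm{succ}_\omega(C_\alpha\setminus\beta)\subseteq A_i\}=\alpha$. Respecting: a downward-closed $\kappa$-tree $X\subseteq{}^{<\kappa}\kappa$ is $\mathrm{P}^-_{14}(\kappa,\mathcal R,\mu,\mathcal S)$-respecting if there exist $\tilde S\subseteq\kappa$, a sequence $\langle C_\alpha\mid\alpha<\kappa\rangle$ and maps $\mathbf b^\alpha:X\restriction C_\alpha\to{}^\alpha\kappa\cup\{\emptyset\}$ ($\alpha<\kappa$) such that (1) $X_\alpha\subseteq\mathrm{range}(\mathbf b^\alpha)$ for every $\alpha\in\tilde S$; (2) $\langle C_\alpha\mid\alpha<\kappa\rangle$ witnesses $\mathrm{P}^-_{14}(\kappa,\mathcal R,\mu,\{S\cap\tilde S\mid S\in\mathcal S\})$; (3) for all $\bar\alpha,\alpha<\kappa$, if $x\in X\restriction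 C_{\bar\alpha}$ and $C_\alpha\cap[\mathrm{dom}(x),\bar\alpha)=C_{\bar\alpha}\cap[\mathrm{dom}(x),\bar\alpha)$, then $\mathbf b^{\bar\alpha}(x)=\mathbf b^\alpha(x)\restriction\bar\alpha$. *)

theory Defs
  imports Main
begin

text \<open>Ordinals below kappa are the elements of a well-ordered type 'k whose
order type is the regular cardinal kappa.  Nodes of trees of size kappa are
represented by elements of 'k as well (any kappa-tree has cardinality kappa).\<close>

definition below :: "'k::wellorder \<Rightarrow> 'k set" where
  "below \<alpha> = {\<beta>. \<beta> < \<alpha>}"

definition is_card :: "'k::wellorder \<Rightarrow> bool" where
  "is_card \<alpha> \<longleftrightarrow> (\<forall>\<beta><\<alpha>. (card_of (below \<beta>), card_of (below \<alpha>)) \<in> ordLess)"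

definition regular_ord :: "'k::wellorder \<Rightarrow> bool" where
  "regular_ord \<theta> \<longleftrightarrow> infinite (below \<theta>) \<and> is_card \<theta> \<and>
     (\<forall>A \<subseteq> below \<theta>. (\<forall>\<beta><\<theta>. \<exists>\<delta>\<in>A. \<beta> \<le> \<delta>) \<longrightarrow> (card_of (below \<theta>), card_of A) \<in> ordLeq)"

definition regular_type :: "'k::wellorder itself \<Rightarrow> bool" where
  "regular_type K \<longleftrightarrow> infinite (UNIV::'k set) \<and>
     (\<forall>\<alpha>::'k. (card_of (below \<alpha>), card_of (UNIV::'k set)) \<in> ordLess) \<and>
     (\<forall>A::'k set. (\<forall>\<beta>. \<exists>\<delta>\<in>A. \<beta> \<le> \<delta>) \<longrightarrow> (card_of (UNIV::'k set), card_of A) \<in> ordLeq)"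

definition funcs_to :: "'k::wellorder \<Rightarrow> 'k \<Rightarrow> ('k \<Rightarrow> 'k) set" where
  "funcs_to \<mu> lam = {f. (\<forall>i<\<mu>. f i < lam) \<and> (\<forall>i. \<not> i < \<mu> \<longrightarrow> f i = undefined)}"

definition cofinal_in :: "'k::wellorder set \<Rightarrow> 'k \<Rightarrow> bool" where
  "cofinal_in D \<alpha> \<longleftrightarrow> (\<exists>\<beta>. \<beta> < \<alpha>) \<and> (\<forall>\<beta><\<alpha>. \<exists>\<delta>\<in>D. \<beta> < \<delta> \<and> \<delta> < \<alpha>)"

definition acc :: "'k::wellorder set \<Rightarrow> 'k set" where
  "acc D = {\<alpha>\<in>D. cofinal_in D \<alpha>}"

definition nacc :: "'k::wellorder set \<Rightarrow> 'k set" where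
  "nacc D = D - acc D"

definition succ_omega :: "'k::wellorder set \<Rightarrow> 'k set" where
  "succ_omega D = {\<delta>\<in>D. finite (D \<inter> below \<delta>) \<and> D \<inter> below \<delta> \<noteq> {}}"

definition is_limit :: "'k::wellorder \<Rightarrow> bool" where
  "is_limit \<alpha> \<longleftrightarrow> (\<exists>\<beta>. \<beta> < \<alpha>) \<and> (\<forall>\<beta><\<alpha>. \<exists>\<gamma>. \<beta> < \<gamma> \<and> \<gamma> < \<alpha>)"

definition is_successor :: "'k::wellorder \<Rightarrow> bool" where
  "is_successor \<alpha> \<longleftrightarrow> (\<exists>\<beta><\<alpha>. \<forall>\<gamma>. \<beta> < \<gamma> \<longrightarrow> \<alpha> \<le> \<gamma>)"

definition is_sup :: "'k::wellorder set \<Rightarrow> 'k \<Rightarrow> bool" where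
  "is_sup B \<alpha> \<longleftrightarrow> (\<forall>\<beta>\<in>B. \<beta> \<le> \<alpha>) \<and> (\<forall>\<gamma>. (\<forall>\<beta>\<in>B. \<beta> \<le> \<gamma>) \<longrightarrow> \<alpha> \<le> \<gamma>)"

definition club_in :: "'k::wellorder set \<Rightarrow> 'k \<Rightarrow> bool" where
  "club_in C \<alpha> \<longleftrightarrow> C \<subseteq> below \<alpha> \<and> (\<forall>\<beta><\<alpha>. \<exists>\<gamma>\<in>C. \<beta> \<le> \<gamma>) \<and>
     (\<forall>\<gamma><\<alpha>. cofinal_in C \<gamma> \<longrightarrow> \<gamma> \<in> C)"

definition club :: "'k::wellorder set \<Rightarrow> bool" where
  "club C \<longleftrightarrow> (\<forall>\<beta>. \<exists>\<gamma>\<in>C. \<beta> \<le> \<gamma>) \<and> (\<forall>\<gamma>. cofinal_in C \<gamma> \<longrightarrow> \<gamma> \<in> C)"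

definition stationary :: "'k::wellorder set \<Rightarrow> bool" where
  "stationary S \<longleftrightarrow> (\<forall>C. club C \<longrightarrow> S \<inter> C \<noteq> {})"

definition diamond :: "'k::wellorder itself \<Rightarrow> bool" where
  "diamond K \<longleftrightarrow> (\<exists>A::'k \<Rightarrow> 'k set. (\<forall>\<alpha>. A \<alpha> \<subseteq> below \<alpha>) \<and>
      (\<forall>Z::'k set. stationary {\<alpha>. Z \<inter> below \<alpha> = A \<alpha>}))"

definition E_ge :: "'k::wellorder \<Rightarrow> 'k set" where
  "E_ge \<eta> = {\<alpha>. \<forall>A \<subseteq> below \<alpha>. (\<forall>\<beta><\<alpha>. \<exists>\<delta>\<in>A. \<beta> \<le> \<delta>) \<longrightarrow>
                   (card_of (below \<eta>), card_of A) \<in> ordLeq}"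

definition otp_is :: "'k::wellorder set \<Rightarrow> 'k \<Rightarrow> bool" where
  "otp_is C \<gamma> \<longleftrightarrow> (\<exists>f. bij_betw f (below \<gamma>) C \<and>
      (\<forall>\<beta>\<in>below \<gamma>. \<forall>\<beta>'\<in>below \<gamma>. \<beta> < \<beta>' \<longrightarrow> f \<beta> < f \<beta>'))"

definition sqsub :: "'k::wellorder set \<Rightarrow> 'k set \<Rightarrow> bool" where
  "sqsub D C \<longleftrightarrow> (\<exists>\<beta>. D = C \<inter> below \<beta>)"

definition sqsub_nu :: "'k::wellorder \<Rightarrow> 'k set \<Rightarrow> 'k set \<Rightarrow> bool" where
  "sqsub_nu \<nu> D C \<longleftrightarrow> sqsub D C \<or> ((\<exists>\<gamma><\<nu>. otp_is C \<gamma>) \<and> (\<forall>\<alpha>\<in>nacc C. is_successor \<alpha>))"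

text \<open>P^-_14(kappa, Rel, mu, SS); mu is given by the index set M = {i. i < mu}
  (M = UNIV for mu = kappa).\<close>
definition P14 :: "('k::wellorder \<Rightarrow> 'k set) \<Rightarrow> ('k set \<Rightarrow> 'k set \<Rightarrow> bool) \<Rightarrow> 'k set \<Rightarrow> 'k set set \<Rightarrow> bool" where
  "P14 C Rel M SS \<longleftrightarrow>
     (\<forall>\<alpha>. is_limit \<alpha> \<longrightarrow> club_in (C \<alpha>) \<alpha>) \<and>
     (\<forall>\<alpha>. \<forall>\<alpha>'\<in>acc (C \<alpha>). Rel (C \<alpha>') (C \<alpha>)) \<and>
     (\<forall>A::'k \<Rightarrow> 'k set. (\<forall>i\<in>M. \<forall>\<beta>. \<exists>\<gamma>\<in>A i. \<beta> \<le> \<gamma>) \<longrightarrow>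
        (\<forall>S\<in>SS. stationary {\<alpha>\<in>S. \<forall>i\<in>M. i < \<alpha> \<longrightarrow>
            is_sup {\<beta>\<in>C \<alpha>. succ_omega (C \<alpha> - below \<beta>) \<subseteq> A i} \<alpha>}))"

text \<open>Elements of ^{<kappa} kappa are partial maps with domain an initial segment.\<close>
definition seq_below :: "('k::wellorder \<Rightarrow> 'k option) \<Rightarrow> bool" where
  "seq_below x \<longleftrightarrow> (\<exists>\<alpha>. dom x = below \<alpha>)"

definition downward_closed :: "('k::wellorder \<Rightarrow> 'k option) set \<Rightarrow> bool" where
  "downward_closed X \<longleftrightarrow> (\<forall>x\<in>X. \<forall>\<beta>. x |` below \<beta> \<in> X)"

definition X_order :: "('k \<Rightarrow> 'k option) set \<Rightarrow> ('k \<Rightarrow> 'k option) \<Rightarrow> ('k \<Rightarrow> 'k option) \<Rightarrow> bool" where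
  "X_order X x y \<longleftrightarrow> x \<in> X \<and> y \<in> X \<and> x \<subseteq>\<^sub>m y \<and> x \<noteq> y"

definition restrX :: "('k::wellorder \<Rightarrow> 'k option) set \<Rightarrow> 'k set \<Rightarrow> ('k \<Rightarrow> 'k option) set" where
  "restrX X D = {x\<in>X. \<exists>\<alpha>\<in>D. dom x = below \<alpha>}"

definition respecting :: "('k::wellorder \<Rightarrow> 'k option) set \<Rightarrow> ('k set \<Rightarrow> 'k set \<Rightarrow> bool) \<Rightarrow> 'k set \<Rightarrow> 'k set set \<Rightarrow> bool" where
  "respecting X Rel M SS \<longleftrightarrow> (\<exists>St C (b :: 'k \<Rightarrow> ('k \<Rightarrow> 'k option) \<Rightarrow> ('k \<Rightarrow> 'k option)).
     (\<forall>\<alpha>. \<forall>x\<in>restrX X (C \<alpha>). dom (b \<alpha> x) = below \<alpha> \<or> b \<alpha> x = Map.empty) \<and>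
     (\<forall>\<alpha>\<in>St. {x\<in>X. dom x = below \<alpha>} \<subseteq> b \<alpha> ` restrX X (C \<alpha>)) \<and>
     P14 C Rel M {S \<inter> St | S. S \<in> SS} \<and>
     (\<forall>\<alpha>' \<alpha>. \<forall>x\<in>restrX X (C \<alpha>'). x \<in> restrX X (C \<alpha>) \<longrightarrow>
        (\<forall>\<delta>. dom x = below \<delta> \<longrightarrow> C \<alpha> \<inter> {\<delta>..<\<alpha>'} = C \<alpha>' \<inter> {\<delta>..<\<alpha>'} \<longrightarrow>
            b \<alpha>' x = b \<alpha> x |` below \<alpha>')))"

definition is_tree :: "'n set \<Rightarrow> ('n \<Rightarrow> 'n \<Rightarrow> bool) \<Rightarrow> bool" where
  "is_tree T R \<longleftrightarrow> (\<forall>x y. R x y \<longrightarrow> x \<in> T \<and> y \<in> T) \<and> (\<forall>x\<in>T. \<not> R x x) \<and>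
     (\<forall>x y z. R x y \<longrightarrow> R y z \<longrightarrow> R x z) \<and>
     (\<forall>x\<in>T. (\<forall>y z. R y x \<longrightarrow> R z x \<longrightarrow> y = z \<or> R y z \<or> R z y) \<and>
        (\<forall>A. A \<subseteq> {y. R y x} \<longrightarrow> A \<noteq> {} \<longrightarrow> (\<exists>m\<in>A. \<forall>a\<in>A. \<not> R a m)))"

definition ht_is :: "'n set \<Rightarrow> ('n \<Rightarrow> 'n \<Rightarrow> bool) \<Rightarrow> 'n \<Rightarrow> 'k::wellorder \<Rightarrow> bool" where
  "ht_is T R x \<alpha> \<longleftrightarrow> (\<exists>f. bij_betw f (below \<alpha>) {y. R y x} \<and>
      (\<forall>\<beta>\<in>below \<alpha>. \<forall>\<beta>'\<in>below \<alpha>. \<beta> < \<beta>' \<longrightarrow> R (f \<beta>) (f \<beta>')))"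

definition level :: "'n set \<Rightarrow> ('n \<Rightarrow> 'n \<Rightarrow> bool) \<Rightarrow> 'k::wellorder \<Rightarrow> 'n set" where
  "level T R \<alpha> = {x\<in>T. ht_is T R x \<alpha>}"

definition kappa_tree :: "'k::wellorder itself \<Rightarrow> 'n set \<Rightarrow> ('n \<Rightarrow> 'n \<Rightarrow> bool) \<Rightarrow> bool" where
  "kappa_tree K T R \<longleftrightarrow> is_tree T R \<and> (\<forall>x\<in>T. \<exists>\<alpha>::'k. ht_is T R x \<alpha>) \<and>
     (\<forall>\<alpha>::'k. level T R \<alpha> \<noteq> {} \<and> (card_of (level T R \<alpha>), card_of (UNIV::'k set)) \<in> ordLess)"

definition souslin :: "'k::wellorder itself \<Rightarrow> 'n set \<Rightarrow> ('n \<Rightarrow> 'n \<Rightarrow> bool) \<Rightarrow> bool" where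
  "souslin K T R \<longleftrightarrow> kappa_tree K T R \<and>
     \<not> (\<exists>B \<subseteq> T. (\<forall>x\<in>B. \<forall>y\<in>B. x = y \<or> R x y \<or> R y x) \<and> (\<forall>\<alpha>::'k. B \<inter> level T R \<alpha> \<noteq> {})) \<and>
     \<not> (\<exists>A \<subseteq> T. (\<forall>x\<in>A. \<forall>y\<in>A. x \<noteq> y \<longrightarrow> \<not> R x y) \<and> (card_of (UNIV::'k set), card_of A) \<in> ordLeq)"

definition eta_complete :: "'n set \<Rightarrow> ('n \<Rightarrow> 'n \<Rightarrow> bool) \<Rightarrow> 'k::wellorder \<Rightarrow> bool" where
  "eta_complete T R \<eta> \<longleftrightarrow> (\<forall>\<gamma><\<eta>. \<forall>s::'k \<Rightarrow> 'n. (\<forall>\<beta><\<gamma>. s \<beta> \<in> T) \<longrightarrow>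
      (\<forall>\<beta> \<beta>'. \<beta> < \<beta>' \<longrightarrow> \<beta>' < \<gamma> \<longrightarrow> R (s \<beta>) (s \<beta>')) \<longrightarrow>
      (\<exists>t\<in>T. \<forall>\<beta><\<gamma>. s \<beta> = t \<or> R (s \<beta>) t))"

definition compatible :: "('n \<Rightarrow> 'n \<Rightarrow> bool) \<Rightarrow> 'n \<Rightarrow> 'n \<Rightarrow> bool" where
  "compatible R a b \<longleftrightarrow> a = b \<or> R a b \<or> R b a"

definition derived_tree :: "'n set \<Rightarrow> ('n \<Rightarrow> 'n \<Rightarrow> bool) \<Rightarrow> 'k::wellorder \<Rightarrow> ('k \<Rightarrow> 'n) \<Rightarrow> ('k \<Rightarrow> 'n) set" where
  "derived_tree T R \<tau> w = {f. (\<forall>i. \<not> i < \<tau> \<longrightarrow> f i = undefined) \<and>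
      (\<exists>\<alpha>::'k. \<forall>i<\<tau>. f i \<in> level T R \<alpha>) \<and> (\<forall>i<\<tau>. compatible R (f i) (w i))}"

definition derived_rel :: "'n set \<Rightarrow> ('n \<Rightarrow> 'n \<Rightarrow> bool) \<Rightarrow> 'k::wellorder \<Rightarrow> ('k \<Rightarrow> 'n) \<Rightarrow> ('k \<Rightarrow> 'n) \<Rightarrow> ('k \<Rightarrow> 'n) \<Rightarrow> bool" where
  "derived_rel T R \<tau> w f g \<longleftrightarrow> f \<in> derived_tree T R \<tau> w \<and> g \<in> derived_tree T R \<tau> w \<and>
      (\<forall>i<\<tau>. R (f i) (g i))"

definition chi_free :: "'n set \<Rightarrow> ('n \<Rightarrow> 'n \<Rightarrow> bool) \<Rightarrow> 'k::wellorder \<Rightarrow> bool" where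
  "chi_free T R \<chi> \<longleftrightarrow> (\<forall>\<tau>::'k. (\<exists>\<beta>. \<beta> < \<tau>) \<longrightarrow> \<tau> < \<chi> \<longrightarrow>
     (\<forall>(\<beta>::'k) w. inj_on w (below \<tau>) \<and> w ` below \<tau> \<subseteq> level T R \<beta> \<longrightarrow>
        souslin TYPE('k) (derived_tree T R \<tau> w) (derived_rel T R \<tau> w)))"

definition cobounded :: "'k::wellorder \<Rightarrow> 'k set \<Rightarrow> bool" where
  "cobounded \<theta> Z \<longleftrightarrow> (\<exists>j<\<theta>. \<forall>i. j \<le> i \<longrightarrow> i < \<theta> \<longrightarrow> i \<in> Z)"

definition ascent_path :: "'n set \<Rightarrow> ('n \<Rightarrow> 'n \<Rightarrow> bool) \<Rightarrow> 'k::wellorder \<Rightarrow>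
    ('k \<Rightarrow> 'k option) set \<Rightarrow> (('k \<Rightarrow> 'k option) \<Rightarrow> 'k \<Rightarrow> 'n) \<Rightarrow> bool" where
  "ascent_path T R \<theta> X f \<longleftrightarrow>
     (\<forall>x\<in>X. \<forall>\<alpha>. dom x = below \<alpha> \<longrightarrow> (\<forall>i<\<theta>. f x i \<in> level T R \<alpha>)) \<and>
     (\<forall>x\<in>X. \<forall>y\<in>X. x \<subseteq>\<^sub>m y \<and> x \<noteq> y \<longrightarrow> cobounded \<theta> {i. i < \<theta> \<and> R (f x i) (f y i)}) \<and>
     (\<forall>\<alpha>. \<forall>x\<in>X. \<forall>y\<in>X. dom x = below \<alpha> \<longrightarrow> dom y = below \<alpha> \<longrightarrow> x \<noteq> y \<longrightarrow>
        cobounded \<theta> {i. i < \<theta> \<and> f x i \<noteq> f y i})"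

end

theory Submission
  imports Defs
begin

text \<open>
  The tree is built level by level from sequences of length below \<open>\<kappa>\<close>.  Along with the level \<open>T\<^sub>\<alpha>\<close> one
  chooses, for each \<open>x \<in> X\<^sub>\<alpha>\<close>, \<open>i < \<theta>\<close> and each node \<open>y\<close> below or at level \<open>\<alpha>\<close>, a node \<open>F\<^sub>\<alpha> x i y\<close>
  extending \<open>y\<close>, such that for every \<open>\<beta> \<le> \<alpha>\<close> the node \<open>F\<^sub>\<beta> (x|\<beta>) i y\<close> lies below \<open>F\<^sub>\<alpha> x i y\<close> for
  all but boundedly many \<open>i\<close>; taking for \<open>y\<close> the root gives the ascent path.  At a limit \<open>\<alpha>\<close> whose
  club is coherent, \<open>F\<^sub>\<alpha> x i y\<close> is a union along \<open>C\<^sub>\<alpha>\<close>: at accumulation points coherence forces the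
  path to agree with the nodes already chosen, and at a successor point \<open>\<gamma>\<close> of \<open>C\<^sub>\<alpha>\<close> the path follows
  the old nodes for all large \<open>i\<close>, except for fewer than \<open>\<theta>\<close> indices that the diamond sequence at
  \<open>\<gamma>\<close> names, and which are steered jointly into a guessed dense set.  A tuple of nodes of \<open>T\<^sub>\<alpha>\<close> is
  named before \<open>\<alpha>\<close> because the maps \<open>b\<^sup>\<alpha>\<close> represent each \<open>x \<in> X\<^sub>\<alpha>\<close> by some \<open>z \<in> X\<restriction>C\<^sub>\<alpha>\<close>.  At the
  other limits \<open>C\<^sub>\<alpha>\<close> has fewer than \<open>\<theta>\<close> points, so the exceptional indices have a common bound below
  \<open>\<theta>\<close>, and no dense set needs to be met there since its successor points are successor ordinals.
\<close>

unbundle cardinal_syntax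

section \<open>Small sets, closed unbounded sets and tuples\<close>

text \<open>Two demands compete at a limit \<open>\<alpha>\<close>: sealing has to alter the paths,
  while \<open>F\<close> at \<open>\<alpha>\<close> must agree with every earlier \<open>F\<close>
  at all but boundedly many indices. Both can be met because a guess names fewer than \<theta>
  paths, hence by regularity disturbs a bounded set of indices only, and because the disturbances do
  not pile up: at an accumulation point the path is \<open>F\<close> itself, so comparing path and
  \<open>F\<close> elsewhere needs only the predecessor in \<open>C\<close>. The bound
  \<open>min \<eta> \<theta>\<close> has two origins. Length below \<theta> keeps the disturbance
  bounded; length below \<eta> makes the names of a tuple, at a level of cofinality at least \<eta>,
  bounded below that level, so that one successor point knows them all. Limits of smaller cofinality
  need no sealing and receive every branch, which gives \<eta>-completeness; the arithmetic
  hypothesis keeps them small. Steering one coordinate never conflicts with another: above distinct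
  nodes the values of the paths differ already, so no path is named twice.\<close>

definition small :: "'k::wellorder itself \<Rightarrow> 'a set \<Rightarrow> bool" where
  "small K A \<longleftrightarrow> |A| <o |UNIV :: 'k set|"

text \<open>The value \<open>undefined\<close> outside \<open>below \<tau>\<close> makes a tuple
  determined by its entries, as for \<open>funcs_to\<close> and for the nodes of a derived
  tree.\<close>

definition tup :: "'k::wellorder \<Rightarrow> 'a set \<Rightarrow> ('k \<Rightarrow> 'a) set" where
  "tup \<tau> Y = {q. (\<forall>k<\<tau>. q k \<in> Y) \<and> (\<forall>k. \<not> k < \<tau> \<longrightarrow> q k = undefined)}"

lemma mem_below [simp]: "\<beta> \<in> below \<alpha> \<longleftrightarrow> \<beta> < \<alpha>"
  by (simp add: below_def)

lemma below_Int [simp]: "below \<alpha> \<inter> below \<beta> = below (min \<alpha> \<beta>)"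
  by auto

lemma below_inj [simp]: "below \<alpha> = below \<beta> \<longleftrightarrow> \<alpha> = \<beta>"
  by (metis mem_below not_less_iff_gr_or_eq)

lemma below_subset [simp]: "below \<alpha> \<subseteq> below \<beta> \<longleftrightarrow> \<alpha> \<le> \<beta>"
  by (auto simp: subset_iff intro: leI less_le_trans)

lemma small_subset: "small K B \<Longrightarrow> A \<subseteq> B \<Longrightarrow> small K A"
  unfolding small_def using card_of_mono1 ordLeq_ordLess_trans by blast

lemma small_image: "small K A \<Longrightarrow> small K (f ` A)"
  unfolding small_def using card_of_image ordLeq_ordLess_trans by blast

lemma small_inj_on: "inj_on f A \<Longrightarrow> f ` A \<subseteq> B \<Longrightarrow> small K B \<Longrightarrow> small K A"
  unfolding small_def using card_of_ordLeq[of A B] ordLeq_ordLess_trans by blast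

lemma not_card_of_ordLeq: "\<not> |A| \<le>o |B| \<Longrightarrow> |B| <o |A|"
  by (simp add: card_of_Well_order not_ordLeq_iff_ordLess[symmetric])

lemma finite_ordLess_infinite_sets: "finite A \<Longrightarrow> infinite C \<Longrightarrow> |A| <o |C|"
  by (rule not_card_of_ordLeq) (auto dest: card_of_ordLeq_finite)

lemma Times_ordLess_infinite:
  assumes "infinite C" "|A| <o |C|" "|B| <o |C|"
  shows "|A \<times> B| <o |C|"
proof (cases "finite (A \<times> B)")
  case True
  then show ?thesis using finite_ordLess_infinite_sets assms(1) by auto
next
  case False
  then have ne: "A \<noteq> {}" "B \<noteq> {}" and inf: "infinite A \<or> infinite B" by auto
  show ?thesis
  proof (cases "|B| \<le>o |A|")
    case True
    then have "infinite A" using inf card_of_ordLeq_finite[OF True] by auto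
    then have "|A \<times> B| =o |A|" using card_of_Times_infinite[OF _ ne(2) True] by auto
    then show ?thesis using assms(2) by (rule ordIso_ordLess_trans)
  next
    case False
    then have le: "|A| \<le>o |B|" by (intro ordLess_imp_ordLeq not_card_of_ordLeq)
    then have "infinite B" using inf card_of_ordLeq_finite[OF le] by auto
    then have "|A \<times> B| =o |B|" using card_of_Times_infinite[OF _ ne(1) le] by auto
    then show ?thesis using assms(3) by (rule ordIso_ordLess_trans)
  qed
qed

section \<open>Bounds below regular ordinals and at points of large cofinality\<close>

lemma regular_ord_bounded:
  assumes "regular_ord \<theta>" "S \<subseteq> below \<theta>" "|S| <o |below \<theta>|"
  shows "\<exists>j<\<theta>. \<forall>i\<in>S. i < j"
proof (rule ccontr)
  assume "\<not> ?thesis"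
  then have "\<forall>\<beta><\<theta>. \<exists>\<delta>\<in>S. \<beta> \<le> \<delta>" by (meson leI)
  then have "|below \<theta>| \<le>o |S|" using assms by (auto simp: regular_ord_def)
  then show False using assms(3) not_ordLess_ordLeq by blast
qed

lemma is_card_less: "is_card \<theta> \<Longrightarrow> \<tau> < \<theta> \<Longrightarrow> |below \<tau>| <o |below \<theta>|"
  by (simp add: is_card_def)

text \<open>Indices in a guessed tuple range over all of \<kappa>, hence the clause
  \<open>h k < \<theta>\<close>: only the values below \<theta> can and need be bounded.\<close>

lemma regular_ord_image_bounded:
  assumes "regular_ord \<theta>" "\<tau> < \<theta>"
  shows "\<exists>j<\<theta>. \<forall>k<\<tau>. h k < \<theta> \<longrightarrow> h k < j"
proof -
  let ?S = "h ` below \<tau> \<inter> below \<theta>"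
  have "|?S| \<le>o |h ` below \<tau>|" by (intro card_of_mono1) auto
  also have "|h ` below \<tau>| \<le>o |below \<tau>|" by (rule card_of_image)
  also have "|below \<tau>| <o |below \<theta>|" using assms is_card_less by (auto simp: regular_ord_def)
  finally have "|?S| <o |below \<theta>|" .
  from regular_ord_bounded[OF assms(1) _ this] obtain j where "j<\<theta>" "\<forall>i\<in>?S. i<j" by auto
  then show ?thesis by (intro exI[of _ j]) auto
qed

text \<open>No finite set is cofinal in such an ordinal; the empty set shows that it is not zero,
  and singletons that it is not a successor.\<close>

lemma E_ge_limit:
  assumes "\<alpha> \<in> E_ge \<eta>" "infinite (below \<eta>)"
  shows "is_limit \<alpha>"
proof -
  have fin: "\<exists>\<beta><\<alpha>. \<forall>\<delta>\<in>A. \<delta> < \<beta>" if "finite A" "A \<subseteq> below \<alpha>" for A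
  proof (rule ccontr)
    assume "\<not> ?thesis"
    then have "\<forall>\<beta><\<alpha>. \<exists>\<delta>\<in>A. \<beta> \<le> \<delta>" by (meson leI)
    then have "|below \<eta>| \<le>o |A|" using assms that by (auto simp: E_ge_def)
    then show False using assms that card_of_ordLeq_finite by blast
  qed
  show ?thesis unfolding is_limit_def using fin[of "{}"] fin[of "{_}"] by auto
qed

lemma E_ge_bounded:
  assumes "\<alpha> \<in> E_ge \<eta>" "is_card \<eta>" "\<tau> < \<eta>" "\<forall>k<\<tau>. h k < \<alpha>"
  shows "\<exists>\<rho><\<alpha>. \<forall>k<\<tau>. h k < \<rho>"
proof (rule ccontr)
  assume "\<not> ?thesis"
  then have "\<forall>\<beta><\<alpha>. \<exists>\<delta>\<in>h ` below \<tau>. \<beta> \<le> \<delta>" by (fastforce simp: not_less)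
  moreover have "h ` below \<tau> \<subseteq> below \<alpha>" using assms(4) by auto
  ultimately have "|below \<eta>| \<le>o |h ` below \<tau>|" using assms(1) by (auto simp: E_ge_def)
  also have "|h ` below \<tau>| \<le>o |below \<tau>|" by (rule card_of_image)
  also have "|below \<tau>| <o |below \<eta>|" using assms is_card_less by auto
  finally show False by (simp add: ordLess_irreflexive)
qed

section \<open>Regularity of \<kappa>: small unions and closure points\<close>

locale regular_uncountable =
  fixes K :: "'k::wellorder itself"
  assumes reg: "regular_type K"
    and uncountable: "\<exists>\<omega>::'k. infinite (below \<omega>)"
begin

lemma inf_UNIV: "infinite (UNIV :: 'k set)"
  using reg by (simp add: regular_type_def)

lemma small_below [simp]: "small K (below (\<alpha>::'k))"
  using reg by (simp add: regular_type_def small_def)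

lemma small_bounded:
  assumes "small K (A :: 'k set)"
  shows "\<exists>l. \<forall>a\<in>A. a < l"
proof (rule ccontr)
  assume "\<not> ?thesis"
  then have "\<forall>\<beta>. \<exists>\<delta>\<in>A. \<beta> \<le> \<delta>" by (meson leI)
  then have "|UNIV::'k set| \<le>o |A|" using reg by (simp add: regular_type_def)
  then show False using assms not_ordLess_ordLeq by (auto simp: small_def)
qed

lemma bounded_small: "\<forall>a\<in>A. a < (l::'k) \<Longrightarrow> small K A"
  by (rule small_subset[OF small_below, of _ l]) auto

lemma small_finite: "finite A \<Longrightarrow> small K A"
  using inf_UNIV unfolding small_def by (rule finite_ordLess_infinite_sets[rotated])

lemma no_max: "\<exists>\<beta>. (\<alpha>::'k) < \<beta>"
  using small_bounded[of "{\<alpha>}"] small_finite by blast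

lemma small_Un: "small K A \<Longrightarrow> small K B \<Longrightarrow> small K (A \<union> B)"
  unfolding small_def using card_of_Un_ordLess_infinite[OF inf_UNIV] by blast

lemma small_Times: "small K A \<Longrightarrow> small K B \<Longrightarrow> small K (A \<times> B)"
  unfolding small_def using Times_ordLess_infinite[OF inf_UNIV] by blast

lemma small_embed:
  assumes "small K A"
  obtains h :: "_ \<Rightarrow> 'k" and l where "inj_on h A" "h ` A \<subseteq> below l"
proof -
  obtain h :: "_ \<Rightarrow> 'k" where h: "inj_on h A"
    using assms unfolding small_def by (meson card_of_ordLeq ordLess_imp_ordLeq)
  obtain l where "\<forall>a\<in>h ` A. a < l" using small_bounded[OF small_image[OF assms]] by blast
  then have "h ` A \<subseteq> below l" by auto
  then show ?thesis using that[OF h] by blast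
qed

text \<open>Each \<open>A i\<close> embeds into some \<open>below (l i)\<close>, and by regularity
  the bounds \<open>l i\<close> have a common bound \<open>m\<close>; so the union is covered by an
  image of a subset of \<open>I \<times> below m\<close>.\<close>

lemma small_UN:
  assumes "small K I" "\<And>i. i \<in> I \<Longrightarrow> small K (A i)"
  shows "small K (\<Union>i\<in>I. A i)"
proof -
  have "\<forall>i\<in>I. \<exists>h::_ \<Rightarrow> 'k. \<exists>l. inj_on h (A i) \<and> h ` A i \<subseteq> below l"
    using assms(2) small_embed by metis
  then obtain h l where h: "\<And>i. i \<in> I \<Longrightarrow> inj_on (h i :: _ \<Rightarrow> 'k) (A i) \<and> h i ` A i \<subseteq> below (l i)"
    by metis
  obtain m where m: "\<forall>a\<in>l ` I. a < m" using small_bounded[OF small_image[OF assms(1)]] by blast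
  have "small K (I \<times> below m)" using assms(1) by (intro small_Times) auto
  moreover have "(SIGMA i:I. h i ` A i) \<subseteq> I \<times> below m"
  proof (rule subsetI, clarsimp)
    fix i a assume "i \<in> I" "a \<in> A i"
    then have "h i a \<in> below (l i)" "l i < m" using h[of i] m by blast+
    then show "h i a < m" by auto
  qed
  moreover have "(\<Union>i\<in>I. A i) \<subseteq> (\<lambda>(i,a). inv_into (A i) (h i) a) ` (SIGMA i:I. h i ` A i)"
  proof
    fix a assume "a \<in> (\<Union>i\<in>I. A i)"
    then obtain i where "i\<in>I" "a \<in> A i" by auto
    then show "a \<in> (\<lambda>(i,a). inv_into (A i) (h i) a) ` (SIGMA i:I. h i ` A i)"
      using h[of i] by (intro image_eqI[of _ _ "(i, h i a)"]) (simp_all add: inv_into_f_f)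
  qed
  ultimately show ?thesis by (meson small_image small_subset)
qed

lemma small_UN_le:
  assumes "\<And>i::'k. i \<le> \<alpha> \<Longrightarrow> small K (A i)"
  shows "small K (\<Union>i\<in>{..\<alpha>}. A i)"
proof (rule small_UN)
  obtain \<beta> where "\<alpha> < \<beta>" using no_max by blast
  then show "small K {..\<alpha>}" by (intro bounded_small[of _ \<beta>]) auto
qed (use assms in auto)

lemma club_closure:
  fixes g :: "'k \<Rightarrow> 'k"
  shows "club {\<alpha>. \<delta> < \<alpha> \<and> (\<forall>\<beta><\<alpha>. g \<beta> < \<alpha>)}" (is "club ?E")
  unfolding club_def
proof safe
  fix \<beta>0 :: 'k
  \<comment> \<open>\<open>g\<close> need not be monotone, so one step of the iteration has to
    dominate \<open>g\<close> on all arguments up to \<beta>.\<close>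
  have "\<exists>\<gamma>>\<beta>. \<forall>\<beta>'\<le>\<beta>. g \<beta>' < \<gamma>" for \<beta>
  proof -
    have "small K (\<Union>i\<in>{..\<beta>}. {g i})"
      by (rule small_UN_le) (simp add: small_finite)
    then have "small K ((\<Union>i\<in>{..\<beta>}. {g i}) \<union> {\<beta>})"
      by (rule small_Un) (simp add: small_finite)
    then obtain \<gamma> where "\<forall>a\<in>(\<Union>i\<in>{..\<beta>}. {g i}) \<union> {\<beta>}. a < \<gamma>"
      using small_bounded by blast
    then show ?thesis by auto
  qed
  then obtain s where s: "\<And>\<beta>. s \<beta> > \<beta>" "\<And>\<beta> \<beta>'. \<beta>' \<le> \<beta> \<Longrightarrow> g \<beta>' < s \<beta>" by metis
  define a where "a n = (s ^^ n) (s (max \<delta> \<beta>0))" for n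
  \<comment> \<open>Uncountability of \<kappa> enters here: a sequence of length \<omega> is
    bounded.\<close>
  have "small K (range a)"
  proof -
    obtain \<omega> :: 'k where "infinite (below \<omega>)" using uncountable by blast
    then have "|UNIV :: nat set| \<le>o |below \<omega>|"
      using infinite_iff_card_of_nat by blast
    then have "small K (UNIV::nat set)"
      using small_below[of \<omega>] unfolding small_def by (rule ordLeq_ordLess_trans)
    then show ?thesis by (rule small_image)
  qed
  then obtain l where l: "\<forall>x\<in>range a. x < l" using small_bounded by blast
  define \<alpha> where "\<alpha> = (LEAST l. \<forall>n. a n < l)"
  have al: "\<forall>n. a n < \<alpha>" unfolding \<alpha>_def by (rule LeastI[of _ l]) (use l in auto)
  have least: "\<exists>n. \<beta> \<le> a n" if "\<beta> < \<alpha>" for \<beta>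
    using not_less_Least[OF that[unfolded \<alpha>_def]] leI by blast
  have "a 0 < \<alpha>" using al by blast
  moreover have "a 0 > max \<delta> \<beta>0" by (simp add: a_def s)
  moreover have "g \<beta> < \<alpha>" if "\<beta> < \<alpha>" for \<beta>
  proof -
    obtain n where "\<beta> \<le> a n" using least[OF \<open>\<beta> < \<alpha>\<close>] by blast
    then have "g \<beta> < a (Suc n)" by (simp add: a_def s)
    then show ?thesis using al less_trans by blast
  qed
  ultimately show "\<exists>\<gamma>\<in>?E. \<beta>0 \<le> \<gamma>" by (intro bexI[of _ \<alpha>]) auto
next
  fix \<gamma> assume c: "cofinal_in ?E \<gamma>"
  then obtain \<beta> where "\<beta> < \<gamma>" by (auto simp: cofinal_in_def)
  with c obtain \<alpha> where "\<alpha> \<in> ?E" "\<alpha> < \<gamma>" unfolding cofinal_in_def by blast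
  then have "\<delta> < \<alpha>" by blast
  then show "\<delta> < \<gamma>" using \<open>\<alpha> < \<gamma>\<close> by (rule less_trans)
next
  fix \<gamma> \<beta> assume "cofinal_in ?E \<gamma>" "\<beta> < \<gamma>"
  then obtain \<alpha> where "\<alpha> \<in> ?E" "\<beta> < \<alpha>" "\<alpha> < \<gamma>" unfolding cofinal_in_def by blast
  then have "g \<beta> < \<alpha>" by blast
  then show "g \<beta> < \<gamma>" using \<open>\<alpha> < \<gamma>\<close> by simp
qed

lemma stationary_meets_closure:
  assumes "stationary S"
  obtains \<alpha> where "\<alpha> \<in> S" "(\<delta>::'k) < \<alpha>" "\<And>\<beta>. \<beta> < \<alpha> \<Longrightarrow> g \<beta> < \<alpha>"
  using assms club_closure[of \<delta> g] unfolding stationary_def by blast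

end

section \<open>Counting tuples shorter than \<eta>\<close>

locale tuple_arith = regular_uncountable K for K :: "'k::wellorder itself" +
  fixes \<eta> :: 'k
  assumes eta_inf: "infinite (below \<eta>)" and eta_card: "is_card \<eta>"
    and exp: "\<forall>lam::'k. |SIGMA \<mu>:below \<eta>. funcs_to \<mu> lam| <o |UNIV::'k set|"
begin

lemma tuples_image:
  assumes "inj_on h Y"
  shows "inj_on (\<lambda>(\<tau>,q). (\<tau>, \<lambda>k. if k < \<tau> then h (q k) else undefined)) (SIGMA \<tau>:below \<eta>. tup \<tau> Y)"
proof -
  have "q k = q' k"
    if q: "q \<in> tup \<tau> Y" "q' \<in> tup \<tau> Y"
      and eq: "(\<lambda>k. if k < \<tau> then h (q k) else undefined) = (\<lambda>k. if k < \<tau> then h (q' k) else undefined)"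
    for \<tau> :: 'k and q q' k
  proof (cases "k < \<tau>")
    case True
    then have "h (q k) = h (q' k)" using fun_cong[OF eq, of k] by simp
    moreover have "q k \<in> Y" "q' k \<in> Y" using q True by (simp_all add: tup_def)
    ultimately show ?thesis using assms by (simp add: inj_on_def)
  next
    case False
    then show ?thesis using q by (simp add: tup_def)
  qed
  then show ?thesis unfolding inj_on_def by (safe; simp; blast)
qed

lemma small_tuples:
  assumes "small K Y"
  shows "small K (SIGMA \<tau>:below \<eta>. tup \<tau> Y)"
proof -
  obtain h :: "_ \<Rightarrow> 'k" and l where h: "inj_on h Y" "h ` Y \<subseteq> below l" using small_embed[OF assms] .
  show ?thesis
  proof (rule small_inj_on[OF tuples_image[OF h(1)]])
    show "small K (SIGMA \<mu>:below \<eta>. funcs_to \<mu> l)" using exp by (simp add: small_def)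
    show "(\<lambda>(\<tau>,q). (\<tau>, \<lambda>k. if k < \<tau> then h (q k) else undefined)) ` (SIGMA \<tau>:below \<eta>. tup \<tau> Y) \<subseteq> (SIGMA \<mu>:below \<eta>. funcs_to \<mu> l)"
      using h(2) by (auto simp: tup_def funcs_to_def image_subset_iff)
  qed
qed

lemma small_tup: "small K Y \<Longrightarrow> \<tau> < \<eta> \<Longrightarrow> small K (tup \<tau> Y)"
  using small_image[OF small_tuples[of Y], of snd] by (rule small_subset) force+

text \<open>By regularity a tuple shorter than \<eta> is bounded in \<kappa>, so the tuples form a
  union of \<kappa> many sets, each small by the arithmetic hypothesis.\<close>

lemma tuples_ordLeq:
  assumes "|Y| \<le>o |UNIV::'k set|"
  shows "|SIGMA \<tau>:below \<eta>. tup \<tau> Y| \<le>o |UNIV::'k set|"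
proof -
  obtain h :: "_ \<Rightarrow> 'k" where h: "inj_on h Y" using assms card_of_ordLeq by metis
  have "(SIGMA \<tau>:below \<eta>. tup \<tau> Y) \<subseteq> (\<Union>l. SIGMA \<tau>:below \<eta>. tup \<tau> {y\<in>Y. h y < l})"
  proof clarify
    fix \<tau> q assume q: "q \<in> tup \<tau> Y" "\<tau> \<in> below \<eta>"
    obtain l where "\<forall>a\<in>(h \<circ> q) ` below \<tau>. a < l"
      using small_bounded[OF small_image[OF small_below]] by blast
    then have "q \<in> tup \<tau> {y\<in>Y. h y < l}" using q by (auto simp: tup_def)
    then show "(\<tau>, q) \<in> (\<Union>l. SIGMA \<tau>:below \<eta>. tup \<tau> {y\<in>Y. h y < l})"
      using q by blast
  qed
  then have "|SIGMA \<tau>:below \<eta>. tup \<tau> Y| \<le>o |\<Union>l. SIGMA \<tau>:below \<eta>. tup \<tau> {y\<in>Y. h y < l}|"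
    by (rule card_of_mono1)
  also have "|\<Union>l. SIGMA \<tau>:below \<eta>. tup \<tau> {y\<in>Y. h y < l}| \<le>o |UNIV::'k set|"
  proof (rule card_of_UNION_ordLeq_infinite[OF inf_UNIV])
    show "\<forall>l\<in>UNIV. |SIGMA \<tau>:below \<eta>. tup \<tau> {y\<in>Y. h y < l}| \<le>o |UNIV::'k set|"
    proof
      fix l
      have "small K {y\<in>Y. h y < l}"
        by (rule small_inj_on[of h _ "below l"]) (auto intro: inj_on_subset[OF h])
      from small_tuples[OF this] show "|SIGMA \<tau>:below \<eta>. tup \<tau> {y\<in>Y. h y < l}| \<le>o |UNIV::'k set|"
        by (simp add: small_def ordLess_imp_ordLeq)
    qed
  qed (rule ordLeq_refl, rule card_of_Card_order)
  finally show ?thesis .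
qed

end

section \<open>Guessing by diamond\<close>

context regular_uncountable
begin

lemma club_Int_above:
  assumes "club (E :: 'k set)"
  shows "club (E \<inter> {\<gamma>. \<delta> < \<gamma>})"
  unfolding club_def
proof (intro conjI allI impI)
  fix \<beta> :: 'k
  obtain \<beta>' where "max \<beta> \<delta> < \<beta>'" using no_max by blast
  moreover obtain \<gamma> where "\<gamma> \<in> E" "\<beta>' \<le> \<gamma>" using assms unfolding club_def by blast
  ultimately show "\<exists>\<gamma>\<in>E \<inter> {\<gamma>. \<delta> < \<gamma>}. \<beta> \<le> \<gamma>" by (intro bexI[of _ \<gamma>]) auto
next
  fix \<gamma> assume c: "cofinal_in (E \<inter> {\<gamma>. \<delta> < \<gamma>}) \<gamma>"
  then have "cofinal_in E \<gamma>" unfolding cofinal_in_def by blast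
  moreover obtain \<alpha> where "\<delta> < \<alpha>" "\<alpha> < \<gamma>" using c unfolding cofinal_in_def by blast
  ultimately show "\<gamma> \<in> E \<inter> {\<gamma>. \<delta> < \<gamma>}" using assms unfolding club_def by (auto dest: less_trans)
qed

lemma stationary_superset: "stationary S \<Longrightarrow> S \<subseteq> S' \<Longrightarrow> stationary S'"
  unfolding stationary_def by blast

lemma stationary_Int_above:
  assumes "stationary (S :: 'k set)"
  shows "stationary (S \<inter> {\<gamma>. \<delta> < \<gamma>})"
  unfolding stationary_def
proof (intro allI impI)
  fix E :: "'k set" assume "club E"
  then have "S \<inter> (E \<inter> {\<gamma>. \<delta> < \<gamma>}) \<noteq> {}"
    using assms club_Int_above unfolding stationary_def by blast
  then show "S \<inter> {\<gamma>. \<delta> < \<gamma>} \<inter> E \<noteq> {}" by blast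
qed

lemma pairing: obtains p :: "'k \<times> 'k \<Rightarrow> 'k" where "inj p"
proof -
  have "|(UNIV::'k set) \<times> (UNIV::'k set)| =o |UNIV::'k set|"
    using card_of_Times_same_infinite[OF inf_UNIV] .
  then have "|UNIV::('k \<times> 'k) set| \<le>o |UNIV::'k set|" by (simp add: ordIso_iff_ordLeq)
  then obtain p :: "'k \<times> 'k \<Rightarrow> 'k" where "inj p" unfolding card_of_ordLeq[symmetric] by blast
  then show ?thesis by (rule that)
qed

text \<open>Every bounded subset of \<open>\<kappa>\<close> occurs in the diamond sequence, and a node is coded by its graph.\<close>

lemma card_seq_below:
  assumes "diamond K"
  shows "|{t :: 'k \<Rightarrow> 'k option. seq_below t}| \<le>o |UNIV :: 'k set|"
proof -
  obtain A :: "'k \<Rightarrow> 'k set" where A: "\<And>Z. stationary {\<alpha>. Z \<inter> below \<alpha> = A \<alpha>}"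
    using assms unfolding diamond_def by blast
  obtain p :: "'k \<times> 'k \<Rightarrow> 'k" where p: "inj p" by (rule pairing)
  define G where "G t = {p (\<xi>, v) | \<xi> v. t \<xi> = Some v}" for t
  have "\<exists>\<alpha>. G t = A \<alpha>" if t: "seq_below t" for t
  proof -
    obtain \<alpha> where d: "dom t = below \<alpha>" using t unfolding seq_below_def by blast
    have "G t \<subseteq> (\<lambda>\<xi>. p (\<xi>, the (t \<xi>))) ` below \<alpha>"
      unfolding G_def d[symmetric] by force
    then have "small K (G t)" using small_subset[OF small_image[OF small_below]] by simp
    then obtain l where l: "\<forall>a\<in>G t. a < l" using small_bounded by blast
    \<comment> \<open>A correct guess beyond the bound \<open>l\<close> already sees all of
      \<open>G t\<close>.\<close>
    obtain \<gamma> where "\<gamma> \<in> {\<alpha>. G t \<inter> below \<alpha> = A \<alpha>}" "l < \<gamma>"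
      by (rule stationary_meets_closure[OF A[of "G t"], of l id])
    moreover have "G t \<inter> below \<gamma> = G t" using l \<open>l < \<gamma>\<close> by (auto intro: less_trans)
    ultimately show ?thesis by auto
  qed
  then obtain f where f: "\<And>t. seq_below t \<Longrightarrow> G t = A (f t)" by metis
  have "inj_on f {t. seq_below t}"
  proof (rule inj_onI, clarify)
    fix t t' assume "seq_below t" "seq_below t'" "f t = f t'"
    then have eq: "G t = G t'" using f by metis
    have mem: "p (\<xi>, v) \<in> G t \<longleftrightarrow> t \<xi> = Some v" for t \<xi> v
      unfolding G_def using p by (auto simp: inj_eq)
    have iff: "t \<xi> = Some v \<longleftrightarrow> t' \<xi> = Some v" for \<xi> v
      unfolding mem[symmetric] eq ..
    show "t = t'"
    proof
      show "t \<xi> = t' \<xi>" for \<xi> using iff by (metis option.exhaust)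
    qed
  qed
  then show ?thesis by (rule card_of_ordLeqI) simp
qed

text \<open>One guessed set carries both objects: \<open>o0\<close> tags the codes of elements of
  \<open>D\<close> and \<open>o1\<close> the code of \<open>s\<close>. Only the part below \<gamma>
  is guessed, so an element \<open>d\<close> is recovered once \<gamma> exceeds its code
  \<open>g d\<close>, and the stationary set is cut to points beyond the code of
  \<open>s\<close>.\<close>

lemma diamond_guess:
  assumes "diamond K" "|U| \<le>o |UNIV :: 'k set|" "|V| \<le>o |UNIV :: 'k set|" "V \<noteq> {}"
  obtains Om :: "'k \<Rightarrow> 'a set" and psi :: "'k \<Rightarrow> 'b" where
    "\<And>\<gamma>. psi \<gamma> \<in> V"
    "\<And>D s. D \<subseteq> U \<Longrightarrow> s \<in> V \<Longrightarrow>
      \<exists>g::'a \<Rightarrow> 'k. stationary {\<gamma>. psi \<gamma> = s \<and> Om \<gamma> \<subseteq> D \<and> (\<forall>d\<in>D. g d < \<gamma> \<longrightarrow> d \<in> Om \<gamma>)}"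
proof -
  obtain A :: "'k \<Rightarrow> 'k set" where A: "\<And>Z. stationary {\<alpha>. Z \<inter> below \<alpha> = A \<alpha>}"
    using assms(1) unfolding diamond_def by blast
  obtain p :: "'k \<times> 'k \<Rightarrow> 'k" where "inj p" by (rule pairing)
  then have p [simp]: "p x = p y \<longleftrightarrow> x = y" for x y by (auto dest: injD)
  obtain cU :: "'a \<Rightarrow> 'k" where cU: "inj_on cU U" using assms(2) card_of_ordLeq by metis
  obtain cV :: "'b \<Rightarrow> 'k" where cV: "inj_on cV V" using assms(3) card_of_ordLeq by metis
  obtain o0 o1 :: 'k where "o0 < o1" using no_max by blast
  then have o01 [simp]: "o0 \<noteq> o1" "o1 \<noteq> o0" by auto
  define Om where "Om \<gamma> = {d \<in> U. p (o0, cU d) \<in> A \<gamma>}" for \<gamma>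
  \<comment> \<open>The default keeps \<open>psi\<close> inside \<open>V\<close> even where nothing
    sensible is guessed; this later bounds the length of every guessed tuple by \<theta>, not just
    of the correct ones.\<close>
  define psi where "psi \<gamma> = (if \<exists>s\<in>V. p (o1, cV s) \<in> A \<gamma> then SOME s. s \<in> V \<and> p (o1, cV s) \<in> A \<gamma> else SOME s. s \<in> V)" for \<gamma>
  show ?thesis
  proof (rule that)
    fix \<gamma>
    show "psi \<gamma> \<in> V"
    proof (cases "\<exists>s\<in>V. p (o1, cV s) \<in> A \<gamma>")
      case True
      then have "\<exists>s. s \<in> V \<and> p (o1, cV s) \<in> A \<gamma>" by blast
      from someI_ex[OF this] True show ?thesis by (simp add: psi_def)
    next
      case False
      then show ?thesis using assms(4) by (simp add: psi_def some_in_eq)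
    qed
  next
    fix D s assume D: "D \<subseteq> U" and s: "s \<in> V"
    define Z where "Z = (\<lambda>d. p (o0, cU d)) ` D \<union> {p (o1, cV s)}"
    let ?g = "\<lambda>d. p (o0, cU d)"
    have "{\<alpha>. Z \<inter> below \<alpha> = A \<alpha>} \<inter> {\<gamma>. p (o1, cV s) < \<gamma>}
        \<subseteq> {\<gamma>. psi \<gamma> = s \<and> Om \<gamma> \<subseteq> D \<and> (\<forall>d\<in>D. ?g d < \<gamma> \<longrightarrow> d \<in> Om \<gamma>)}"
    proof clarify
      fix \<gamma> assume ZA: "Z \<inter> below \<gamma> = A \<gamma>" and less: "p (o1, cV s) < \<gamma>"
      have memA: "x \<in> A \<gamma> \<longleftrightarrow> x \<in> Z \<and> x < \<gamma>" for x using ZA by (metis IntE IntI mem_below)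
      have 1: "s' \<in> V \<and> p (o1, cV s') \<in> A \<gamma> \<longleftrightarrow> s' = s" for s'
      proof
        assume *: "s' \<in> V \<and> p (o1, cV s') \<in> A \<gamma>"
        then have "cV s' = cV s" unfolding memA Z_def by auto
        then show "s' = s" using inj_onD[OF cV] * s by blast
      qed (use s less in \<open>simp add: memA Z_def\<close>)
      then have "psi \<gamma> = s" unfolding psi_def by auto
      moreover have "Om \<gamma> \<subseteq> D"
      proof
        fix d assume "d \<in> Om \<gamma>"
        then have "d \<in> U" "p (o0, cU d) \<in> Z" by (simp_all add: Om_def memA)
        then obtain d' where "d' \<in> D" "cU d = cU d'" by (auto simp: Z_def)
        then show "d \<in> D" using inj_onD[OF cU] D \<open>d \<in> U\<close> by blast
      qed
      moreover have "\<forall>d\<in>D. ?g d < \<gamma> \<longrightarrow> d \<in> Om \<gamma>"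
        using D by (auto simp: Om_def memA Z_def)
      ultimately show "psi \<gamma> = s \<and> Om \<gamma> \<subseteq> D \<and> (\<forall>d\<in>D. ?g d < \<gamma> \<longrightarrow> d \<in> Om \<gamma>)" by blast
    qed
    from stationary_superset[OF stationary_Int_above[OF A] this]
    show "\<exists>g::'a \<Rightarrow> 'k. stationary {\<gamma>. psi \<gamma> = s \<and> Om \<gamma> \<subseteq> D \<and> (\<forall>d\<in>D. g d < \<gamma> \<longrightarrow> d \<in> Om \<gamma>)}"
      by (rule exI[of _ ?g])
  qed
qed

end

section \<open>The recursive construction\<close>

type_synonym 'k node = "'k \<Rightarrow> 'k option"
type_synonym 'k chooser = "'k node \<Rightarrow> 'k \<Rightarrow> 'k node \<Rightarrow> 'k node"

text \<open>The union of the graphs when \<open>S\<close> is a chain; for other \<open>S\<close> the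
  value at a point is an arbitrary choice.\<close>

definition Umap :: "'k node set \<Rightarrow> 'k node" where
  "Umap S = (\<lambda>\<xi>. if \<exists>t\<in>S. \<xi> \<in> dom t then (SOME t. t \<in> S \<and> \<xi> \<in> dom t) \<xi> else None)"

lemma dom_Umap: "dom (Umap S) = (\<Union>t\<in>S. dom t)"
proof -
  have "Umap S \<xi> \<noteq> None" if ex: "\<exists>t\<in>S. \<xi> \<in> dom t" for \<xi>
  proof -
    have "\<exists>t. t \<in> S \<and> \<xi> \<in> dom t" using ex by blast
    from someI_ex[OF this] show ?thesis using ex by (auto simp: Umap_def)
  qed
  moreover have "\<exists>t\<in>S. \<xi> \<in> dom t" if "Umap S \<xi> \<noteq> None" for \<xi>
    using that by (auto simp: Umap_def split: if_splits)
  ultimately show ?thesis by (auto simp: dom_def)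
qed

lemma map_le_Umap:
  assumes chain: "\<And>s t. s \<in> S \<Longrightarrow> t \<in> S \<Longrightarrow> s \<subseteq>\<^sub>m t \<or> t \<subseteq>\<^sub>m s" and "t \<in> S"
  shows "t \<subseteq>\<^sub>m Umap S"
  unfolding map_le_def
proof
  fix \<xi> assume "\<xi> \<in> dom t"
  then have ex: "\<exists>t. t \<in> S \<and> \<xi> \<in> dom t" using assms(2) by blast
  define s where "s = (SOME t. t \<in> S \<and> \<xi> \<in> dom t)"
  have s: "s \<in> S" "\<xi> \<in> dom s" using someI_ex[OF ex] by (auto simp: s_def)
  have "t \<xi> = s \<xi>" using chain[OF s(1) assms(2)] s \<open>\<xi> \<in> dom t\<close> unfolding map_le_def by metis
  then show "t \<xi> = Umap S \<xi>" using ex by (auto simp: Umap_def s_def)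
qed

lemma map_le_restrict: "t \<subseteq>\<^sub>m u \<Longrightarrow> u |` dom t = t"
  by (auto simp: map_le_def restrict_map_def fun_eq_iff dom_def)

lemma map_le_restrict_below: "t \<subseteq>\<^sub>m u \<Longrightarrow> dom t = below \<alpha> \<Longrightarrow> u |` below \<alpha> = t"
  using map_le_restrict by fastforce

lemma restrict_map_le [simp]: "t |` A \<subseteq>\<^sub>m t"
  by (auto simp: map_le_def restrict_map_def)

lemma map_le_restrictI: "s \<subseteq>\<^sub>m t \<Longrightarrow> dom s \<subseteq> A \<Longrightarrow> s \<subseteq>\<^sub>m t |` A"
  by (auto simp: map_le_def restrict_map_def)

lemma restrict_below_below [simp]: "(t |` below \<alpha>) |` below \<beta> = t |` below (min \<alpha> \<beta>)"
  by (simp add: restrict_restrict)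

lemma restrict_below_self: "dom t = below \<alpha> \<Longrightarrow> \<alpha> \<le> \<beta> \<Longrightarrow> t |` below \<beta> = t"
  using map_le_restrictI[OF map_le_refl, of t "below \<beta>"] by (intro map_le_antisym) auto

lemma dom_restrict_below: "dom t = below \<alpha> \<Longrightarrow> \<beta> \<le> \<alpha> \<Longrightarrow> dom (t |` below \<beta>) = below \<beta>"
  by (auto intro: less_le_trans)

lemma map_le_chain: "s \<subseteq>\<^sub>m u \<Longrightarrow> t \<subseteq>\<^sub>m u \<Longrightarrow> dom s = below \<alpha> \<Longrightarrow> dom t = below \<beta> \<Longrightarrow> \<alpha> \<le> \<beta> \<Longrightarrow> s \<subseteq>\<^sub>m t"
  unfolding map_le_def by (simp add: less_le_trans)

lemma map_le_eq: "s \<subseteq>\<^sub>m t \<Longrightarrow> dom s = below \<alpha> \<Longrightarrow> dom t = below \<alpha> \<Longrightarrow> s = t"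
  by (rule map_le_antisym) (simp_all add: map_le_def)

lemma cobounded_mono: "cobounded \<theta> Z \<Longrightarrow> (\<And>i. i < \<theta> \<Longrightarrow> i \<in> Z \<Longrightarrow> i \<in> Z') \<Longrightarrow> cobounded \<theta> Z'"
  unfolding cobounded_def by blast

lemma cobounded_Int: "cobounded \<theta> Z \<Longrightarrow> cobounded \<theta> Z' \<Longrightarrow> cobounded \<theta> (Z \<inter> Z')"
proof -
  assume "cobounded \<theta> Z" "cobounded \<theta> Z'"
  then obtain j j' where "j < \<theta>" "\<forall>i. j \<le> i \<longrightarrow> i < \<theta> \<longrightarrow> i \<in> Z" "j' < \<theta>" "\<forall>i. j' \<le> i \<longrightarrow> i < \<theta> \<longrightarrow> i \<in> Z'"
    unfolding cobounded_def by blast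
  then show ?thesis unfolding cobounded_def by (intro exI[of _ "max j j'"]) auto
qed

lemma regular_ord_nonempty: "regular_ord \<theta> \<Longrightarrow> \<exists>j. j < \<theta>"
proof (rule ccontr)
  assume "regular_ord \<theta>" "\<nexists>j. j < \<theta>"
  then have "below \<theta> = {}" by auto
  then show False using \<open>regular_ord \<theta>\<close> by (simp add: regular_ord_def)
qed

lemma cobounded_all: "regular_ord \<theta> \<Longrightarrow> (\<And>i. i < \<theta> \<Longrightarrow> i \<in> Z) \<Longrightarrow> cobounded \<theta> Z"
  using regular_ord_nonempty[of \<theta>] by (auto simp: cobounded_def)

section \<open>Successor ordinals and predecessors inside a set\<close>

definition sucof :: "'k::wellorder \<Rightarrow> 'k \<Rightarrow> bool" where
  "sucof \<alpha> \<delta> \<longleftrightarrow> \<delta> < \<alpha> \<and> (\<forall>\<gamma>. \<delta> < \<gamma> \<longrightarrow> \<alpha> \<le> \<gamma>)"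

definition pd :: "'k::wellorder \<Rightarrow> 'k" where
  "pd \<alpha> = (THE \<delta>. sucof \<alpha> \<delta>)"

lemma pd_eq: "sucof \<alpha> \<delta> \<Longrightarrow> pd \<alpha> = \<delta>"
  unfolding pd_def
proof (rule the_equality)
  show "\<delta>' = \<delta>" if "sucof \<alpha> \<delta>" "sucof \<alpha> \<delta>'" for \<delta>'
    using that unfolding sucof_def by (meson leD linorder_cases)
qed

lemma sucof_not_limit: "sucof \<alpha> \<delta> \<Longrightarrow> \<not> is_limit \<alpha>"
  unfolding sucof_def is_limit_def using leD by blast

lemma not_limit_sucof: "\<not> is_limit \<alpha> \<Longrightarrow> \<beta> < \<alpha> \<Longrightarrow> sucof \<alpha> (pd \<alpha>)"
proof -
  assume "\<not> is_limit \<alpha>" "\<beta> < \<alpha>"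
  then obtain \<delta> where "\<delta> < \<alpha>" "\<forall>\<gamma>. \<delta> < \<gamma> \<longrightarrow> \<not> \<gamma> < \<alpha>" unfolding is_limit_def by blast
  then have "sucof \<alpha> \<delta>" by (auto simp: sucof_def)
  then show ?thesis using pd_eq by metis
qed

lemma sucof_below: "sucof \<alpha> \<delta> \<Longrightarrow> below \<alpha> = insert \<delta> (below \<delta>)"
  unfolding sucof_def by (auto simp: not_le[symmetric]) (meson leD linorder_cases)+

lemma sucof_le: "sucof \<alpha> \<delta> \<Longrightarrow> \<beta> < \<alpha> \<Longrightarrow> \<beta> \<le> \<delta>"
  unfolding sucof_def by (meson leD leI)

definition mx :: "'k::wellorder set \<Rightarrow> 'k \<Rightarrow> 'k \<Rightarrow> bool" where
  "mx c \<gamma> \<delta> \<longleftrightarrow> \<delta> \<in> c \<and> \<delta> < \<gamma> \<and> (\<forall>\<delta>'\<in>c. \<delta>' < \<gamma> \<longrightarrow> \<delta>' \<le> \<delta>)"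

lemma mx_unique: "mx c \<gamma> \<delta> \<Longrightarrow> mx c \<gamma> \<delta>' \<Longrightarrow> \<delta> = \<delta>'"
  unfolding mx_def by (meson antisym)

lemma the_mx: "mx c \<gamma> \<delta> \<Longrightarrow> (THE \<delta>. mx c \<gamma> \<delta>) = \<delta>"
  using mx_unique by (metis the_equality)

lemma cofinal_limit: "cofinal_in D \<gamma> \<Longrightarrow> is_limit \<gamma>"
  unfolding cofinal_in_def is_limit_def by blast

text \<open>The supremum of \<open>c\<close> below \<gamma> belongs to \<open>c\<close> by
  closedness unless it is \<gamma> itself. The cases are those of the recursion along
  \<open>c\<close>: a step from a predecessor, a start, and an accumulation point.\<close>

lemma mx_cases:
  assumes "club_in c \<alpha>" "\<gamma> < \<alpha>"
  obtains \<delta> where "mx c \<gamma> \<delta>" | "c \<inter> below \<gamma> = {}" | "cofinal_in c \<gamma>"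
proof (cases "cofinal_in c \<gamma> \<or> c \<inter> below \<gamma> = {}")
  case False
  then obtain \<beta> where \<beta>: "\<beta> < \<gamma>" "\<forall>\<delta>\<in>c. \<not> (\<beta> < \<delta> \<and> \<delta> < \<gamma>)"
    unfolding cofinal_in_def by auto
  define s where "s = (LEAST s. \<forall>\<delta>\<in>c. \<delta> < \<gamma> \<longrightarrow> \<delta> \<le> s)"
  have bd: "\<forall>\<delta>\<in>c. \<delta> < \<gamma> \<longrightarrow> \<delta> \<le> \<beta>" using \<beta>(2) not_le by blast
  have s: "\<forall>\<delta>\<in>c. \<delta> < \<gamma> \<longrightarrow> \<delta> \<le> s" unfolding s_def by (rule LeastI[of _ \<beta>]) (rule bd)
  have "s \<le> \<beta>" unfolding s_def by (rule Least_le) (rule bd)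
  then have "s < \<gamma>" using \<beta> by simp
  have "s \<in> c"
  proof (rule ccontr)
    assume "s \<notin> c"
    have "\<exists>\<delta>\<in>c. \<xi> < \<delta> \<and> \<delta> < s" if "\<xi> < s" for \<xi>
    proof -
      have "\<not> (\<forall>\<delta>\<in>c. \<delta> < \<gamma> \<longrightarrow> \<delta> \<le> \<xi>)"
        using that unfolding s_def by (rule not_less_Least)
      then obtain \<delta> where "\<delta> \<in> c" "\<delta> < \<gamma>" "\<xi> < \<delta>" by (auto simp: not_le)
      moreover from this have "\<delta> < s" using s \<open>s \<notin> c\<close> by (metis le_less)
      ultimately show ?thesis by blast
    qed
    moreover obtain \<delta> where "\<delta> \<in> c" "\<delta> < \<gamma>" using False by auto
    then have "\<delta> < s" using s \<open>s \<notin> c\<close> by (metis le_less)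
    ultimately have "cofinal_in c s" unfolding cofinal_in_def by blast
    then show False using assms \<open>s < \<gamma>\<close> \<open>s \<notin> c\<close> unfolding club_in_def by (meson less_trans)
  qed
  then have "mx c \<gamma> s" using s \<open>s < \<gamma>\<close> by (simp add: mx_def)
  then show ?thesis by (rule that(1))
qed (use that in blast)

text \<open>The diamond guess at \<open>\<gamma>\<close> consists of \<open>psi \<gamma> = (\<tau>, q)\<close> and of \<open>Om \<gamma>\<close>.  An entry
  \<open>q k = (z, i, y)\<close> names the path through index \<open>i\<close> and start \<open>y\<close> belonging to the sequence that
  \<open>z\<close> represents, and \<open>Om \<gamma>\<close> is the guessed part of a dense set of \<open>\<tau>\<close>-tuples.\<close>

locale tree_recursion =
  fixes \<eta> \<theta> :: "'k::wellorder"
    and X :: "'k node set"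
    and C :: "'k \<Rightarrow> 'k set"
    and b :: "'k \<Rightarrow> 'k node \<Rightarrow> 'k node"
    and psi :: "'k \<Rightarrow> 'k \<times> ('k \<Rightarrow> 'k node \<times> 'k \<times> 'k node)"
    and Om :: "'k \<Rightarrow> ('k \<Rightarrow> 'k node) set"
    and e0 e1 :: 'k
  assumes C_club: "\<And>\<alpha>. is_limit \<alpha> \<Longrightarrow> club_in (C \<alpha>) \<alpha>"
begin

text \<open>Here \<open>g\<close> stands for the path at \<delta>, the predecessor of \<gamma>, and
  \<open>bb\<close> for the map \<open>b \<alpha>\<close> that interprets names. The result is the
  node that the path named by entry \<open>k\<close> has reached at \<delta>.\<close>

definition vals :: "('k node \<Rightarrow> 'k node) \<Rightarrow> 'k \<Rightarrow> 'k \<Rightarrow> 'k chooser \<Rightarrow> 'k \<Rightarrow> 'k node" where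
  "vals bb \<gamma> \<delta> g k = (case snd (psi \<gamma>) k of (z, i, y) \<Rightarrow> g (bb z |` below \<delta>) i y)"

definition hits :: "('k \<Rightarrow> 'k node set) \<Rightarrow> ('k node \<Rightarrow> 'k node) \<Rightarrow> 'k \<Rightarrow> 'k \<Rightarrow> 'k chooser \<Rightarrow> ('k \<Rightarrow> 'k node) \<Rightarrow> bool" where
  "hits T bb \<gamma> \<delta> g a \<longleftrightarrow> a \<in> Om \<gamma> \<and> (\<forall>k<fst (psi \<gamma>). vals bb \<gamma> \<delta> g k \<subseteq>\<^sub>m a k \<and> (\<exists>\<beta><\<gamma>. a k \<in> T \<beta>))"

text \<open>The names must have height in \<open>c\<close> below \<gamma>, because only for those is
  the interpretation the same along \<open>C \<alpha>\<close> and along the set at an accumulation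
  point of it. Injectivity excludes two entries that name the same path and ask for different
  continuations.\<close>

definition sealing :: "('k \<Rightarrow> 'k node set) \<Rightarrow> 'k set \<Rightarrow> ('k node \<Rightarrow> 'k node) \<Rightarrow> 'k \<Rightarrow> 'k \<Rightarrow> 'k chooser \<Rightarrow> bool" where
  "sealing T c bb \<gamma> \<delta> g \<longleftrightarrow>
     (\<forall>k<fst (psi \<gamma>). fst (snd (psi \<gamma>) k) \<in> restrX X (c \<inter> below \<gamma>)) \<and>
     inj_on (vals bb \<gamma> \<delta> g) (below (fst (psi \<gamma>))) \<and> (\<exists>a. hits T bb \<gamma> \<delta> g a)"

definition target :: "('k node \<Rightarrow> 'k node) \<Rightarrow> 'k \<Rightarrow> 'k node \<Rightarrow> 'k \<Rightarrow> 'k node \<Rightarrow> 'k \<Rightarrow> bool" where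
  "target bb \<gamma> x i y k \<longleftrightarrow> k < fst (psi \<gamma>) \<and> (\<exists>z. snd (psi \<gamma>) k = (z, i, y) \<and> x = bb z |` below \<gamma>)"

text \<open>The first case is a path that has not begun, since \<open>y\<close> reaches beyond
  \<delta>. The second steers towards the matching entry of one hit chosen for the whole tuple.
  Otherwise the path follows the old node if that extends its current value, and else extends the
  current value; for fixed \<open>x\<close> and \<open>y\<close> this last case will concern
  boundedly many indices only.\<close>

definition stepP :: "('k \<Rightarrow> 'k node set) \<Rightarrow> ('k \<Rightarrow> 'k chooser) \<Rightarrow> 'k set \<Rightarrow> ('k node \<Rightarrow> 'k node) \<Rightarrow> 'k \<Rightarrow> 'k \<Rightarrow>
    'k chooser \<Rightarrow> 'k chooser" where
  "stepP T F c bb \<gamma> \<delta> g x i y =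
     (if \<not> dom y \<subseteq> below \<delta> then F \<gamma> x i y
      else if sealing T c bb \<gamma> \<delta> g \<and> (\<exists>k. target bb \<gamma> x i y k)
        then F \<gamma> x i ((SOME a. hits T bb \<gamma> \<delta> g a) (SOME k. target bb \<gamma> x i y k))
      else if g (x |` below \<delta>) i y \<subseteq>\<^sub>m F \<gamma> x i y then F \<gamma> x i y
      else F \<gamma> x i (g (x |` below \<delta>) i y))"

text \<open>Where \<open>\<gamma>\<close> has no predecessor in \<open>c\<close> the path takes the value \<open>F \<gamma>\<close>: for accumulation
  points of a coherent club this is the union of the earlier values.\<close>

function path :: "('k \<Rightarrow> 'k node set) \<Rightarrow> ('k \<Rightarrow> 'k chooser) \<Rightarrow> 'k set \<Rightarrow> ('k node \<Rightarrow> 'k node) \<Rightarrow> 'k \<Rightarrow>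
    'k chooser" where
  "path T F c bb \<gamma> = (if \<exists>\<delta>. mx c \<gamma> \<delta>
      then stepP T F c bb \<gamma> (THE \<delta>. mx c \<gamma> \<delta>) (path T F c bb (THE \<delta>. mx c \<gamma> \<delta>)) else F \<gamma>)"
  by pat_completeness auto
termination
proof (relation "inv_image {(x::'k, y). x < y} (\<lambda>(T, F, c, bb, \<gamma>). \<gamma>)")
  show "wf (inv_image {(x::'k, y). x < y} (\<lambda>(T, F, c, bb, \<gamma>). \<gamma>))"
    by (intro wf_inv_image wf)
next
  fix T :: "'k \<Rightarrow> 'k node set" and F :: "'k \<Rightarrow> 'k chooser" and c bb and \<gamma> :: 'k
  assume "\<exists>\<delta>. mx c \<gamma> \<delta>"
  then obtain \<delta> where "mx c \<gamma> \<delta>" by blast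
  then show "((T, F, c, bb, THE \<delta>. mx c \<gamma> \<delta>), (T, F, c, bb, \<gamma>)) \<in> inv_image {(x, y). x < y} (\<lambda>(T, F, c, bb, \<gamma>). \<gamma>)"
    using the_mx[of c \<gamma> \<delta>] by (simp add: mx_def)
qed

declare path.simps [simp del]

lemma path_mx: "mx c \<gamma> \<delta> \<Longrightarrow> path T F c bb \<gamma> = stepP T F c bb \<gamma> \<delta> (path T F c bb \<delta>)"
  by (subst path.simps) (auto simp: the_mx)

lemma path_no_mx: "(\<nexists>\<delta>. mx c \<gamma> \<delta>) \<Longrightarrow> path T F c bb \<gamma> = F \<gamma>"
  by (subst path.simps) auto

text \<open>For \<gamma> in \<open>C \<alpha>\<close> the path at \<gamma> consults no level from
  \<alpha> on, which makes the recursion for the levels well defined.\<close>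

lemma path_cong:
  assumes "\<And>\<beta>. \<beta> \<le> \<gamma> \<Longrightarrow> T \<beta> = T' \<beta> \<and> F \<beta> = F' \<beta>"
  shows "path T F c bb \<gamma> = path T' F' c bb \<gamma>"
  using assms
proof (induction \<gamma> rule: less_induct)
  case (less \<gamma>)
  show ?case
  proof (cases "\<exists>\<delta>. mx c \<gamma> \<delta>")
    case True
    then obtain \<delta> where \<delta>: "mx c \<gamma> \<delta>" by blast
    then have "\<delta> < \<gamma>" by (simp add: mx_def)
    then have p: "path T F c bb \<delta> = path T' F' c bb \<delta>" using less by auto
    have h: "hits T bb \<gamma> \<delta> g = hits T' bb \<gamma> \<delta> g" for g
      unfolding hits_def fun_eq_iff using less.prems by (metis less_imp_le)
    have s: "sealing T c bb \<gamma> \<delta> g = sealing T' c bb \<gamma> \<delta> g" for g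
      unfolding sealing_def h ..
    have F: "F \<gamma> = F' \<gamma>" using less.prems by auto
    have "stepP T F c bb \<gamma> \<delta> g = stepP T' F' c bb \<gamma> \<delta> g" for g
      unfolding stepP_def s h F ..
    then show ?thesis unfolding path_mx[OF \<delta>] p .
  qed (simp add: path_no_mx less.prems)
qed

definition good :: "'k \<Rightarrow> bool" where
  "good \<alpha> \<longleftrightarrow> (\<forall>\<beta>\<in>acc (C \<alpha>). C \<beta> = C \<alpha> \<inter> below \<beta>)"

text \<open>Meant for \<alpha> that are not \<open>good\<close>: an index from which the nodes
  \<open>F\<close> along all of \<open>C \<alpha>\<close> form chains. Its existence depends on the
  invariants of the lower levels.\<close>

definition stab :: "('k \<Rightarrow> 'k chooser) \<Rightarrow> 'k \<Rightarrow> 'k node \<Rightarrow> 'k node \<Rightarrow> 'k" where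
  "stab F \<alpha> x y = (SOME j. j < \<theta> \<and> (\<forall>i. j \<le> i \<longrightarrow> i < \<theta> \<longrightarrow>
     (\<forall>\<gamma>\<in>C \<alpha>. \<forall>\<gamma>'\<in>C \<alpha>. dom y \<subseteq> below \<gamma> \<longrightarrow> \<gamma> \<le> \<gamma>' \<longrightarrow>
        F \<gamma> (x |` below \<gamma>) i y \<subseteq>\<^sub>m F \<gamma>' (x |` below \<gamma>') i y)))"

text \<open>At a successor the value of \<open>x\<close> is appended to the old node; this is what
  separates the paths of distinct sequences. At a limit that is not \<open>good\<close>, the indices
  below \<open>stab\<close> borrow the nodes of index \<open>stab\<close>, so that every index
  yields a chain.\<close>

definition stepF :: "('k \<Rightarrow> 'k node set \<times> 'k chooser) \<Rightarrow> 'k \<Rightarrow> 'k chooser" where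
  "stepF L \<alpha> x i y = (if dom y = below \<alpha> then y
     else if \<not> is_limit \<alpha> then (snd (L (pd \<alpha>)) (x |` below (pd \<alpha>)) i y)(pd \<alpha> := x (pd \<alpha>))
     else if good \<alpha> then Umap ((\<lambda>\<gamma>. path (fst \<circ> L) (snd \<circ> L) (C \<alpha>) (b \<alpha>) \<gamma> (x |` below \<gamma>) i y) ` {\<gamma>\<in>C \<alpha>. dom y \<subseteq> below \<gamma>})
     else Umap ((\<lambda>\<gamma>. snd (L \<gamma>) (x |` below \<gamma>) (max i (stab (snd \<circ> L) \<alpha> x y)) y) ` {\<gamma>\<in>C \<alpha>. dom y \<subseteq> below \<gamma>}))"

text \<open>The values \<open>e0\<close> and \<open>e1\<close> make every node split; the values of
  members of \<open>X\<close> admit the entries that \<open>stepF\<close> appends. All branches are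
  added at limits outside \<open>E_ge \<eta>\<close> only, since elsewhere they would spoil the
  sealing.\<close>

definition stepL :: "('k \<Rightarrow> 'k node set \<times> 'k chooser) \<Rightarrow> 'k \<Rightarrow> 'k node set \<times> 'k chooser" where
  "stepL L \<alpha> =
    (if is_limit \<alpha> then
        {stepF L \<alpha> x i y |x i y. x \<in> X \<and> dom x = below \<alpha> \<and> i < \<theta> \<and> (\<exists>\<beta><\<alpha>. y \<in> fst (L \<beta>))} \<union>
        {t. \<alpha> \<notin> E_ge \<eta> \<and> dom t = below \<alpha> \<and> (\<forall>\<beta><\<alpha>. t |` below \<beta> \<in> fst (L \<beta>))}
     else if \<exists>\<beta>. \<beta> < \<alpha> then
        {t(pd \<alpha> \<mapsto> \<xi>) |t \<xi>. t \<in> fst (L (pd \<alpha>)) \<and> (\<xi> = e0 \<or> \<xi> = e1 \<or> (\<exists>x\<in>X. x (pd \<alpha>) = Some \<xi>))}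
     else {Map.empty}, stepF L \<alpha>)"

lemma C_less: "is_limit \<alpha> \<Longrightarrow> \<gamma> \<in> C \<alpha> \<Longrightarrow> \<gamma> < \<alpha>"
  using C_club[of \<alpha>] unfolding club_in_def by auto

text \<open>Zero is excluded because \<open>pd\<close> has no meaningful value there.\<close>

lemma stepF_cong:
  assumes "\<And>\<beta>. \<beta> < \<alpha> \<Longrightarrow> L \<beta> = L' \<beta>" "\<exists>\<beta>. \<beta> < \<alpha>"
  shows "stepF L \<alpha> = stepF L' \<alpha>"
proof -
  have "stepF L \<alpha> x i y = stepF L' \<alpha> x i y" for x i y
  proof (cases "is_limit \<alpha>")
    case False
    then have "sucof \<alpha> (pd \<alpha>)" using assms(2) not_limit_sucof by blast
    then show ?thesis using False assms by (simp add: stepF_def sucof_def)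
  next
    case True
    have p: "path (fst \<circ> L) (snd \<circ> L) (C \<alpha>) (b \<alpha>) \<gamma> = path (fst \<circ> L') (snd \<circ> L') (C \<alpha>) (b \<alpha>) \<gamma>" if "\<gamma> \<in> C \<alpha>" for \<gamma>
    proof -
      have "L \<beta> = L' \<beta>" if "\<beta> \<le> \<gamma>" for \<beta>
        using assms(1) C_less[OF True \<open>\<gamma> \<in> C \<alpha>\<close>] that by (simp add: le_less_trans)
      then show ?thesis by (intro path_cong) simp
    qed
    have L: "L \<gamma> = L' \<gamma>" if "\<gamma> \<in> C \<alpha>" for \<gamma> using that C_less[OF True] assms by auto
    have s: "stab (snd \<circ> L) \<alpha> x y = stab (snd \<circ> L') \<alpha> x y"
      unfolding stab_def using L by (simp cong: ball_cong)
    have "(\<lambda>\<gamma>. path (fst \<circ> L) (snd \<circ> L) (C \<alpha>) (b \<alpha>) \<gamma> (x |` below \<gamma>) i y) ` {\<gamma>\<in>C \<alpha>. dom y \<subseteq> below \<gamma>}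
       = (\<lambda>\<gamma>. path (fst \<circ> L') (snd \<circ> L') (C \<alpha>) (b \<alpha>) \<gamma> (x |` below \<gamma>) i y) ` {\<gamma>\<in>C \<alpha>. dom y \<subseteq> below \<gamma>}"
      using p by (intro image_cong) auto
    moreover have "(\<lambda>\<gamma>. snd (L \<gamma>) (x |` below \<gamma>) (max i (stab (snd \<circ> L) \<alpha> x y)) y) ` {\<gamma>\<in>C \<alpha>. dom y \<subseteq> below \<gamma>}
       = (\<lambda>\<gamma>. snd (L' \<gamma>) (x |` below \<gamma>) (max i (stab (snd \<circ> L') \<alpha> x y)) y) ` {\<gamma>\<in>C \<alpha>. dom y \<subseteq> below \<gamma>}"
      unfolding s using L by (intro image_cong) auto
    ultimately show ?thesis unfolding stepF_def using True by simp
  qed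
  then show ?thesis by (intro ext) simp
qed

section \<open>The levels and their recursion equations\<close>

definition Lv :: "'k \<Rightarrow> 'k node set \<times> 'k chooser" where
  "Lv = wfrec {(x, y). x < y} stepL"

definition Tr :: "'k \<Rightarrow> 'k node set" where "Tr \<alpha> = fst (Lv \<alpha>)"
definition Fn :: "'k \<Rightarrow> 'k chooser" where "Fn \<alpha> = snd (Lv \<alpha>)"

lemma Lv_cut: "Lv \<alpha> = stepL (cut Lv {(x, y). x < y} \<alpha>) \<alpha>"
  unfolding Lv_def by (rule wfrec[OF wf])

lemma
  assumes "\<exists>\<beta>. \<beta> < \<alpha>"
  shows stepF_cut: "stepF (cut Lv {(x, y). x < y} \<alpha>) \<alpha> = stepF Lv \<alpha>"
  by (rule stepF_cong) (use assms in \<open>auto simp: cut_apply\<close>)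

lemma fst_snd_Lv: "fst \<circ> Lv = Tr" "snd \<circ> Lv = Fn"
  by (auto simp: Tr_def Fn_def)

lemma Tr_zero: "\<nexists>\<beta>. \<beta> < \<alpha> \<Longrightarrow> Tr \<alpha> = {Map.empty}"
  unfolding Tr_def by (subst Lv_cut) (auto simp: stepL_def is_limit_def)

lemma Fn_top: "dom y = below \<alpha> \<Longrightarrow> Fn \<alpha> x i y = y"
  unfolding Fn_def by (subst Lv_cut) (auto simp: stepL_def stepF_def)

lemma Tr_suc:
  assumes "sucof \<alpha> \<delta>"
  shows "Tr \<alpha> = {t(\<delta> \<mapsto> \<xi>) |t \<xi>. t \<in> Tr \<delta> \<and> (\<xi> = e0 \<or> \<xi> = e1 \<or> (\<exists>x\<in>X. x \<delta> = Some \<xi>))}"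
proof -
  have "\<delta> < \<alpha>" using assms by (simp add: sucof_def)
  then have "cut Lv {(x, y). x < y} \<alpha> \<delta> = Lv \<delta>" by (simp add: cut_apply)
  moreover have "\<exists>\<beta>. \<beta> < \<alpha>" using \<open>\<delta> < \<alpha>\<close> by blast
  ultimately show ?thesis
    unfolding Tr_def by (subst Lv_cut) (simp add: stepL_def sucof_not_limit[OF assms] pd_eq[OF assms])
qed

lemma Fn_suc:
  assumes "sucof \<alpha> \<delta>" "dom y \<noteq> below \<alpha>"
  shows "Fn \<alpha> x i y = (Fn \<delta> (x |` below \<delta>) i y)(\<delta> := x \<delta>)"
proof -
  have "\<delta> < \<alpha>" using assms by (simp add: sucof_def)
  then have "cut Lv {(x, y). x < y} \<alpha> \<delta> = Lv \<delta>" by (simp add: cut_apply)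
  then show ?thesis
    unfolding Fn_def using assms(2)
    by (subst Lv_cut) (simp add: stepL_def stepF_def sucof_not_limit[OF assms(1)] pd_eq[OF assms(1)])
qed

lemma Fn_limit:
  assumes "is_limit \<alpha>" "dom y \<noteq> below \<alpha>"
  shows "good \<alpha> \<Longrightarrow> Fn \<alpha> x i y = Umap ((\<lambda>\<gamma>. path Tr Fn (C \<alpha>) (b \<alpha>) \<gamma> (x |` below \<gamma>) i y) ` {\<gamma>\<in>C \<alpha>. dom y \<subseteq> below \<gamma>})"
    and "\<not> good \<alpha> \<Longrightarrow> Fn \<alpha> x i y = Umap ((\<lambda>\<gamma>. Fn \<gamma> (x |` below \<gamma>) (max i (stab Fn \<alpha> x y)) y) ` {\<gamma>\<in>C \<alpha>. dom y \<subseteq> below \<gamma>})"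
proof -
  have "Fn \<alpha> x i y = stepF Lv \<alpha> x i y"
    unfolding Fn_def by (subst Lv_cut) (use assms stepF_cut in \<open>auto simp: stepL_def is_limit_def\<close>)
  then show "good \<alpha> \<Longrightarrow> Fn \<alpha> x i y = Umap ((\<lambda>\<gamma>. path Tr Fn (C \<alpha>) (b \<alpha>) \<gamma> (x |` below \<gamma>) i y) ` {\<gamma>\<in>C \<alpha>. dom y \<subseteq> below \<gamma>})"
    and "\<not> good \<alpha> \<Longrightarrow> Fn \<alpha> x i y = Umap ((\<lambda>\<gamma>. Fn \<gamma> (x |` below \<gamma>) (max i (stab Fn \<alpha> x y)) y) ` {\<gamma>\<in>C \<alpha>. dom y \<subseteq> below \<gamma>})"
    using assms by (auto simp: stepF_def fst_snd_Lv Fn_def)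
qed

lemma Tr_limit:
  assumes "is_limit \<alpha>"
  shows "Tr \<alpha> = {Fn \<alpha> x i y |x i y. x \<in> X \<and> dom x = below \<alpha> \<and> i < \<theta> \<and> (\<exists>\<beta><\<alpha>. y \<in> Tr \<beta>)} \<union>
        {t. \<alpha> \<notin> E_ge \<eta> \<and> dom t = below \<alpha> \<and> (\<forall>\<beta><\<alpha>. t |` below \<beta> \<in> Tr \<beta>)}"
proof -
  have ex: "\<exists>\<beta>. \<beta> < \<alpha>" using assms by (auto simp: is_limit_def)
  have F: "Fn \<alpha> = stepF Lv \<alpha>"
    unfolding Fn_def by (subst Lv_cut) (simp add: stepL_def stepF_cut[OF ex])
  have cut: "\<beta> < \<alpha> \<Longrightarrow> cut Lv {(x, y). x < y} \<alpha> \<beta> = Lv \<beta>" for \<beta> by (simp add: cut_apply)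
  show ?thesis
    unfolding F unfolding Tr_def
    by (subst Lv_cut) (simp add: stepL_def assms stepF_cut[OF ex] cut cong: conj_cong)
qed

end

section \<open>Invariants of the levels\<close>

locale ascent_tree = tuple_arith K \<eta> + tree_recursion \<eta> \<theta> X C b psi Om e0 e1
  for K :: "'k::wellorder itself" and \<eta> \<theta> X C b psi Om e0 e1 +
  assumes theta: "regular_ord \<theta>"
    and X_dom: "\<And>x. x \<in> X \<Longrightarrow> \<exists>\<alpha>. dom x = below \<alpha>"
    and X_closed: "\<And>x \<beta>. x \<in> X \<Longrightarrow> x |` below \<beta> \<in> X"
    and X_level: "\<And>\<alpha>. \<exists>x\<in>X. dom x = below \<alpha>"
    and X_small: "\<And>\<alpha>. small K {x \<in> X. dom x = below \<alpha>}"
    and b_coherent: "\<And>\<alpha> \<beta> z \<delta>. z \<in> restrX X (C \<beta>) \<Longrightarrow> z \<in> restrX X (C \<alpha>) \<Longrightarrow> dom z = below \<delta> \<Longrightarrow>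
        C \<alpha> \<inter> {\<delta>..<\<beta>} = C \<beta> \<inter> {\<delta>..<\<beta>} \<Longrightarrow> b \<beta> z = b \<alpha> z |` below \<beta>"
    and C_sqsub: "\<And>\<alpha> \<beta>. \<beta> \<in> acc (C \<alpha>) \<Longrightarrow> sqsub_nu \<theta> (C \<beta>) (C \<alpha>)"
    and psi_theta: "\<And>\<gamma>. fst (psi \<gamma>) < \<theta>"
    and e01: "e0 \<noteq> e1"
begin

lemma acc_limit: "\<beta> \<in> acc c \<Longrightarrow> is_limit \<beta>"
  unfolding acc_def using cofinal_limit by auto

lemma C_cofinal: "is_limit \<alpha> \<Longrightarrow> \<beta> < \<alpha> \<Longrightarrow> \<exists>\<gamma>\<in>C \<alpha>. \<beta> < \<gamma>"
proof -
  assume "is_limit \<alpha>" "\<beta> < \<alpha>"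
  then obtain \<beta>' where "\<beta> < \<beta>'" "\<beta>' < \<alpha>" unfolding is_limit_def by blast
  then obtain \<gamma> where "\<gamma> \<in> C \<alpha>" "\<beta>' \<le> \<gamma>" using C_club[OF \<open>is_limit \<alpha>\<close>] unfolding club_in_def by blast
  then show ?thesis using \<open>\<beta> < \<beta>'\<close> by (auto intro: less_le_trans)
qed

text \<open>The cut point cannot exceed \<beta>, as \<beta> would then belong to
  \<open>C \<beta>\<close>, and cannot be smaller, as \<open>C \<beta>\<close> is cofinal in
  \<beta>.\<close>

lemma sqsub_eq:
  assumes "is_limit \<beta>" "\<beta> \<in> C \<alpha>" "sqsub (C \<beta>) (C \<alpha>)"
  shows "C \<beta> = C \<alpha> \<inter> below \<beta>"
proof -
  obtain \<gamma> where \<gamma>: "C \<beta> = C \<alpha> \<inter> below \<gamma>" using assms(3) by (auto simp: sqsub_def)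
  have "\<not> \<beta> < \<gamma>"
  proof
    assume "\<beta> < \<gamma>"
    then have "\<beta> \<in> C \<beta>" using assms(2) \<gamma> by simp
    then show False using C_less[OF assms(1)] by blast
  qed
  moreover have "\<not> \<gamma> < \<beta>"
  proof
    assume "\<gamma> < \<beta>"
    then obtain \<delta> where "\<delta> \<in> C \<beta>" "\<gamma> < \<delta>" using C_cofinal assms(1) by blast
    then show False using \<gamma> by auto
  qed
  ultimately show ?thesis using \<gamma> by (metis linorder_cases)
qed

text \<open>Failure of coherence at a single accumulation point forces the second alternative of
  \<open>sqsub_nu\<close>, which speaks of \<open>C \<alpha>\<close> alone.\<close>

lemma good_or_short:
  assumes "\<not> good \<alpha>"
  shows "|C \<alpha>| <o |below \<theta>|" and "\<forall>\<gamma>\<in>nacc (C \<alpha>). is_successor \<gamma>"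
proof -
  obtain \<beta> where \<beta>: "\<beta> \<in> acc (C \<alpha>)" "C \<beta> \<noteq> C \<alpha> \<inter> below \<beta>" using assms by (auto simp: good_def)
  then have "\<not> sqsub (C \<beta>) (C \<alpha>)" using sqsub_eq acc_limit by (auto simp: acc_def)
  then have s: "(\<exists>\<gamma><\<theta>. otp_is (C \<alpha>) \<gamma>) \<and> (\<forall>\<gamma>\<in>nacc (C \<alpha>). is_successor \<gamma>)"
    using C_sqsub[OF \<beta>(1)] by (simp add: sqsub_nu_def)
  then show "\<forall>\<gamma>\<in>nacc (C \<alpha>). is_successor \<gamma>" by blast
  obtain \<gamma> f where "\<gamma> < \<theta>" "bij_betw f (below \<gamma>) (C \<alpha>)" using s unfolding otp_is_def by blast
  then have "|C \<alpha>| \<le>o |below \<gamma>|" by (intro surj_imp_ordLeq[of _ f]) (auto simp: bij_betw_def)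
  also have "|below \<gamma>| <o |below \<theta>|"
    using is_card_less[OF _ \<open>\<gamma> < \<theta>\<close>] theta by (simp add: regular_ord_def)
  finally show "|C \<alpha>| <o |below \<theta>|" .
qed

text \<open>For \<open>\<beta>' = \<beta>\<close> the last clause says no more than
  \<open>y \<subseteq>\<^sub>m F\<close>, since \<open>F\<close> fixes the nodes of its own level.
  The content lies in larger \<open>\<beta>'\<close>, and the exceptional bound may depend on
  \<open>x\<close>, \<open>y\<close> and \<open>\<beta>'\<close>.\<close>

definition level_inv :: "'k \<Rightarrow> bool" where
  "level_inv \<alpha> \<longleftrightarrow> (\<forall>t\<in>Tr \<alpha>. dom t = below \<alpha> \<and> (\<forall>\<beta><\<alpha>. t |` below \<beta> \<in> Tr \<beta>)) \<and>
     (\<forall>x\<in>X. dom x = below \<alpha> \<longrightarrow> (\<forall>\<beta>\<le>\<alpha>. \<forall>y\<in>Tr \<beta>.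
        (\<forall>i<\<theta>. Fn \<alpha> x i y \<in> Tr \<alpha> \<and> y \<subseteq>\<^sub>m Fn \<alpha> x i y) \<and>
        (\<forall>\<beta>'. \<beta> \<le> \<beta>' \<longrightarrow> \<beta>' \<le> \<alpha> \<longrightarrow> cobounded \<theta> {i. Fn \<beta>' (x |` below \<beta>') i y \<subseteq>\<^sub>m Fn \<alpha> x i y})))"

lemma level_invI:
  assumes "\<And>t. t \<in> Tr \<alpha> \<Longrightarrow> dom t = below \<alpha> \<and> (\<forall>\<beta><\<alpha>. t |` below \<beta> \<in> Tr \<beta>)"
    and "\<And>x \<beta> y i. x \<in> X \<Longrightarrow> dom x = below \<alpha> \<Longrightarrow> \<beta> \<le> \<alpha> \<Longrightarrow> y \<in> Tr \<beta> \<Longrightarrow> i < \<theta> \<Longrightarrow>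
      Fn \<alpha> x i y \<in> Tr \<alpha> \<and> y \<subseteq>\<^sub>m Fn \<alpha> x i y"
    and "\<And>x \<beta> y \<beta>'. x \<in> X \<Longrightarrow> dom x = below \<alpha> \<Longrightarrow> y \<in> Tr \<beta> \<Longrightarrow> \<beta> \<le> \<beta>' \<Longrightarrow> \<beta>' \<le> \<alpha> \<Longrightarrow>
      cobounded \<theta> {i. Fn \<beta>' (x |` below \<beta>') i y \<subseteq>\<^sub>m Fn \<alpha> x i y}"
  shows "level_inv \<alpha>"
  unfolding level_inv_def
proof (rule conjI; intro ballI impI allI)
  fix x \<beta> y assume *: "x \<in> X" "dom x = below \<alpha>" "\<beta> \<le> \<alpha>" "y \<in> Tr \<beta>"
  show "(\<forall>i<\<theta>. Fn \<alpha> x i y \<in> Tr \<alpha> \<and> y \<subseteq>\<^sub>m Fn \<alpha> x i y) \<and>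
    (\<forall>\<beta>'. \<beta> \<le> \<beta>' \<longrightarrow> \<beta>' \<le> \<alpha> \<longrightarrow> cobounded \<theta> {i. Fn \<beta>' (x |` below \<beta>') i y \<subseteq>\<^sub>m Fn \<alpha> x i y})"
    using assms(2)[OF *] assms(3)[OF *(1,2,4)] by simp
qed (rule assms(1))

lemma level_inv_dom: "level_inv \<alpha> \<Longrightarrow> t \<in> Tr \<alpha> \<Longrightarrow> dom t = below \<alpha>"
  by (simp add: level_inv_def)

lemma level_inv_restrict: "level_inv \<alpha> \<Longrightarrow> t \<in> Tr \<alpha> \<Longrightarrow> \<beta> \<le> \<alpha> \<Longrightarrow> t |` below \<beta> \<in> Tr \<beta>"
  by (cases "\<beta> = \<alpha>") (auto simp: level_inv_def restrict_below_self)

lemma level_inv_Fn: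
  assumes "level_inv \<alpha>" "x \<in> X" "dom x = below \<alpha>" "\<beta> \<le> \<alpha>" "y \<in> Tr \<beta>" "i < \<theta>"
  shows "Fn \<alpha> x i y \<in> Tr \<alpha>" "y \<subseteq>\<^sub>m Fn \<alpha> x i y"
  using assms unfolding level_inv_def by blast+

lemma level_inv_cobounded:
  assumes "level_inv \<alpha>" "x \<in> X" "dom x = below \<alpha>" "y \<in> Tr \<beta>" "\<beta> \<le> \<beta>'" "\<beta>' \<le> \<alpha>"
  shows "cobounded \<theta> {i. Fn \<beta>' (x |` below \<beta>') i y \<subseteq>\<^sub>m Fn \<alpha> x i y}"
proof -
  have "\<beta> \<le> \<alpha>" using assms by auto
  then show ?thesis using assms unfolding level_inv_def by blast
qed

text \<open>A step at \<delta> consults the interpretation of names only up to \<delta> and, when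
  sealing, only for names of height in \<open>C\<close> below \<delta>; there the two
  interpretations agree by \<open>b_coherent\<close>. If some entry carries another name,
  \<open>sealing\<close> fails on both sides and no interpretation is consulted.\<close>

lemma path_coherent:
  assumes "\<beta> \<in> acc (C \<alpha>)" "C \<beta> = C \<alpha> \<inter> below \<beta>" "\<delta> < \<beta>"
  shows "path Tr Fn (C \<beta>) (b \<beta>) \<delta> = path Tr Fn (C \<alpha>) (b \<alpha>) \<delta>"
  using assms(3)
proof (induction \<delta> rule: less_induct)
  case (less \<delta>)
  have mx: "mx (C \<beta>) \<delta> \<xi> \<longleftrightarrow> mx (C \<alpha>) \<delta> \<xi>" for \<xi>
    using assms(2) less.prems by (auto simp: mx_def)
  show ?case
  proof (cases "\<exists>\<xi>. mx (C \<alpha>) \<delta> \<xi>")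
    case True
    then obtain \<xi> where \<xi>: "mx (C \<alpha>) \<delta> \<xi>" by blast
    then have "\<xi> < \<delta>" by (simp add: mx_def)
    define g where "g = path Tr Fn (C \<alpha>) (b \<alpha>) \<xi>"
    have "path Tr Fn (C \<beta>) (b \<beta>) \<xi> = g" unfolding g_def by (rule less.IH) (use \<open>\<xi> < \<delta>\<close> less.prems in simp_all)
    moreover have "stepP Tr Fn (C \<beta>) (b \<beta>) \<delta> \<xi> g = stepP Tr Fn (C \<alpha>) (b \<alpha>) \<delta> \<xi> g"
    proof -
      have Cd: "C \<beta> \<inter> below \<delta> = C \<alpha> \<inter> below \<delta>" unfolding assms(2) using less.prems by auto
      have bb: "b \<beta> z |` below \<gamma> = b \<alpha> z |` below \<gamma>"
        if z: "z \<in> restrX X (C \<alpha> \<inter> below \<delta>)" and "\<gamma> \<le> \<delta>" for z \<gamma>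
      proof -
        obtain \<zeta> where \<zeta>: "z \<in> X" "dom z = below \<zeta>" "\<zeta> \<in> C \<alpha>" "\<zeta> < \<delta>"
          using z by (auto simp: restrX_def)
        have "b \<beta> z = b \<alpha> z |` below \<beta>"
        proof (rule b_coherent)
          show "z \<in> restrX X (C \<beta>)" "z \<in> restrX X (C \<alpha>)" "dom z = below \<zeta>"
            unfolding restrX_def assms(2) using \<zeta> less.prems by (auto intro!: bexI[of _ \<zeta>])
          show "C \<alpha> \<inter> {\<zeta>..<\<beta>} = C \<beta> \<inter> {\<zeta>..<\<beta>}" unfolding assms(2) by auto
        qed
        then show ?thesis using \<open>\<gamma> \<le> \<delta>\<close> less.prems by (simp add: min_absorb2)
      qed
      show ?thesis
      proof (cases "\<forall>k<fst (psi \<delta>). fst (snd (psi \<delta>) k) \<in> restrX X (C \<alpha> \<inter> below \<delta>)")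
        case True
        have v: "vals (b \<beta>) \<delta> \<xi> g k = vals (b \<alpha>) \<delta> \<xi> g k" if "k < fst (psi \<delta>)" for k
        proof -
          obtain z i y where zy: "snd (psi \<delta>) k = (z, i, y)" by (metis prod_cases3)
          then have "z \<in> restrX X (C \<alpha> \<inter> below \<delta>)" using True that by fastforce
          then show ?thesis using bb[of z \<xi>] \<open>\<xi> < \<delta>\<close> zy by (simp add: vals_def)
        qed
        have i: "inj_on (vals (b \<beta>) \<delta> \<xi> g) (below (fst (psi \<delta>))) = inj_on (vals (b \<alpha>) \<delta> \<xi> g) (below (fst (psi \<delta>)))"
          by (rule inj_on_cong) (simp add: v)
        have h: "hits Tr (b \<beta>) \<delta> \<xi> g = hits Tr (b \<alpha>) \<delta> \<xi> g"
          unfolding hits_def using v by (intro ext) auto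
        have t: "target (b \<beta>) \<delta> x i y = target (b \<alpha>) \<delta> x i y" for x i y
        proof
          fix k
          show "target (b \<beta>) \<delta> x i y k = target (b \<alpha>) \<delta> x i y k"
          proof (cases "k < fst (psi \<delta>)")
            case k: True
            obtain z i' y' where zy: "snd (psi \<delta>) k = (z, i', y')" by (metis prod_cases3)
            then have "z \<in> restrX X (C \<alpha> \<inter> below \<delta>)" using True k by fastforce
            then show ?thesis using bb[of z \<delta>] zy by (simp add: target_def)
          qed (simp add: target_def)
        qed
        have s: "sealing Tr (C \<beta>) (b \<beta>) \<delta> \<xi> g = sealing Tr (C \<alpha>) (b \<alpha>) \<delta> \<xi> g"
          unfolding sealing_def i h Cd ..
        show ?thesis unfolding stepP_def s h t ..
      next
        case False
        then have "\<not> sealing Tr (C \<beta>) (b \<beta>) \<delta> \<xi> g" "\<not> sealing Tr (C \<alpha>) (b \<alpha>) \<delta> \<xi> g"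
          unfolding sealing_def Cd by blast+
        then show ?thesis by (intro ext) (simp add: stepP_def)
      qed
    qed
    ultimately show ?thesis using \<xi> mx by (simp add: path_mx[of _ \<delta> \<xi>] g_def)
  qed (simp add: path_no_mx mx)
qed

section \<open>Paths along a coherent club\<close>

lemma cobounded_not_guessed:
  "cobounded \<theta> {i. \<forall>k<fst (psi \<gamma>). fst (snd (snd (psi \<gamma>) k)) \<noteq> i}"
proof -
  obtain j where "j < \<theta>" "\<forall>k<fst (psi \<gamma>). fst (snd (snd (psi \<gamma>) k)) < \<theta> \<longrightarrow> fst (snd (snd (psi \<gamma>) k)) < j"
    using regular_ord_image_bounded[OF theta psi_theta, of \<gamma> "\<lambda>k. fst (snd (snd (psi \<gamma>) k))"] by blast
  then show ?thesis unfolding cobounded_def by (intro exI[of _ j]) auto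
qed

abbreviation (input) pth where "pth \<alpha> \<equiv> path Tr Fn (C \<alpha>) (b \<alpha>)"

text \<open>\<open>F\<close> at \<gamma> extends every node of level at most \<gamma>. The new value
  lies above the current one either because \<open>F\<close> is applied to a node above it, or
  because this was tested before following the old node.\<close>

lemma stepP_in_Tr:
  assumes level_inv: "\<And>\<beta>. \<beta> \<le> \<gamma> \<Longrightarrow> level_inv \<beta>" and \<delta>: "\<delta> < \<gamma>"
    and x: "x \<in> X" "dom x = below \<gamma>" and i: "i < \<theta>" and y: "y \<in> Tr \<beta>" "\<beta> \<le> \<delta>"
    and v: "g (x |` below \<delta>) i y \<in> Tr \<delta>" "y \<subseteq>\<^sub>m g (x |` below \<delta>) i y"
  shows "stepP Tr Fn c bb \<gamma> \<delta> g x i y \<in> Tr \<gamma> \<and> g (x |` below \<delta>) i y \<subseteq>\<^sub>m stepP Tr Fn c bb \<gamma> \<delta> g x i y"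
proof -
  have "dom y \<subseteq> below \<delta>" using level_inv_dom[OF level_inv y(1)] y(2) \<delta> by simp
  note Fy = level_inv_Fn[OF level_inv[OF order_refl] x _ y(1) i]
  show ?thesis
  proof (cases "sealing Tr c bb \<gamma> \<delta> g \<and> (\<exists>k. target bb \<gamma> x i y k)")
    case True
    define a where "a = (SOME a. hits Tr bb \<gamma> \<delta> g a)"
    define k where "k = (SOME k. target bb \<gamma> x i y k)"
    have "\<exists>a. hits Tr bb \<gamma> \<delta> g a" using True unfolding sealing_def by blast
    then have "hits Tr bb \<gamma> \<delta> g a" unfolding a_def by (rule someI_ex)
    moreover have k: "target bb \<gamma> x i y k" unfolding k_def by (rule someI_ex) (use True in simp)
    then obtain z where z: "k < fst (psi \<gamma>)" "snd (psi \<gamma>) k = (z, i, y)" "x = bb z |` below \<gamma>"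
      by (auto simp: target_def)
    \<comment> \<open>Entry \<open>k\<close> names the very path under consideration, so the hit
      extends its current value.\<close>
    then have "vals bb \<gamma> \<delta> g k = g (x |` below \<delta>) i y" using \<delta> by (simp add: vals_def min_absorb2)
    ultimately obtain \<beta>' where \<beta>': "\<beta>' < \<gamma>" "a k \<in> Tr \<beta>'" "g (x |` below \<delta>) i y \<subseteq>\<^sub>m a k"
      using z(1) by (auto simp: hits_def)
    have "Fn \<gamma> x i (a k) \<in> Tr \<gamma>" "a k \<subseteq>\<^sub>m Fn \<gamma> x i (a k)"
      using level_inv_Fn[OF level_inv[OF order_refl] x _ \<beta>'(2) i] \<beta>'(1) by auto
    moreover have "stepP Tr Fn c bb \<gamma> \<delta> g x i y = Fn \<gamma> x i (a k)"
      using True \<open>dom y \<subseteq> below \<delta>\<close> by (simp add: stepP_def a_def k_def)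
    ultimately show ?thesis using map_le_trans[OF \<beta>'(3)] by simp
  next
    case False
    then show ?thesis
      using Fy level_inv_Fn[OF level_inv[OF order_refl] x _ v(1) i] \<open>dom y \<subseteq> below \<delta>\<close> \<delta> y(2)
      by (auto simp: stepP_def)
  qed
qed

text \<open>Agreement with \<open>Fn\<close> can be lost only in the step from a predecessor
  \<delta>, and there at three bounded sets of indices: where the path differs from
  \<open>Fn\<close> at \<delta>, where \<open>Fn\<close> does not increase from \<delta> to
  \<gamma>, and those named by \<open>psi \<gamma>\<close>. At an accumulation point the path is
  \<open>Fn\<close> by definition, and the work is to see that it extends the earlier
  values.\<close>

lemma path_props:
  assumes \<alpha>: "is_limit \<alpha>" "good \<alpha>" and level_inv: "\<And>\<beta>. \<beta> < \<alpha> \<Longrightarrow> level_inv \<beta>"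
    and "\<gamma> \<in> C \<alpha>" "x \<in> X" "dom x = below \<gamma>" "y \<in> Tr \<beta>" "\<beta> \<le> \<gamma>"
  shows "(\<forall>i<\<theta>. pth \<alpha> \<gamma> x i y \<in> Tr \<gamma> \<and> y \<subseteq>\<^sub>m pth \<alpha> \<gamma> x i y \<and>
     (\<forall>\<delta>\<in>C \<alpha>. \<beta> \<le> \<delta> \<longrightarrow> \<delta> \<le> \<gamma> \<longrightarrow> pth \<alpha> \<delta> (x |` below \<delta>) i y \<subseteq>\<^sub>m pth \<alpha> \<gamma> x i y)) \<and>
    cobounded \<theta> {i. pth \<alpha> \<gamma> x i y = Fn \<gamma> x i y}"
  using assms(4-6,8)
proof (induction \<gamma> arbitrary: x rule: less_induct)
  case (less \<gamma>)
  have "\<gamma> < \<alpha>" using less.prems C_less \<alpha> by blast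
  have inv_upto: "level_inv \<beta>'" if "\<beta>' \<le> \<gamma>" for \<beta>' using that level_inv \<open>\<gamma> < \<alpha>\<close> by auto
  have domy: "dom y = below \<beta>" using level_inv_dom[OF inv_upto \<open>y \<in> Tr \<beta>\<close>] less.prems by simp
  have xg: "x |` below \<gamma> = x" using restrict_below_self less.prems by blast
  have xd: "x |` below \<delta> \<in> X" "dom (x |` below \<delta>) = below \<delta>" if "\<delta> \<le> \<gamma>" for \<delta>
    using X_closed less.prems dom_restrict_below that by auto
  note Fy = level_inv_Fn[OF inv_upto[OF order_refl] \<open>x \<in> X\<close> \<open>dom x = below \<gamma>\<close> \<open>\<beta> \<le> \<gamma>\<close> \<open>y \<in> Tr \<beta>\<close>]
  have IH: "pth \<alpha> \<delta> x' i y \<in> Tr \<delta> \<and> y \<subseteq>\<^sub>m pth \<alpha> \<delta> x' i y \<and>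
     (\<forall>\<xi>\<in>C \<alpha>. \<beta> \<le> \<xi> \<longrightarrow> \<xi> \<le> \<delta> \<longrightarrow> pth \<alpha> \<xi> (x' |` below \<xi>) i y \<subseteq>\<^sub>m pth \<alpha> \<delta> x' i y)"
    "cobounded \<theta> {i. pth \<alpha> \<delta> x' i y = Fn \<delta> x' i y}"
    if "\<delta> < \<gamma>" "\<delta> \<in> C \<alpha>" "x' \<in> X" "dom x' = below \<delta>" "\<beta> \<le> \<delta>" "i < \<theta>" for \<delta> x' i
    using less.IH[OF that(1-5)] that(6) by blast+
  obtain i0 where i0: "i0 < \<theta>" using regular_ord_nonempty[OF theta] by blast
  have tail: "cobounded \<theta> {i. pth \<alpha> \<gamma> x i y = Fn \<gamma> x i y}"
  proof (cases "\<exists>\<delta>. mx (C \<alpha>) \<gamma> \<delta> \<and> \<beta> \<le> \<delta>")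
    case False
    then have "pth \<alpha> \<gamma> x i y = Fn \<gamma> x i y" for i
    proof (cases "\<exists>\<delta>. mx (C \<alpha>) \<gamma> \<delta>")
      case True
      then obtain \<delta> where \<delta>: "mx (C \<alpha>) \<gamma> \<delta>" by blast
      then have "\<not> \<beta> \<le> \<delta>" using False by blast
      then show ?thesis using domy by (simp add: path_mx[OF \<delta>] stepP_def)
    qed (simp add: path_no_mx)
    then show ?thesis by (intro cobounded_all theta) simp
  next
    case True
    then obtain \<delta> where \<delta>: "mx (C \<alpha>) \<gamma> \<delta>" "\<beta> \<le> \<delta>" by blast
    then have \<delta>': "\<delta> < \<gamma>" "\<delta> \<in> C \<alpha>" by (auto simp: mx_def)
    have 1: "cobounded \<theta> {i. pth \<alpha> \<delta> (x |` below \<delta>) i y = Fn \<delta> (x |` below \<delta>) i y}"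
      by (rule IH(2)) (use \<delta> \<delta>' xd i0 in auto)
    have 2: "cobounded \<theta> {i. Fn \<delta> (x |` below \<delta>) i y \<subseteq>\<^sub>m Fn \<gamma> x i y}"
      by (rule level_inv_cobounded[OF inv_upto[OF order_refl]]) (use less.prems \<open>y \<in> Tr \<beta>\<close> \<delta> \<delta>' in auto)
    show ?thesis
    proof (rule cobounded_mono[OF cobounded_Int[OF cobounded_Int[OF 1 2] cobounded_not_guessed[of \<gamma>]]])
      fix i
      assume *: "i \<in> {i. pth \<alpha> \<delta> (x |` below \<delta>) i y = Fn \<delta> (x |` below \<delta>) i y} \<inter> {i. Fn \<delta> (x |` below \<delta>) i y \<subseteq>\<^sub>m Fn \<gamma> x i y}
        \<inter> {i. \<forall>k<fst (psi \<gamma>). fst (snd (snd (psi \<gamma>) k)) \<noteq> i}"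
      then have nt: "\<not> Ex (target (b \<alpha>) \<gamma> x i y)" by (auto simp: target_def)
      then show "i \<in> {i. pth \<alpha> \<gamma> x i y = Fn \<gamma> x i y}"
        using * by (simp add: path_mx[OF \<delta>(1)] stepP_def) (use nt in blast)
    qed
  qed
  have "pth \<alpha> \<gamma> x i y \<in> Tr \<gamma> \<and> y \<subseteq>\<^sub>m pth \<alpha> \<gamma> x i y \<and>
     (\<forall>\<delta>\<in>C \<alpha>. \<beta> \<le> \<delta> \<longrightarrow> \<delta> \<le> \<gamma> \<longrightarrow> pth \<alpha> \<delta> (x |` below \<delta>) i y \<subseteq>\<^sub>m pth \<alpha> \<gamma> x i y)"
    if i: "i < \<theta>" for i
  proof -
    have top: "pth \<alpha> \<gamma> (x |` below \<gamma>) i y \<subseteq>\<^sub>m pth \<alpha> \<gamma> x i y" unfolding xg by simp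
    show ?thesis
    proof (cases "\<exists>\<delta>. mx (C \<alpha>) \<gamma> \<delta>")
      case True
      then obtain \<delta> where \<delta>: "mx (C \<alpha>) \<gamma> \<delta>" by blast
      then have \<delta>': "\<delta> < \<gamma>" "\<delta> \<in> C \<alpha>" by (auto simp: mx_def)
      show ?thesis
      proof (cases "\<beta> \<le> \<delta>")
        case True
        have IHd: "pth \<alpha> \<delta> (x |` below \<delta>) i y \<in> Tr \<delta> \<and> y \<subseteq>\<^sub>m pth \<alpha> \<delta> (x |` below \<delta>) i y \<and>
          (\<forall>\<xi>\<in>C \<alpha>. \<beta> \<le> \<xi> \<longrightarrow> \<xi> \<le> \<delta> \<longrightarrow> pth \<alpha> \<xi> (x |` below \<delta> |` below \<xi>) i y \<subseteq>\<^sub>m pth \<alpha> \<delta> (x |` below \<delta>) i y)"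
          by (rule IH(1)) (use \<delta>' xd i True in auto)
        have s: "pth \<alpha> \<gamma> x i y \<in> Tr \<gamma> \<and> pth \<alpha> \<delta> (x |` below \<delta>) i y \<subseteq>\<^sub>m pth \<alpha> \<gamma> x i y"
          unfolding path_mx[OF \<delta>]
          by (rule stepP_in_Tr) (use inv_upto \<delta>' less.prems i \<open>y \<in> Tr \<beta>\<close> True IHd in auto)
        have "pth \<alpha> \<xi> (x |` below \<xi>) i y \<subseteq>\<^sub>m pth \<alpha> \<gamma> x i y" if "\<xi> \<in> C \<alpha>" "\<beta> \<le> \<xi>" "\<xi> \<le> \<gamma>" for \<xi>
        proof (cases "\<xi> = \<gamma>")
          case False
          then have "\<xi> \<le> \<delta>" using \<delta> that by (auto simp: mx_def)
          then have "pth \<alpha> \<xi> (x |` below \<xi>) i y \<subseteq>\<^sub>m pth \<alpha> \<delta> (x |` below \<delta>) i y"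
            using IHd that by (auto simp: min_absorb2)
          then show ?thesis using s map_le_trans by blast
        qed (use top in simp)
        then show ?thesis using s IHd map_le_trans by blast
      next
        case False
        \<comment> \<open>\<open>y\<close> reaches beyond the predecessor, so the path begins at
          \<gamma> and no earlier point of \<open>C \<alpha>\<close> has to be compared.\<close>
        then have e: "pth \<alpha> \<gamma> x i y = Fn \<gamma> x i y" using domy by (simp add: path_mx[OF \<delta>] stepP_def)
        have "\<xi> = \<gamma>" if "\<xi> \<in> C \<alpha>" "\<beta> \<le> \<xi>" "\<xi> \<le> \<gamma>" for \<xi>
          using \<delta> that False unfolding mx_def by (meson le_less order_trans)
        then show ?thesis using e Fy[OF i] top by auto
      qed
    next
      case False
      then have e: "pth \<alpha> \<gamma> x i y = Fn \<gamma> x i y" by (simp add: path_no_mx)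
      have "pth \<alpha> \<xi> (x |` below \<xi>) i y \<subseteq>\<^sub>m pth \<alpha> \<gamma> x i y" if \<xi>: "\<xi> \<in> C \<alpha>" "\<beta> \<le> \<xi>" "\<xi> < \<gamma>" for \<xi>
      proof -
        have "cofinal_in (C \<alpha>) \<gamma>"
          by (rule mx_cases[OF C_club[OF \<alpha>(1)] \<open>\<gamma> < \<alpha>\<close>]) (use False \<xi> in auto)
        then have acc: "\<gamma> \<in> acc (C \<alpha>)" using less.prems by (simp add: acc_def)
        then have Cg: "C \<gamma> = C \<alpha> \<inter> below \<gamma>" using \<alpha>(2) by (simp add: good_def)
        \<comment> \<open>Coherence is inherited by accumulation points, so
          \<open>Fn \<gamma>\<close> was itself formed as a union of path values along
          \<open>C \<gamma>\<close>; by \<open>path_coherent\<close> these are the values of the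
          present path.\<close>
        have gg: "good \<gamma>"
          unfolding good_def
        proof
          fix \<delta> assume "\<delta> \<in> acc (C \<gamma>)"
          then have "\<delta> \<in> acc (C \<alpha>)" "\<delta> < \<gamma>" unfolding Cg acc_def cofinal_in_def by auto
          then have "C \<delta> = C \<alpha> \<inter> below \<delta>" using \<alpha>(2) by (simp add: good_def)
          then show "C \<delta> = C \<gamma> \<inter> below \<delta>" using Cg \<open>\<delta> < \<gamma>\<close> by auto
        qed
        have "\<beta> < \<gamma>" using \<xi> by simp
        have level_inv: "pth \<gamma> \<delta> = pth \<alpha> \<delta>" if "\<delta> < \<gamma>" for \<delta> using path_coherent[OF acc Cg that] .
        define S where "S = (\<lambda>\<delta>. pth \<alpha> \<delta> (x |` below \<delta>) i y) ` {\<delta>\<in>C \<gamma>. dom y \<subseteq> below \<delta>}"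
        have "Fn \<gamma> x i y = Umap ((\<lambda>\<delta>. pth \<gamma> \<delta> (x |` below \<delta>) i y) ` {\<delta>\<in>C \<gamma>. dom y \<subseteq> below \<delta>})"
          by (rule Fn_limit(1)) (use acc_limit[OF acc] gg domy \<open>\<beta> < \<gamma>\<close> in auto)
        also have "(\<lambda>\<delta>. pth \<gamma> \<delta> (x |` below \<delta>) i y) ` {\<delta>\<in>C \<gamma>. dom y \<subseteq> below \<delta>} = S"
          unfolding S_def by (rule image_cong) (use level_inv Cg in auto)
        finally have F: "Fn \<gamma> x i y = Umap S" .
        have chain1: "pth \<alpha> \<delta> (x |` below \<delta>) i y \<subseteq>\<^sub>m pth \<alpha> \<delta>' (x |` below \<delta>') i y"
          if "\<delta> \<in> C \<gamma>" "\<delta>' \<in> C \<gamma>" "\<beta> \<le> \<delta>" "\<delta> \<le> \<delta>'" for \<delta> \<delta>'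
        proof -
          have "pth \<alpha> \<delta>' (x |` below \<delta>') i y \<in> Tr \<delta>' \<and> y \<subseteq>\<^sub>m pth \<alpha> \<delta>' (x |` below \<delta>') i y \<and>
            (\<forall>\<xi>\<in>C \<alpha>. \<beta> \<le> \<xi> \<longrightarrow> \<xi> \<le> \<delta>' \<longrightarrow> pth \<alpha> \<xi> (x |` below \<delta>' |` below \<xi>) i y \<subseteq>\<^sub>m pth \<alpha> \<delta>' (x |` below \<delta>') i y)"
            by (rule IH(1)) (use Cg that xd[of \<delta>'] i in \<open>simp_all del: dom_restrict add: less_imp_le\<close>)
          then show ?thesis using that Cg by (auto simp: min_absorb2)
        qed
        have "pth \<alpha> \<xi> (x |` below \<xi>) i y \<subseteq>\<^sub>m Umap S"
        proof (rule map_le_Umap)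
          fix s t assume "s \<in> S" "t \<in> S"
          then obtain \<delta> \<delta>' where "\<delta> \<in> C \<gamma>" "\<delta>' \<in> C \<gamma>" "\<beta> \<le> \<delta>" "\<beta> \<le> \<delta>'"
            "s = pth \<alpha> \<delta> (x |` below \<delta>) i y" "t = pth \<alpha> \<delta>' (x |` below \<delta>') i y"
            unfolding S_def by (auto simp: domy)
          then show "s \<subseteq>\<^sub>m t \<or> t \<subseteq>\<^sub>m s" using chain1 by (meson linear)
        next
          show "pth \<alpha> \<xi> (x |` below \<xi>) i y \<in> S" unfolding S_def using \<xi> Cg domy by auto
        qed
        then show ?thesis using F e by simp
      qed
      then have "pth \<alpha> \<xi> (x |` below \<xi>) i y \<subseteq>\<^sub>m pth \<alpha> \<gamma> x i y" if \<xi>: "\<xi> \<in> C \<alpha>" "\<beta> \<le> \<xi>" "\<xi> \<le> \<gamma>" for \<xi>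
        using that top by (cases "\<xi> = \<gamma>") auto
      then show ?thesis using e Fy[OF i] by auto
    qed
  qed
  then show ?case using tail by blast
qed

section \<open>Limit levels\<close>

definition pieces :: "'k \<Rightarrow> 'k node \<Rightarrow> 'k \<Rightarrow> 'k node \<Rightarrow> 'k \<Rightarrow> 'k node" where
  "pieces \<alpha> x i y \<gamma> = (if good \<alpha> then pth \<alpha> \<gamma> (x |` below \<gamma>) i y
     else Fn \<gamma> (x |` below \<gamma>) (max i (stab Fn \<alpha> x y)) y)"

text \<open>At a bad limit the fewer than \<open>\<theta>\<close> many exceptional bounds along \<open>C\<^sub>\<alpha>\<close> have a common bound.\<close>

lemma stab_props:
  assumes \<alpha>: "is_limit \<alpha>" "\<not> good \<alpha>" and level_inv: "\<And>\<beta>. \<beta> < \<alpha> \<Longrightarrow> level_inv \<beta>"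
    and x: "x \<in> X" "dom x = below \<alpha>" and y: "y \<in> Tr \<beta>" "\<beta> < \<alpha>"
  shows "stab Fn \<alpha> x y < \<theta> \<and> (\<forall>i. stab Fn \<alpha> x y \<le> i \<longrightarrow> i < \<theta> \<longrightarrow>
     (\<forall>\<gamma>\<in>C \<alpha>. \<forall>\<gamma>'\<in>C \<alpha>. dom y \<subseteq> below \<gamma> \<longrightarrow> \<gamma> \<le> \<gamma>' \<longrightarrow>
        Fn \<gamma> (x |` below \<gamma>) i y \<subseteq>\<^sub>m Fn \<gamma>' (x |` below \<gamma>') i y))"
proof -
  have domy: "dom y = below \<beta>" using level_inv_dom[OF level_inv y(1)] y(2) by simp
  define P where "P \<gamma> \<gamma>' j \<longleftrightarrow> j < \<theta> \<and> (\<forall>i. j \<le> i \<longrightarrow> i < \<theta> \<longrightarrow> Fn \<gamma> (x |` below \<gamma>) i y \<subseteq>\<^sub>m Fn \<gamma>' (x |` below \<gamma>') i y)" for \<gamma> \<gamma>' j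
  have "\<exists>j. P \<gamma> \<gamma>' j" if "\<gamma> \<in> C \<alpha>" "\<gamma>' \<in> C \<alpha>" "\<beta> \<le> \<gamma>" "\<gamma> \<le> \<gamma>'" for \<gamma> \<gamma>'
  proof -
    have less: "\<gamma>' < \<alpha>" using C_less \<alpha> that by blast
    have "cobounded \<theta> {i. Fn \<gamma> (x |` below \<gamma>' |` below \<gamma>) i y \<subseteq>\<^sub>m Fn \<gamma>' (x |` below \<gamma>') i y}"
      by (rule level_inv_cobounded[OF level_inv[OF less]])
        (use X_closed x y that less dom_restrict_below[of x \<alpha> \<gamma>'] in \<open>simp_all del: dom_restrict\<close>)
    then show ?thesis using that unfolding cobounded_def P_def by (auto simp: min_absorb2)
  qed
  then obtain h where h: "\<And>\<gamma> \<gamma>'. \<gamma> \<in> C \<alpha> \<Longrightarrow> \<gamma>' \<in> C \<alpha> \<Longrightarrow> \<beta> \<le> \<gamma> \<Longrightarrow> \<gamma> \<le> \<gamma>' \<Longrightarrow> P \<gamma> \<gamma>' (h \<gamma> \<gamma>')" by metis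
  \<comment> \<open>\<open>h\<close> is unspecified on pairs that are not increasing or lie too low;
    cutting to \<open>below \<theta>\<close> discards values that could not be bounded.\<close>
  define S where "S = (\<lambda>(\<gamma>, \<gamma>'). h \<gamma> \<gamma>') ` (C \<alpha> \<times> C \<alpha>) \<inter> below \<theta>"
  have "|S| \<le>o |(\<lambda>(\<gamma>, \<gamma>'). h \<gamma> \<gamma>') ` (C \<alpha> \<times> C \<alpha>)|" unfolding S_def by (rule card_of_mono1) auto
  also have "|(\<lambda>(\<gamma>, \<gamma>'). h \<gamma> \<gamma>') ` (C \<alpha> \<times> C \<alpha>)| \<le>o |C \<alpha> \<times> C \<alpha>|" by (rule card_of_image)
  also have "|C \<alpha> \<times> C \<alpha>| <o |below \<theta>|"
    using theta good_or_short(1)[OF \<alpha>(2)] by (intro Times_ordLess_infinite) (auto simp: regular_ord_def)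
  finally obtain j where j: "j < \<theta>" "\<forall>i\<in>S. i < j"
    using regular_ord_bounded[OF theta, of S] unfolding S_def by blast
  have "\<exists>j. j < \<theta> \<and> (\<forall>i. j \<le> i \<longrightarrow> i < \<theta> \<longrightarrow>
     (\<forall>\<gamma>\<in>C \<alpha>. \<forall>\<gamma>'\<in>C \<alpha>. dom y \<subseteq> below \<gamma> \<longrightarrow> \<gamma> \<le> \<gamma>' \<longrightarrow>
        Fn \<gamma> (x |` below \<gamma>) i y \<subseteq>\<^sub>m Fn \<gamma>' (x |` below \<gamma>') i y))"
  proof (intro exI[of _ j] conjI allI impI ballI j(1))
    fix i \<gamma> \<gamma>' assume *: "j \<le> i" "i < \<theta>" "\<gamma> \<in> C \<alpha>" "\<gamma>' \<in> C \<alpha>" "dom y \<subseteq> below \<gamma>" "\<gamma> \<le> \<gamma>'"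
    then have P: "P \<gamma> \<gamma>' (h \<gamma> \<gamma>')" using h domy by simp
    then have "h \<gamma> \<gamma>' \<in> S" using * unfolding S_def P_def by auto
    then have "h \<gamma> \<gamma>' \<le> i" using j(2) *(1) by (meson less_imp_le less_le_trans)
    then show "Fn \<gamma> (x |` below \<gamma>) i y \<subseteq>\<^sub>m Fn \<gamma>' (x |` below \<gamma>') i y" using P * by (simp add: P_def)
  qed
  then show ?thesis unfolding stab_def by (rule someI_ex)
qed

lemma pieces_props:
  assumes \<alpha>: "is_limit \<alpha>" and level_inv: "\<And>\<beta>. \<beta> < \<alpha> \<Longrightarrow> level_inv \<beta>"
    and x: "x \<in> X" "dom x = below \<alpha>" and y: "y \<in> Tr \<beta>" "\<beta> < \<alpha>"
  shows "i < \<theta> \<Longrightarrow> \<gamma> \<in> C \<alpha> \<Longrightarrow> \<beta> \<le> \<gamma> \<Longrightarrow> pieces \<alpha> x i y \<gamma> \<in> Tr \<gamma> \<and> y \<subseteq>\<^sub>m pieces \<alpha> x i y \<gamma>"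
    and "i < \<theta> \<Longrightarrow> \<gamma> \<in> C \<alpha> \<Longrightarrow> \<gamma>' \<in> C \<alpha> \<Longrightarrow> \<beta> \<le> \<gamma> \<Longrightarrow> \<gamma> \<le> \<gamma>' \<Longrightarrow> pieces \<alpha> x i y \<gamma> \<subseteq>\<^sub>m pieces \<alpha> x i y \<gamma>'"
    and "\<gamma> \<in> C \<alpha> \<Longrightarrow> \<beta> \<le> \<gamma> \<Longrightarrow> cobounded \<theta> {i. pieces \<alpha> x i y \<gamma> = Fn \<gamma> (x |` below \<gamma>) i y}"
proof -
  have domy: "dom y = below \<beta>" using level_inv_dom[OF level_inv y(1)] y(2) by simp
  have xd: "x |` below \<gamma> \<in> X" "dom (x |` below \<gamma>) = below \<gamma>" "\<gamma> < \<alpha>" if "\<gamma> \<in> C \<alpha>" for \<gamma>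
    using X_closed x C_less[OF \<alpha> that] dom_restrict_below[of x \<alpha> \<gamma>] by simp_all
  show "i < \<theta> \<Longrightarrow> \<gamma> \<in> C \<alpha> \<Longrightarrow> \<beta> \<le> \<gamma> \<Longrightarrow> pieces \<alpha> x i y \<gamma> \<in> Tr \<gamma> \<and> y \<subseteq>\<^sub>m pieces \<alpha> x i y \<gamma>" for i \<gamma>
  proof (cases "good \<alpha>")
    case True
    assume "i < \<theta>" "\<gamma> \<in> C \<alpha>" "\<beta> \<le> \<gamma>"
    then show ?thesis using path_props[OF \<alpha> True level_inv _ xd(1,2) y(1), of \<gamma>] True by (simp add: pieces_def)
  next
    case False
    assume "i < \<theta>" "\<gamma> \<in> C \<alpha>" "\<beta> \<le> \<gamma>"
    moreover from this have "max i (stab Fn \<alpha> x y) < \<theta>" using stab_props[OF \<alpha> False level_inv x y] by simp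
    ultimately show ?thesis using level_inv_Fn[OF level_inv[OF xd(3)] xd(1,2) _ y(1), of \<gamma>] False by (simp add: pieces_def)
  qed
  show "i < \<theta> \<Longrightarrow> \<gamma> \<in> C \<alpha> \<Longrightarrow> \<gamma>' \<in> C \<alpha> \<Longrightarrow> \<beta> \<le> \<gamma> \<Longrightarrow> \<gamma> \<le> \<gamma>' \<Longrightarrow> pieces \<alpha> x i y \<gamma> \<subseteq>\<^sub>m pieces \<alpha> x i y \<gamma>'" for i \<gamma> \<gamma>'
  proof (cases "good \<alpha>")
    case True
    assume *: "i < \<theta>" "\<gamma> \<in> C \<alpha>" "\<gamma>' \<in> C \<alpha>" "\<beta> \<le> \<gamma>" "\<gamma> \<le> \<gamma>'"
    then have "pth \<alpha> \<gamma> (x |` below \<gamma>' |` below \<gamma>) i y \<subseteq>\<^sub>m pth \<alpha> \<gamma>' (x |` below \<gamma>') i y"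
      using path_props[OF \<alpha> True level_inv _ xd(1,2) y(1), of \<gamma>'] by (meson order_trans)
    then show ?thesis using * True by (simp add: pieces_def min_absorb2)
  next
    case False
    assume "i < \<theta>" "\<gamma> \<in> C \<alpha>" "\<gamma>' \<in> C \<alpha>" "\<beta> \<le> \<gamma>" "\<gamma> \<le> \<gamma>'"
    then show ?thesis using stab_props[OF \<alpha> False level_inv x y] False by (simp add: pieces_def domy)
  qed
  show "\<gamma> \<in> C \<alpha> \<Longrightarrow> \<beta> \<le> \<gamma> \<Longrightarrow> cobounded \<theta> {i. pieces \<alpha> x i y \<gamma> = Fn \<gamma> (x |` below \<gamma>) i y}" for \<gamma>
  proof (cases "good \<alpha>")
    case True
    assume "\<gamma> \<in> C \<alpha>" "\<beta> \<le> \<gamma>"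
    then show ?thesis using path_props[OF \<alpha> True level_inv _ xd(1,2) y(1), of \<gamma>] True by (simp add: pieces_def)
  next
    case False
    \<comment> \<open>From \<open>stab\<close> on the maximum is the index itself, so the pieces are
      the old nodes.\<close>
    then show ?thesis using stab_props[OF \<alpha> False level_inv x y]
      unfolding cobounded_def by (intro exI[of _ "stab Fn \<alpha> x y"]) (simp add: pieces_def max_absorb1)
  qed
qed

lemma Fn_limit_props:
  assumes \<alpha>: "is_limit \<alpha>" and level_inv: "\<And>\<beta>. \<beta> < \<alpha> \<Longrightarrow> level_inv \<beta>"
    and x: "x \<in> X" "dom x = below \<alpha>" and y: "y \<in> Tr \<beta>" "\<beta> < \<alpha>" and i: "i < \<theta>"
  shows "dom (Fn \<alpha> x i y) = below \<alpha>" and "y \<subseteq>\<^sub>m Fn \<alpha> x i y"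
    and "\<And>\<gamma>. \<gamma> \<in> C \<alpha> \<Longrightarrow> \<beta> \<le> \<gamma> \<Longrightarrow> pieces \<alpha> x i y \<gamma> \<subseteq>\<^sub>m Fn \<alpha> x i y"
    and "\<And>\<gamma>. \<gamma> < \<alpha> \<Longrightarrow> Fn \<alpha> x i y |` below \<gamma> \<in> Tr \<gamma>"
proof -
  have domy: "dom y = below \<beta>" using level_inv_dom[OF level_inv y(1)] y(2) by simp
  define S where "S = pieces \<alpha> x i y ` {\<gamma>\<in>C \<alpha>. \<beta> \<le> \<gamma>}"
  have "dom y \<noteq> below \<alpha>" using domy y(2) by auto
  then have F: "Fn \<alpha> x i y = Umap S"
    using Fn_limit[OF \<alpha>, of y x i] unfolding S_def pieces_def by (cases "good \<alpha>") (simp_all add: domy)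
  note pp = pieces_props[OF \<alpha> level_inv x y]
  have le: "pieces \<alpha> x i y \<gamma> \<subseteq>\<^sub>m Umap S" if "\<gamma> \<in> C \<alpha>" "\<beta> \<le> \<gamma>" for \<gamma>
  proof (rule map_le_Umap)
    fix s t assume "s \<in> S" "t \<in> S"
    then obtain \<delta> \<delta>' where "\<delta> \<in> C \<alpha>" "\<delta>' \<in> C \<alpha>" "\<beta> \<le> \<delta>" "\<beta> \<le> \<delta>'" "s = pieces \<alpha> x i y \<delta>" "t = pieces \<alpha> x i y \<delta>'"
      unfolding S_def by auto
    then show "s \<subseteq>\<^sub>m t \<or> t \<subseteq>\<^sub>m s" using pp(2)[OF _ i] by (meson linear)
  qed (use that in \<open>simp add: S_def\<close>)
  have dp: "dom (pieces \<alpha> x i y \<gamma>) = below \<gamma>" if "\<gamma> \<in> C \<alpha>" "\<beta> \<le> \<gamma>" for \<gamma>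
    using level_inv_dom[OF level_inv[OF C_less[OF \<alpha>]]] pp(1)[OF _ i] that by blast
  have big: "\<exists>\<gamma>\<in>C \<alpha>. \<beta> \<le> \<gamma> \<and> \<xi> < \<gamma>" if "\<xi> < \<alpha>" for \<xi>
    using C_cofinal[OF \<alpha>, of "max \<beta> \<xi>"] that y(2) by (auto intro: less_imp_le)
  have "dom (Umap S) = (\<Union>\<gamma>\<in>{\<gamma>\<in>C \<alpha>. \<beta> \<le> \<gamma>}. below \<gamma>)"
    unfolding dom_Umap S_def using dp by auto
  also have "\<dots> = below \<alpha>"
  proof (rule set_eqI, rule iffI)
    fix \<xi> assume "\<xi> \<in> (\<Union>\<gamma>\<in>{\<gamma>\<in>C \<alpha>. \<beta> \<le> \<gamma>}. below \<gamma>)"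
    then obtain \<gamma> where "\<gamma> \<in> C \<alpha>" "\<xi> < \<gamma>" by auto
    then show "\<xi> \<in> below \<alpha>" using C_less[OF \<alpha>, of \<gamma>] by simp
  next
    fix \<xi> assume "\<xi> \<in> below \<alpha>"
    then show "\<xi> \<in> (\<Union>\<gamma>\<in>{\<gamma>\<in>C \<alpha>. \<beta> \<le> \<gamma>}. below \<gamma>)" using big[of \<xi>] by auto
  qed
  finally show "dom (Fn \<alpha> x i y) = below \<alpha>" unfolding F .
  show le': "pieces \<alpha> x i y \<gamma> \<subseteq>\<^sub>m Fn \<alpha> x i y" if "\<gamma> \<in> C \<alpha>" "\<beta> \<le> \<gamma>" for \<gamma>
    using le that F by simp
  obtain \<gamma> where "\<gamma> \<in> C \<alpha>" "\<beta> \<le> \<gamma>" using big[OF y(2)] by blast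
  then show "y \<subseteq>\<^sub>m Fn \<alpha> x i y" using pp(1)[OF _ i] le' map_le_trans by blast
  show "Fn \<alpha> x i y |` below \<gamma> \<in> Tr \<gamma>" if "\<gamma> < \<alpha>" for \<gamma>
  proof -
    obtain \<gamma>' where \<gamma>': "\<gamma>' \<in> C \<alpha>" "\<beta> \<le> \<gamma>'" "\<gamma> < \<gamma>'" using big[OF \<open>\<gamma> < \<alpha>\<close>] by blast
    have "Fn \<alpha> x i y |` below \<gamma>' = pieces \<alpha> x i y \<gamma>'"
      by (rule map_le_restrict_below) (use le' dp \<gamma>' in blast)+
    then have "Fn \<alpha> x i y |` below \<gamma> = pieces \<alpha> x i y \<gamma>' |` below \<gamma>"
      using \<gamma>'(3) by (metis less_imp_le min_absorb2 restrict_below_below)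
    also have "\<dots> \<in> Tr \<gamma>"
      by (rule level_inv_restrict[OF level_inv[OF C_less[OF \<alpha> \<gamma>'(1)]]]) (use pp(1)[OF _ i \<gamma>'(1,2)] \<gamma>'(3) in auto)
    finally show ?thesis .
  qed
qed

lemma level_inv_limit:
  assumes \<alpha>: "is_limit \<alpha>" and level_inv: "\<And>\<beta>. \<beta> < \<alpha> \<Longrightarrow> level_inv \<beta>"
  shows "level_inv \<alpha>"
proof -
  have T1: "dom t = below \<alpha> \<and> (\<forall>\<beta><\<alpha>. t |` below \<beta> \<in> Tr \<beta>)" if "t \<in> Tr \<alpha>" for t
  proof -
    from that[unfolded Tr_limit[OF \<alpha>]]
    consider x i y \<beta> where "t = Fn \<alpha> x i y" "x \<in> X" "dom x = below \<alpha>" "i < \<theta>" "\<beta> < \<alpha>" "y \<in> Tr \<beta>"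
      | "dom t = below \<alpha> \<and> (\<forall>\<beta><\<alpha>. t |` below \<beta> \<in> Tr \<beta>)" by blast
    then show ?thesis
    proof cases
      case 1
      then show ?thesis using Fn_limit_props(1,4)[OF \<alpha> level_inv 1(2,3,6,5,4)] by simp
    qed
  qed
  have T2: "Fn \<alpha> x i y \<in> Tr \<alpha> \<and> y \<subseteq>\<^sub>m Fn \<alpha> x i y"
    if "x \<in> X" "dom x = below \<alpha>" "\<beta> \<le> \<alpha>" "y \<in> Tr \<beta>" "i < \<theta>" for x \<beta> y i
  proof (cases "\<beta> = \<alpha>")
    case True
    then have "Fn \<alpha> x i y = y" using T1 that by (intro Fn_top) auto
    then show ?thesis using that True by simp
  next
    case False
    then have "\<beta> < \<alpha>" using that by simp
    then show ?thesis using Fn_limit_props(2)[OF \<alpha> level_inv that(1,2,4) _ that(5)] that Tr_limit[OF \<alpha>] by blast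
  qed
  have T3: "cobounded \<theta> {i. Fn \<beta>' (x |` below \<beta>') i y \<subseteq>\<^sub>m Fn \<alpha> x i y}"
    if x: "x \<in> X" "dom x = below \<alpha>" and y: "y \<in> Tr \<beta>" "\<beta> \<le> \<beta>'" "\<beta>' \<le> \<alpha>" for x \<beta> y \<beta>'
  proof (cases "\<beta>' = \<alpha>")
    case True
    then show ?thesis using restrict_below_self[OF x(2)] by (intro cobounded_all theta) simp
  next
    case False
    then have l: "\<beta>' < \<alpha>" "\<beta> < \<alpha>" using y by auto
    \<comment> \<open>A single point of \<open>C \<alpha>\<close> past \<open>\<beta>'\<close>
      suffices: for all large indices \<open>Fn\<close> increases from \<open>\<beta>'\<close> to
      \<gamma> and equals the piece there, which lies below the union.\<close>
    obtain \<gamma> where \<gamma>: "\<gamma> \<in> C \<alpha>" "\<beta>' < \<gamma>" using C_cofinal[OF \<alpha> l(1)] by blast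
    have \<gamma>\<alpha>: "\<gamma> < \<alpha>" using C_less[OF \<alpha> \<gamma>(1)] .
    have 1: "cobounded \<theta> {i. Fn \<beta>' (x |` below \<gamma> |` below \<beta>') i y \<subseteq>\<^sub>m Fn \<gamma> (x |` below \<gamma>) i y}"
      by (rule level_inv_cobounded[OF level_inv[OF \<gamma>\<alpha>]])
        (use X_closed x y \<gamma> \<gamma>\<alpha> dom_restrict_below[of x \<alpha> \<gamma>] in \<open>simp_all del: dom_restrict\<close>)
    have 2: "cobounded \<theta> {i. pieces \<alpha> x i y \<gamma> = Fn \<gamma> (x |` below \<gamma>) i y}"
      by (rule pieces_props(3)[OF \<alpha> level_inv x y(1) l(2)]) (use \<gamma> y in auto)
    show ?thesis
    proof (rule cobounded_mono[OF cobounded_Int[OF 1 2]])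
      fix i assume "i < \<theta>" and *: "i \<in> {i. Fn \<beta>' (x |` below \<gamma> |` below \<beta>') i y \<subseteq>\<^sub>m Fn \<gamma> (x |` below \<gamma>) i y} \<inter>
        {i. pieces \<alpha> x i y \<gamma> = Fn \<gamma> (x |` below \<gamma>) i y}"
      have "pieces \<alpha> x i y \<gamma> \<subseteq>\<^sub>m Fn \<alpha> x i y"
        by (rule Fn_limit_props(3)[OF \<alpha> level_inv x y(1) l(2) \<open>i < \<theta>\<close>]) (use \<gamma> y in auto)
      moreover have "Fn \<beta>' (x |` below \<beta>') i y \<subseteq>\<^sub>m pieces \<alpha> x i y \<gamma>"
        using * \<gamma>(2) by (simp add: min_absorb2)
      ultimately show "i \<in> {i. Fn \<beta>' (x |` below \<beta>') i y \<subseteq>\<^sub>m Fn \<alpha> x i y}" using map_le_trans by auto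
    qed
  qed
  show ?thesis using T1 T2 T3 by (rule level_invI)
qed

section \<open>Successor levels and the induction\<close>

lemma level_inv_suc:
  assumes s: "sucof \<alpha> \<delta>" and level_inv: "level_inv \<delta>"
  shows "level_inv \<alpha>"
proof -
  have da: "\<delta> < \<alpha>" using s by (simp add: sucof_def)
  have restr: "t(\<delta> := v) |` below \<beta> = t |` below \<beta>" if "\<beta> \<le> \<delta>" for t :: "'k node" and v \<beta>
    using that by (auto simp: restrict_map_def fun_eq_iff)
  have T1: "dom t = below \<alpha> \<and> (\<forall>\<beta><\<alpha>. t |` below \<beta> \<in> Tr \<beta>)" if "t \<in> Tr \<alpha>" for t
  proof -
    from that[unfolded Tr_suc[OF s]] obtain u \<xi> where u: "t = u(\<delta> \<mapsto> \<xi>)" "u \<in> Tr \<delta>" by blast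
    have "dom t = below \<alpha>" using level_inv_dom[OF level_inv u(2)] u(1) sucof_below[OF s] by simp
    moreover have "t |` below \<beta> \<in> Tr \<beta>" if "\<beta> < \<alpha>" for \<beta>
      using sucof_le[OF s that] level_inv_restrict[OF level_inv u(2)] restr u(1) by simp
    ultimately show ?thesis by blast
  qed
  have xd: "x |` below \<delta> \<in> X" "dom (x |` below \<delta>) = below \<delta>" "\<exists>\<xi>. x \<delta> = Some \<xi>" if "x \<in> X" "dom x = below \<alpha>" for x
    using that X_closed dom_restrict_below[of x \<alpha> \<delta>] da by (simp_all add: domIff[symmetric] del: not_None_eq dom_restrict flip: not_None_eq)
  have Fs: "Fn \<alpha> x i y = (Fn \<delta> (x |` below \<delta>) i y)(\<delta> := x \<delta>)" and Fin: "Fn \<alpha> x i y \<in> Tr \<alpha>"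
    and Fle: "Fn \<delta> (x |` below \<delta>) i y \<subseteq>\<^sub>m Fn \<alpha> x i y"  "y \<subseteq>\<^sub>m Fn \<alpha> x i y"
    if x: "x \<in> X" "dom x = below \<alpha>" and y: "\<beta> \<le> \<delta>" "y \<in> Tr \<beta>" and i: "i < \<theta>" for x \<beta> y i
  proof -
    note I = level_inv_Fn[OF level_inv xd(1,2)[OF x] y i]
    have "dom y \<subseteq> below \<delta>" using map_le_implies_dom_le[OF I(2)] level_inv_dom[OF level_inv I(1)] by simp
    then have "dom y \<noteq> below \<alpha>" using da by auto
    then show F: "Fn \<alpha> x i y = (Fn \<delta> (x |` below \<delta>) i y)(\<delta> := x \<delta>)" by (rule Fn_suc[OF s])
    obtain \<xi> where "x \<delta> = Some \<xi>" using xd(3)[OF x] by blast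
    then have "(Fn \<delta> (x |` below \<delta>) i y)(\<delta> \<mapsto> \<xi>) \<in> Tr \<alpha>" unfolding Tr_suc[OF s] using I(1) x(1) by blast
    then show "Fn \<alpha> x i y \<in> Tr \<alpha>" unfolding F \<open>x \<delta> = Some \<xi>\<close> .
    show "Fn \<delta> (x |` below \<delta>) i y \<subseteq>\<^sub>m Fn \<alpha> x i y"
      unfolding F map_le_def using level_inv_dom[OF level_inv I(1)] by auto
    then show "y \<subseteq>\<^sub>m Fn \<alpha> x i y" using I(2) map_le_trans by blast
  qed
  have top: "Fn \<alpha> x i y = y" if "y \<in> Tr \<alpha>" for x i y using T1[OF that] by (intro Fn_top) simp
  have T2: "Fn \<alpha> x i y \<in> Tr \<alpha> \<and> y \<subseteq>\<^sub>m Fn \<alpha> x i y"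
    if "x \<in> X" "dom x = below \<alpha>" "\<beta> \<le> \<alpha>" "y \<in> Tr \<beta>" "i < \<theta>" for x \<beta> y i
  proof (cases "\<beta> = \<alpha>")
    case False
    then have "\<beta> \<le> \<delta>" using that sucof_le[OF s] by auto
    then show ?thesis using Fin Fle(2) that by blast
  qed (use that top in simp)
  have T3: "cobounded \<theta> {i. Fn \<beta>' (x |` below \<beta>') i y \<subseteq>\<^sub>m Fn \<alpha> x i y}"
    if x: "x \<in> X" "dom x = below \<alpha>" and y: "y \<in> Tr \<beta>" "\<beta> \<le> \<beta>'" "\<beta>' \<le> \<alpha>" for x \<beta> y \<beta>'
  proof (cases "\<beta>' = \<alpha>")
    case True
    then show ?thesis using restrict_below_self[OF x(2)] by (intro cobounded_all theta) simp
  next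
    case False
    then have l: "\<beta>' \<le> \<delta>" "\<beta> \<le> \<delta>" using y sucof_le[OF s] by auto
    have 1: "cobounded \<theta> {i. Fn \<beta>' (x |` below \<delta> |` below \<beta>') i y \<subseteq>\<^sub>m Fn \<delta> (x |` below \<delta>) i y}"
      by (rule level_inv_cobounded[OF level_inv xd(1,2)[OF x] y(1,2) l(1)])
    show ?thesis
    proof (rule cobounded_mono[OF 1])
      fix i assume "i < \<theta>" and *: "i \<in> {i. Fn \<beta>' (x |` below \<delta> |` below \<beta>') i y \<subseteq>\<^sub>m Fn \<delta> (x |` below \<delta>) i y}"
      then show "i \<in> {i. Fn \<beta>' (x |` below \<beta>') i y \<subseteq>\<^sub>m Fn \<alpha> x i y}"
        using map_le_trans[OF _ Fle(1)[OF x l(2) y(1)]] l(1) by (simp add: min_absorb2)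
    qed
  qed
  show ?thesis using T1 T2 T3 by (rule level_invI)
qed

lemma level_inv_zero:
  assumes "\<nexists>\<beta>. \<beta> < \<alpha>"
  shows "level_inv \<alpha>"
proof -
  have e: "below \<alpha> = {}" using assms by auto
  have le: "\<beta> \<le> \<alpha> \<Longrightarrow> \<beta> = \<alpha>" for \<beta> using assms by (auto simp: le_less)
  have F: "Fn \<alpha> x i Map.empty = Map.empty" for x i by (rule Fn_top) (simp add: e)
  show ?thesis unfolding level_inv_def
    using assms by (auto simp: Tr_zero e F intro!: cobounded_all[OF theta] dest!: le)
qed

lemma level_inv: "level_inv \<alpha>"
proof (induction \<alpha> rule: less_induct)
  case (less \<alpha>)
  show ?case
  proof (cases "is_limit \<alpha>")
    case False
    show ?thesis
    proof (cases "\<exists>\<beta>. \<beta> < \<alpha>")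
      case True
      then have s: "sucof \<alpha> (pd \<alpha>)" using not_limit_sucof False by blast
      then have "pd \<alpha> < \<alpha>" by (simp add: sucof_def)
      then show ?thesis using level_inv_suc[OF s] less by blast
    qed (rule level_inv_zero)
  qed (use less level_inv_limit in blast)
qed

end

section \<open>Sealing dense sets of tuples\<close>

text \<open>The ordinals below \<eta> carry a well-order, so a smaller cardinal is isomorphic to one
  of its proper initial segments, and these are the sets \<open>below a\<close>.\<close>

lemma ordLess_below_obtain:
  fixes \<eta> :: "'k::wellorder"
  assumes "|A| <o |below \<eta>|"
  obtains \<mu> where "\<mu> < \<eta>" "|A| \<le>o |below \<mu>|"
proof -
  define R where "R = {(x, y). x \<le> y \<and> y < \<eta>}"
  have F: "Field R = below \<eta>" by (auto simp: R_def Field_def)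
  have "wf ({(x, y). x < y} :: 'k rel)" by (rule wf)
  then have "wf (R - Id)" by (rule wf_subset) (auto simp: R_def)
  then have W: "Well_order R"
    unfolding well_order_on_def linear_order_on_def partial_order_on_def preorder_on_def F
    by (auto simp: R_def refl_on_def trans_def antisym_def total_on_def)
  then have "|below \<eta>| \<le>o R" using card_of_least F by metis
  with assms have "|A| <o R" by (rule ordLess_ordLeq_trans)
  then obtain a where a: "a \<in> Field R" "|A| =o Restr R (underS R a)"
    using ordLess_iff_ordIso_Restr[OF W card_of_Well_order] by metis
  have u: "underS R a = below a" using a(1) F by (auto simp: R_def underS_def)
  have "Field (Restr R (below a)) = below a" using a(1) F by (auto simp: R_def Field_def)
  then have "|A| =o |below a|" using card_of_cong[OF a(2)] by (simp add: u Field_card_of)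
  then show ?thesis using that[of a] a(1) F by (auto simp: ordIso_iff_ordLeq)
qed

context ascent_tree
begin

lemma dom_Tr: "t \<in> Tr \<alpha> \<Longrightarrow> dom t = below \<alpha>"
  using level_inv_dom[OF level_inv] .

lemma restrict_Tr: "t \<in> Tr \<alpha> \<Longrightarrow> \<beta> \<le> \<alpha> \<Longrightarrow> t |` below \<beta> \<in> Tr \<beta>"
  using level_inv_restrict[OF level_inv] .

lemma Tr_level_unique: "t \<in> Tr \<alpha> \<Longrightarrow> t \<in> Tr \<beta> \<Longrightarrow> \<alpha> = \<beta>"
  using dom_Tr below_inj by metis

lemma Tr_extend:
  assumes "t \<in> Tr \<beta>" "\<beta> \<le> \<alpha>"
  shows "\<exists>u\<in>Tr \<alpha>. t \<subseteq>\<^sub>m u"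
proof -
  obtain x where "x \<in> X" "dom x = below \<alpha>" using X_level by blast
  moreover obtain i where "i < \<theta>" using regular_ord_nonempty[OF theta] by blast
  ultimately show ?thesis using level_inv_Fn[OF level_inv _ _ assms(2,1)] by blast
qed

text \<open>A branch is determined by its restrictions along a cofinal set of fewer than \<eta>
  points, hence by a tuple of nodes that is shorter than \<eta>.\<close>

lemma small_branches:
  assumes \<alpha>: "is_limit \<alpha>" "\<alpha> \<notin> E_ge \<eta>" and Y: "small K Y"
  shows "small K {t. dom t = below \<alpha> \<and> (\<forall>\<beta><\<alpha>. t |` below \<beta> \<in> Y)}"
proof -
  obtain A where A: "A \<subseteq> below \<alpha>" "\<forall>\<beta><\<alpha>. \<exists>\<delta>\<in>A. \<beta> \<le> \<delta>" "\<not> |below \<eta>| \<le>o |A|"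
    using \<alpha>(2) by (auto simp: E_ge_def)
  obtain \<mu> where \<mu>: "\<mu> < \<eta>" "|A| \<le>o |below \<mu>|"
    using ordLess_below_obtain[OF not_card_of_ordLeq[OF A(3)]] .
  have "A \<noteq> {}" using A(2) \<alpha>(1) by (auto simp: is_limit_def)
  then obtain e where e: "e ` below \<mu> = A" using \<mu>(2) card_of_ordLeq2 by metis
  let ?f = "\<lambda>t k. if k < \<mu> then t |` below (e k) else undefined"
  show ?thesis
  proof (rule small_inj_on)
    show "small K (tup \<mu> Y)" using small_tup[OF Y \<mu>(1)] .
    show "?f ` {t. dom t = below \<alpha> \<and> (\<forall>\<beta><\<alpha>. t |` below \<beta> \<in> Y)} \<subseteq> tup \<mu> Y"
    proof -
      have "e k < \<alpha>" if "k < \<mu>" for k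
      proof -
        have "e k \<in> A" using e that by auto
        then show ?thesis using A(1) by auto
      qed
      then show ?thesis by (auto simp: tup_def)
    qed
    show "inj_on ?f {t. dom t = below \<alpha> \<and> (\<forall>\<beta><\<alpha>. t |` below \<beta> \<in> Y)}"
    proof (rule inj_onI)
      fix t t' assume t: "t \<in> {t. dom t = below \<alpha> \<and> (\<forall>\<beta><\<alpha>. t |` below \<beta> \<in> Y)}"
        and t': "t' \<in> {t. dom t = below \<alpha> \<and> (\<forall>\<beta><\<alpha>. t |` below \<beta> \<in> Y)}" and eq: "?f t = ?f t'"
      have "t \<xi> = t' \<xi>" for \<xi>
      proof (cases "\<xi> < \<alpha>")
        case True
        obtain \<xi>' where "\<xi> < \<xi>'" "\<xi>' < \<alpha>" using True \<alpha>(1) by (auto simp: is_limit_def)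
        then obtain \<delta> where "\<delta> \<in> A" "\<xi>' \<le> \<delta>" using A(2) by blast
        then obtain k where k: "k < \<mu>" "\<xi> < e k" using e \<open>\<xi> < \<xi>'\<close> by fastforce
        have "t |` below (e k) = t' |` below (e k)" using fun_cong[OF eq, of k] k(1) by simp
        then show ?thesis using k(2) by (metis mem_below restrict_in)
      next
        case False
        then show ?thesis using t t' by (metis (mono_tags, lifting) domIff mem_Collect_eq mem_below)
      qed
      then show "t = t'" by blast
    qed
  qed
qed

lemma Tr_small: "small K (Tr \<alpha>)"
proof (induction \<alpha> rule: less_induct)
  case (less \<alpha>)
  consider "\<nexists>\<beta>. \<beta> < \<alpha>" | \<delta> where "sucof \<alpha> \<delta>" | "is_limit \<alpha>" using not_limit_sucof by metis
  then show ?case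
  proof cases
    case 1
    then show ?thesis by (simp add: Tr_zero small_finite)
  next
    case (2 \<delta>)
    have da: "\<delta> < \<alpha>" using 2 by (simp add: sucof_def)
    let ?V = "{\<xi>. \<exists>x\<in>X. x \<delta> = Some \<xi>}"
    \<comment> \<open>A longer sequence takes the same value at \<delta> as its restriction to
      \<alpha>, so level \<alpha> of \<open>X\<close> bounds the number of appended values.\<close>
    have "?V \<subseteq> (\<lambda>x. the (x \<delta>)) ` {x \<in> X. dom x = below \<alpha>}"
    proof clarify
      fix x \<xi> assume x: "x \<in> X" "x \<delta> = Some \<xi>"
      obtain \<gamma> where \<gamma>: "dom x = below \<gamma>" using X_dom x by blast
      then have "\<delta> < \<gamma>" using x(2) by (metis domI mem_below)
      then have "\<alpha> \<le> \<gamma>" using 2 by (simp add: sucof_def)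
      then have mem: "x |` below \<alpha> \<in> {x \<in> X. dom x = below \<alpha>}"
        using X_closed[OF x(1)] dom_restrict_below[OF \<gamma>] by (simp del: dom_restrict)
      have "\<xi> = the ((x |` below \<alpha>) \<delta>)" using x(2) da by simp
      then show "\<xi> \<in> (\<lambda>x. the (x \<delta>)) ` {x \<in> X. dom x = below \<alpha>}" using mem by (rule image_eqI)
    qed
    then have "small K ?V" by (rule small_subset[OF small_image[OF X_small]])
    then have "small K ({e0, e1} \<union> ?V)" by (intro small_Un small_finite[of "{e0, e1}"]) simp_all
    then have "small K (Tr \<delta> \<times> ({e0, e1} \<union> ?V))" by (rule small_Times[OF less[OF da]])
    then have "small K ((\<lambda>(t, \<xi>). t(\<delta> \<mapsto> \<xi>)) ` (Tr \<delta> \<times> ({e0, e1} \<union> ?V)))" by (rule small_image)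
    then show ?thesis by (rule small_subset) (auto simp: Tr_suc[OF 2] image_iff)
  next
    case 3
    let ?Y = "\<Union>\<beta>\<in>below \<alpha>. Tr \<beta>"
    have Y: "small K ?Y" by (rule small_UN[OF small_below]) (use less in simp)
    have "small K ({x \<in> X. dom x = below \<alpha>} \<times> below \<theta> \<times> ?Y)"
      by (rule small_Times[OF X_small small_Times[OF small_below Y]])
    then have "small K ((\<lambda>(x, i, y). Fn \<alpha> x i y) ` ({x \<in> X. dom x = below \<alpha>} \<times> below \<theta> \<times> ?Y))"
      by (rule small_image)
    then have 1: "small K {Fn \<alpha> x i y |x i y. x \<in> X \<and> dom x = below \<alpha> \<and> i < \<theta> \<and> (\<exists>\<beta><\<alpha>. y \<in> Tr \<beta>)}"
    proof (rule small_subset, intro subsetI)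
      fix t assume "t \<in> {Fn \<alpha> x i y |x i y. x \<in> X \<and> dom x = below \<alpha> \<and> i < \<theta> \<and> (\<exists>\<beta><\<alpha>. y \<in> Tr \<beta>)}"
      then obtain x i y \<beta> where "t = Fn \<alpha> x i y" "x \<in> X" "dom x = below \<alpha>" "i < \<theta>" "\<beta> < \<alpha>" "y \<in> Tr \<beta>"
        by blast
      then show "t \<in> (\<lambda>(x, i, y). Fn \<alpha> x i y) ` ({x \<in> X. dom x = below \<alpha>} \<times> below \<theta> \<times> ?Y)"
        by (intro image_eqI[of _ _ "(x, i, y)"]) (auto intro!: bexI[of _ \<beta>])
    qed
    have 2: "small K {t. \<alpha> \<notin> E_ge \<eta> \<and> dom t = below \<alpha> \<and> (\<forall>\<beta><\<alpha>. t |` below \<beta> \<in> Tr \<beta>)}"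
    proof (cases "\<alpha> \<in> E_ge \<eta>")
      case True
      then show ?thesis by (simp add: small_finite)
    next
      case False
      show ?thesis by (rule small_subset[OF small_branches[OF 3 False Y]]) auto
    qed
    show ?thesis unfolding Tr_limit[OF 3] by (rule small_Un[OF 1 2])
  qed
qed

end

section \<open>Guessed dense sets and sealed levels\<close>

locale sealed_tree = ascent_tree K \<eta> \<theta> X C b psi Om e0 e1
  for K :: "'k::wellorder itself" and \<eta> \<theta> X C b psi Om e0 e1 +
  fixes St :: "'k set" and cd :: "'k \<times> ('k \<Rightarrow> 'k node \<times> 'k \<times> 'k node) \<Rightarrow> 'k"
  assumes b_onto: "\<And>\<alpha> x. \<alpha> \<in> St \<Longrightarrow> x \<in> X \<Longrightarrow> dom x = below \<alpha> \<Longrightarrow> \<exists>z\<in>restrX X (C \<alpha>). b \<alpha> z = x"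
    and C_hits: "\<And>A. (\<And>i \<beta>. \<exists>\<gamma>\<in>A i. \<beta> \<le> \<gamma>) \<Longrightarrow>
      stationary {\<alpha> \<in> E_ge \<eta> \<inter> St. \<forall>i<\<alpha>. is_sup {\<beta>\<in>C \<alpha>. succ_omega (C \<alpha> - below \<beta>) \<subseteq> A i} \<alpha>}"
    and cd: "inj_on cd (SIGMA \<tau>:below (min \<eta> \<theta>). tup \<tau> ({t. seq_below t} \<times> UNIV \<times> {t. seq_below t}))"
    and guess: "\<And>\<tau> q D. \<tau> < min \<eta> \<theta> \<Longrightarrow> q \<in> tup \<tau> ({t. seq_below t} \<times> UNIV \<times> {t. seq_below t}) \<Longrightarrow>
      D \<subseteq> tup \<tau> {t. seq_below t} \<Longrightarrow>
      \<exists>g. stationary {\<gamma>. psi \<gamma> = (\<tau>, q) \<and> Om \<gamma> \<subseteq> D \<and> (\<forall>d\<in>D. g d < \<gamma> \<longrightarrow> d \<in> Om \<gamma>)}"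
begin

abbreviation "code_set \<equiv> {t::'k node. seq_below t} \<times> (UNIV :: 'k set) \<times> {t::'k node. seq_below t}"

definition dense_above :: "'k \<Rightarrow> 'k \<Rightarrow> ('k \<Rightarrow> 'k node) \<Rightarrow> ('k \<Rightarrow> 'k node) set \<Rightarrow> bool" where
  "dense_above \<tau> \<beta> w D \<longleftrightarrow> (\<forall>\<delta> v. \<beta> \<le> \<delta> \<longrightarrow> v \<in> tup \<tau> (Tr \<delta>) \<longrightarrow> (\<forall>k<\<tau>. w k \<subseteq>\<^sub>m v k) \<longrightarrow>
     (\<exists>d\<in>D. \<forall>k<\<tau>. v k \<subseteq>\<^sub>m d k))"

text \<open>Such a point is required to be a limit, so that it cannot be a non-accumulation point of
  a \<open>C \<alpha>\<close> that fails to be coherent. Witnesses must come from levels below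
  \<gamma>, as \<open>hits\<close> demands.\<close>

definition guessed :: "'k \<Rightarrow> 'k \<Rightarrow> ('k \<Rightarrow> 'k node) \<Rightarrow> ('k \<Rightarrow> 'k node) set \<Rightarrow> ('k \<Rightarrow> 'k node \<times> 'k \<times> 'k node) \<Rightarrow> 'k set" where
  "guessed \<tau> \<beta> w D q = {\<gamma>. is_limit \<gamma> \<and> psi \<gamma> = (\<tau>, q) \<and> Om \<gamma> \<subseteq> D \<and>
     (\<forall>\<delta> v. \<beta> \<le> \<delta> \<longrightarrow> \<delta> < \<gamma> \<longrightarrow> v \<in> tup \<tau> (Tr \<delta>) \<longrightarrow> (\<forall>k<\<tau>. w k \<subseteq>\<^sub>m v k) \<longrightarrow>
       (\<exists>d\<in>Om \<gamma>. \<forall>k<\<tau>. v k \<subseteq>\<^sub>m d k \<and> (\<exists>\<epsilon><\<gamma>. d k \<in> Tr \<epsilon>)))}"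

text \<open>A level has few tuples of length \<tau>, so the codes and levels of chosen witnesses
  \<open>dd v\<close> for all tuples of level \<delta> have a common bound
  \<open>G \<delta>\<close>. At a guessing point closed under \<open>G\<close> the guessed part of
  \<open>D\<close> contains all these witnesses.\<close>

lemma guessed_unbounded:
  assumes \<tau>: "\<tau> < min \<eta> \<theta>" and q: "q \<in> tup \<tau> code_set"
    and D: "\<And>d. d \<in> D \<Longrightarrow> d \<in> tup \<tau> (\<Union>\<epsilon>. Tr \<epsilon>)" and dense: "dense_above \<tau> \<beta> w D"
  shows "\<exists>\<gamma>\<in>guessed \<tau> \<beta> w D q. \<beta>0 \<le> \<gamma>"
proof -
  have nodes: "(\<Union>\<epsilon>. Tr \<epsilon>) \<subseteq> {t. seq_below t}" using dom_Tr by (auto simp: seq_below_def)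
  have "D \<subseteq> tup \<tau> {t. seq_below t}" using D nodes unfolding tup_def by blast
  from guess[OF \<tau> q this] obtain g where
    g: "stationary {\<gamma>. psi \<gamma> = (\<tau>, q) \<and> Om \<gamma> \<subseteq> D \<and> (\<forall>d\<in>D. g d < \<gamma> \<longrightarrow> d \<in> Om \<gamma>)}" by blast
  have "\<exists>l. \<forall>k<\<tau>. \<exists>\<epsilon><l. d k \<in> Tr \<epsilon>" if "d \<in> D" for d
  proof -
    have "\<forall>k. \<exists>\<epsilon>. k < \<tau> \<longrightarrow> d k \<in> Tr \<epsilon>" using D[OF that] by (auto simp: tup_def)
    then obtain \<epsilon> where \<epsilon>: "\<And>k. k < \<tau> \<Longrightarrow> d k \<in> Tr (\<epsilon> k)" by metis
    obtain l where "\<forall>a\<in>\<epsilon> ` below \<tau>. a < l" using small_bounded[OF small_image[OF small_below]] by blast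
    then have "\<exists>\<epsilon><l. d k \<in> Tr \<epsilon>" if "k < \<tau>" for k
      using \<epsilon>[OF that] that by (intro exI[of _ "\<epsilon> k"]) simp
    then show ?thesis by blast
  qed
  then have "\<forall>d\<in>D. \<exists>l. \<forall>k<\<tau>. \<exists>\<epsilon><l. d k \<in> Tr \<epsilon>" by simp
  from bchoice[OF this] obtain lev where lev: "\<forall>d\<in>D. \<forall>k<\<tau>. \<exists>\<epsilon><lev d. d k \<in> Tr \<epsilon>" ..
  define good_v where "good_v \<delta> v \<longleftrightarrow> \<beta> \<le> \<delta> \<and> v \<in> tup \<tau> (Tr \<delta>) \<and> (\<forall>k<\<tau>. w k \<subseteq>\<^sub>m v k)" for \<delta> v
  have "\<forall>v. \<exists>d. (\<exists>\<delta>. good_v \<delta> v) \<longrightarrow> d \<in> D \<and> (\<forall>k<\<tau>. v k \<subseteq>\<^sub>m d k)"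
  proof
    fix v
    show "\<exists>d. (\<exists>\<delta>. good_v \<delta> v) \<longrightarrow> d \<in> D \<and> (\<forall>k<\<tau>. v k \<subseteq>\<^sub>m d k)"
    proof (cases "\<exists>\<delta>. good_v \<delta> v")
      case True
      then obtain \<delta> where "\<beta> \<le> \<delta>" "v \<in> tup \<tau> (Tr \<delta>)" "\<forall>k<\<tau>. w k \<subseteq>\<^sub>m v k" by (auto simp: good_v_def)
      then show ?thesis using dense unfolding dense_above_def by blast
    qed blast
  qed
  from choice[OF this] obtain dd where
    dd': "\<forall>v. (\<exists>\<delta>. good_v \<delta> v) \<longrightarrow> dd v \<in> D \<and> (\<forall>k<\<tau>. v k \<subseteq>\<^sub>m dd v k)" ..
  then have dd: "dd v \<in> D \<and> (\<forall>k<\<tau>. v k \<subseteq>\<^sub>m dd v k)" if "good_v \<delta> v" for v \<delta> using that by blast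
  have "\<exists>l>\<delta>. \<forall>v. good_v \<delta> v \<longrightarrow> g (dd v) < l \<and> lev (dd v) < l" for \<delta>
  proof -
    have "small K (tup \<tau> (Tr \<delta>))" using small_tup[OF Tr_small] \<tau> by simp
    then have "small K (((\<lambda>v. g (dd v)) ` tup \<tau> (Tr \<delta>) \<union> (\<lambda>v. lev (dd v)) ` tup \<tau> (Tr \<delta>)) \<union> {\<delta>})"
      by (intro small_Un small_image small_finite[of "{\<delta>}"]) simp_all
    then obtain l where "\<forall>a\<in>((\<lambda>v. g (dd v)) ` tup \<tau> (Tr \<delta>) \<union> (\<lambda>v. lev (dd v)) ` tup \<tau> (Tr \<delta>)) \<union> {\<delta>}. a < l"
      using small_bounded by blast
    then show ?thesis by (intro exI[of _ l]) (auto simp: good_v_def)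
  qed
  then have "\<forall>\<delta>. \<exists>l. \<delta> < l \<and> (\<forall>v. good_v \<delta> v \<longrightarrow> g (dd v) < l \<and> lev (dd v) < l)" by blast
  from choice[OF this] obtain G where
    G': "\<forall>\<delta>. \<delta> < G \<delta> \<and> (\<forall>v. good_v \<delta> v \<longrightarrow> g (dd v) < G \<delta> \<and> lev (dd v) < G \<delta>)" ..
  then have G: "\<delta> < G \<delta>" "good_v \<delta> v \<Longrightarrow> g (dd v) < G \<delta> \<and> lev (dd v) < G \<delta>" for \<delta> v by blast+
  obtain \<gamma> where \<gamma>: "\<gamma> \<in> {\<gamma>. psi \<gamma> = (\<tau>, q) \<and> Om \<gamma> \<subseteq> D \<and> (\<forall>d\<in>D. g d < \<gamma> \<longrightarrow> d \<in> Om \<gamma>)}"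
    "\<beta>0 < \<gamma>" "\<And>\<delta>. \<delta> < \<gamma> \<Longrightarrow> G \<delta> < \<gamma>"
    by (rule stationary_meets_closure[OF g, of \<beta>0 G], rule that)
  have "is_limit \<gamma>" unfolding is_limit_def using \<gamma>(2,3) G(1) by blast
  moreover have "\<exists>d\<in>Om \<gamma>. \<forall>k<\<tau>. v k \<subseteq>\<^sub>m d k \<and> (\<exists>\<epsilon><\<gamma>. d k \<in> Tr \<epsilon>)"
    if "\<beta> \<le> \<delta>" "\<delta> < \<gamma>" "v \<in> tup \<tau> (Tr \<delta>)" "\<forall>k<\<tau>. w k \<subseteq>\<^sub>m v k" for \<delta> v
  proof -
    have v: "good_v \<delta> v" using that by (simp add: good_v_def)
    have "g (dd v) < \<gamma>" "lev (dd v) < \<gamma>" using G(2)[OF v] \<gamma>(3)[OF that(2)] by auto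
    then have "dd v \<in> Om \<gamma>" using \<gamma>(1) dd[OF v] by blast
    moreover have "\<exists>\<epsilon><\<gamma>. dd v k \<in> Tr \<epsilon>" if "k < \<tau>" for k
    proof -
      have "dd v \<in> D" using dd[OF v] by blast
      then obtain \<epsilon> where "\<epsilon> < lev (dd v)" "dd v k \<in> Tr \<epsilon>" using lev \<open>k < \<tau>\<close> by blast
      then show ?thesis using \<open>lev (dd v) < \<gamma>\<close> by (intro exI[of _ \<epsilon>]) simp
    qed
    ultimately show ?thesis using dd[OF v] by blast
  qed
  ultimately have "\<gamma> \<in> guessed \<tau> \<beta> w D q" unfolding guessed_def using \<gamma>(1) by simp
  then show ?thesis using \<gamma>(2) by (intro bexI[of _ \<gamma>]) auto
qed

text \<open>At a level \<open>\<alpha>\<close> whose club \<open>C\<^sub>\<alpha>\<close> hits the guessing set of every tuple of paths, each tuple of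
  nodes is resolved at the successor in \<open>C\<^sub>\<alpha>\<close> of a sufficiently late point.\<close>

lemma sealed_at:
  assumes \<tau>: "\<tau> < min \<eta> \<theta>" and w: "inj_on w (below \<tau>)" "\<And>k. k < \<tau> \<Longrightarrow> w k \<in> Tr \<beta>"
    and \<alpha>: "\<alpha> \<in> E_ge \<eta>" and "\<beta> < \<alpha>" and u: "u \<in> tup \<tau> (Tr \<alpha>)" "\<And>k. k < \<tau> \<Longrightarrow> w k \<subseteq>\<^sub>m u k"
    and q: "\<And>k. k < \<tau> \<Longrightarrow> q k = (z k, i k, y k)"
    and zk: "\<And>k. k < \<tau> \<Longrightarrow> z k \<in> X \<and> dom (z k) = below (\<zeta> k) \<and> \<zeta> k \<in> C \<alpha> \<and> b \<alpha> (z k) = x k"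
    and uk: "\<And>k. k < \<tau> \<Longrightarrow> u k = Fn \<alpha> (x k) (i k) (y k)"
    and xk: "\<And>k. k < \<tau> \<Longrightarrow> x k \<in> X \<and> dom (x k) = below \<alpha> \<and> i k < \<theta> \<and> y k \<in> Tr (\<epsilon> k)"
    and \<rho>: "\<beta> \<le> \<rho>" "\<And>k. k < \<tau> \<Longrightarrow> \<zeta> k \<le> \<rho> \<and> \<epsilon> k \<le> \<rho>"
    and \<beta>': "\<beta>' \<in> C \<alpha>" "\<rho> < \<beta>'" "succ_omega (C \<alpha> - below \<beta>') \<subseteq> guessed \<tau> \<beta> w D q"
  shows "\<exists>d\<in>D. \<forall>k<\<tau>. d k \<subseteq>\<^sub>m u k"
proof -
  have lim: "is_limit \<alpha>" using E_ge_limit[OF \<alpha> eta_inf] .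
  define \<gamma> where "\<gamma> = (LEAST \<gamma>. \<gamma> \<in> C \<alpha> \<and> \<beta>' < \<gamma>)"
  have ex: "\<exists>\<gamma>. \<gamma> \<in> C \<alpha> \<and> \<beta>' < \<gamma>" using C_cofinal[OF lim C_less[OF lim \<beta>'(1)]] by blast
  have \<gamma>: "\<gamma> \<in> C \<alpha>" "\<beta>' < \<gamma>" using LeastI_ex[OF ex] by (auto simp: \<gamma>_def)
  have no: "\<delta> \<le> \<beta>'" if "\<delta> \<in> C \<alpha>" "\<delta> < \<gamma>" for \<delta>
    using not_less_Least[of \<delta> "\<lambda>\<gamma>. \<gamma> \<in> C \<alpha> \<and> \<beta>' < \<gamma>"] that by (auto simp: \<gamma>_def)
  \<comment> \<open>\<open>\<beta>'\<close> has no predecessor in this set, so \<gamma> is the least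
    element of \<open>succ_omega\<close>; this single element is all that gets used.\<close>
  have "(C \<alpha> - below \<beta>') \<inter> below \<gamma> = {\<beta>'}" using no \<beta>'(1) \<gamma> by (auto simp: antisym)
  then have "\<gamma> \<in> succ_omega (C \<alpha> - below \<beta>')" using \<gamma> by (simp add: succ_omega_def)
  then have \<gamma>g: "is_limit \<gamma>" "psi \<gamma> = (\<tau>, q)" "Om \<gamma> \<subseteq> D"
    "\<And>\<delta> v. \<beta> \<le> \<delta> \<Longrightarrow> \<delta> < \<gamma> \<Longrightarrow> v \<in> tup \<tau> (Tr \<delta>) \<Longrightarrow> \<forall>k<\<tau>. w k \<subseteq>\<^sub>m v k \<Longrightarrow>
       \<exists>d\<in>Om \<gamma>. \<forall>k<\<tau>. v k \<subseteq>\<^sub>m d k \<and> (\<exists>\<epsilon><\<gamma>. d k \<in> Tr \<epsilon>)"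
    using \<beta>'(3) unfolding guessed_def by blast+
  have mx: "mx (C \<alpha>) \<gamma> \<beta>'" using no \<beta>'(1) \<gamma>(2) by (simp add: mx_def)
  \<comment> \<open>\<gamma> is a limit without being an accumulation point of
    \<open>C \<alpha>\<close>, which is impossible if \<open>C \<alpha>\<close> is not
    coherent.\<close>
  have g: "good \<alpha>"
  proof (rule ccontr)
    assume "\<not> good \<alpha>"
    have "\<not> cofinal_in (C \<alpha>) \<gamma>"
    proof
      assume "cofinal_in (C \<alpha>) \<gamma>"
      then obtain \<delta> where "\<delta> \<in> C \<alpha>" "\<beta>' < \<delta>" "\<delta> < \<gamma>" using \<gamma>(2) unfolding cofinal_in_def by blast
      then show False using no[of \<delta>] by simp
    qed
    then have "\<gamma> \<in> nacc (C \<alpha>)" using \<gamma>(1) by (simp add: nacc_def acc_def)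
    then have "is_successor \<gamma>" using good_or_short(2)[OF \<open>\<not> good \<alpha>\<close>] by blast
    then obtain \<delta> where "\<delta> < \<gamma>" "\<forall>\<xi>. \<delta> < \<xi> \<longrightarrow> \<gamma> \<le> \<xi>" unfolding is_successor_def by blast
    moreover from this(1) obtain \<xi> where "\<delta> < \<xi>" "\<xi> < \<gamma>" using \<gamma>g(1) unfolding is_limit_def by blast
    ultimately show False by auto
  qed
  define G where "G = pth \<alpha> \<beta>'"
  have dy: "dom (y k) \<subseteq> below \<beta>'" "\<epsilon> k \<le> \<beta>'" "\<epsilon> k < \<alpha>" if "k < \<tau>" for k
  proof -
    have "dom (y k) = below (\<epsilon> k)" using dom_Tr xk[OF that] by blast
    moreover have "\<epsilon> k < \<beta>'" using conjunct2[OF \<rho>(2)[OF that]] \<beta>'(2) by (rule le_less_trans)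
    ultimately show "dom (y k) \<subseteq> below \<beta>'" "\<epsilon> k \<le> \<beta>'" "\<epsilon> k < \<alpha>"
      using C_less[OF lim \<beta>'(1)] by (auto intro: less_trans less_imp_le)
  qed
  have pc: "pieces \<alpha> (x k) (i k) (y k) \<delta> \<in> Tr \<delta>" "pieces \<alpha> (x k) (i k) (y k) \<delta> \<subseteq>\<^sub>m u k"
    if "k < \<tau>" "\<delta> \<in> C \<alpha>" "\<beta>' \<le> \<delta>" for k \<delta>
  proof -
    have xx: "x k \<in> X" "dom (x k) = below \<alpha>" "i k < \<theta>" "y k \<in> Tr (\<epsilon> k)" using xk that by auto
    have le: "\<epsilon> k \<le> \<delta>" using dy(2)[OF that(1)] that(3) by simp
    show "pieces \<alpha> (x k) (i k) (y k) \<delta> \<in> Tr \<delta>"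
      using pieces_props(1)[OF lim level_inv xx(1,2,4) dy(3)[OF that(1)] xx(3) that(2) le] by blast
    show "pieces \<alpha> (x k) (i k) (y k) \<delta> \<subseteq>\<^sub>m u k"
      unfolding uk[OF that(1)] by (rule Fn_limit_props(3)[OF lim level_inv xx(1,2,4) dy(3)[OF that(1)] xx(3) that(2) le])
  qed
  define v where "v k = (if k < \<tau> then G (x k |` below \<beta>') (i k) (y k) else undefined)" for k
  have vG: "vals (b \<alpha>) \<gamma> \<beta>' G k = v k" if "k < \<tau>" for k
    using that zk[OF that] q[OF that] \<gamma>g(2) by (simp add: vals_def v_def)
  have vp: "v k = pieces \<alpha> (x k) (i k) (y k) \<beta>'" if "k < \<tau>" for k
    using that g by (simp add: v_def G_def pieces_def)
  have vT: "v k \<in> Tr \<beta>'" "v k \<subseteq>\<^sub>m u k" if "k < \<tau>" for k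
    using pc[OF that \<beta>'(1)] vp[OF that] by auto
  have wv: "w k \<subseteq>\<^sub>m v k" if "k < \<tau>" for k
    using map_le_chain[OF u(2)[OF that] vT(2)[OF that] dom_Tr[OF w(2)[OF that]] dom_Tr[OF vT(1)[OF that]]] \<rho>(1) \<beta>'(2) by simp
  \<comment> \<open>The distinct nodes \<open>w k\<close> are restrictions of the values
    \<open>v k\<close>. This injectivity is the one that \<open>sealing\<close> requires.\<close>
  have vinj: "k = k'" if "k < \<tau>" "k' < \<tau>" "v k = v k'" for k k'
  proof -
    have "w k = v k |` below \<beta>" using map_le_restrict_below[OF wv[OF that(1)] dom_Tr[OF w(2)[OF that(1)]]] by simp
    also have "\<dots> = w k'" unfolding that(3) using map_le_restrict_below[OF wv[OF that(2)] dom_Tr[OF w(2)[OF that(2)]]] by simp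
    finally show ?thesis using inj_onD[OF w(1)] that by simp
  qed
  have "v \<in> tup \<tau> (Tr \<beta>')" using vT(1) by (simp add: tup_def v_def)
  moreover have "\<forall>k<\<tau>. w k \<subseteq>\<^sub>m v k" using wv by blast
  moreover have "\<beta> \<le> \<beta>'" using \<rho>(1) \<beta>'(2) by simp
  ultimately obtain d where d: "d \<in> Om \<gamma>" "\<forall>k<\<tau>. v k \<subseteq>\<^sub>m d k \<and> (\<exists>\<epsilon><\<gamma>. d k \<in> Tr \<epsilon>)"
    using \<gamma>g(4)[of \<beta>' v] \<gamma>(2) by blast
  have "hits Tr (b \<alpha>) \<gamma> \<beta>' G d" unfolding hits_def \<gamma>g(2) using d vG by simp
  then have hex: "\<exists>a. hits Tr (b \<alpha>) \<gamma> \<beta>' G a" by blast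
  \<comment> \<open>Not \<open>d\<close> but the element chosen inside \<open>stepP\<close>: the
    same choice serves all coordinates, so the nodes of \<open>u\<close> end up above one element of
    \<open>D\<close>.\<close>
  define a where "a = (SOME a. hits Tr (b \<alpha>) \<gamma> \<beta>' G a)"
  have "hits Tr (b \<alpha>) \<gamma> \<beta>' G a" unfolding a_def using hex by (rule someI_ex)
  then have a: "a \<in> D" "\<And>k. k < \<tau> \<Longrightarrow> \<exists>\<epsilon><\<gamma>. a k \<in> Tr \<epsilon>" unfolding hits_def \<gamma>g(2) using \<gamma>g(3) by auto
  have "inj_on (vals (b \<alpha>) \<gamma> \<beta>' G) (below \<tau>)"
    using vinj by (intro inj_onI) (simp add: vG)
  moreover have "fst (q k) \<in> restrX X (C \<alpha> \<inter> below \<gamma>)" if "k < \<tau>" for k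
    using zk[OF that] q[OF that] \<rho>(2)[OF that] \<beta>'(2) \<gamma>(2) by (auto simp: restrX_def intro!: bexI[of _ "\<zeta> k"])
  ultimately have seal: "sealing Tr (C \<alpha>) (b \<alpha>) \<gamma> \<beta>' G" unfolding sealing_def \<gamma>g(2) using hex by simp
  have "a k \<subseteq>\<^sub>m u k" if k: "k < \<tau>" for k
  proof -
    let ?x = "x k |` below \<gamma>"
    have t: "target (b \<alpha>) \<gamma> ?x (i k) (y k) k" unfolding target_def \<gamma>g(2) using k zk[OF k] q[OF k] by simp
    \<comment> \<open>Two entries with the same target would have equal values at
      \<open>\<beta>'\<close>; hence the choice in \<open>stepP\<close> can only be
      \<open>k\<close>.\<close>
    have "k' = k" if "target (b \<alpha>) \<gamma> ?x (i k) (y k) k'" for k'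
    proof -
      from that obtain z' where z': "k' < \<tau>" "q k' = (z', i k, y k)" "?x = b \<alpha> z' |` below \<gamma>"
        unfolding target_def \<gamma>g(2) by auto
      have "x k |` below \<beta>' = ?x |` below \<beta>'" using \<gamma>(2) by (simp add: min_absorb2)
      also have "\<dots> = b \<alpha> z' |` below \<beta>'" unfolding z'(3) using \<gamma>(2) by (simp add: min_absorb2)
      finally have "vals (b \<alpha>) \<gamma> \<beta>' G k' = v k" unfolding vals_def \<gamma>g(2) using z'(2) k by (simp add: v_def)
      then have "v k' = v k" using vG[OF z'(1)] by simp
      then show ?thesis using vinj z'(1) k by blast
    qed
    then have some: "(SOME k'. target (b \<alpha>) \<gamma> ?x (i k) (y k) k') = k" using t by blast
    have "pth \<alpha> \<gamma> ?x (i k) (y k) = Fn \<gamma> ?x (i k) (a k)"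
      unfolding path_mx[OF mx] G_def[symmetric] stepP_def some a_def[symmetric] using seal t dy(1)[OF k] by auto
    moreover obtain \<epsilon>' where e': "\<epsilon>' < \<gamma>" "a k \<in> Tr \<epsilon>'" using a(2)[OF k] by blast
    have "a k \<subseteq>\<^sub>m Fn \<gamma> ?x (i k) (a k)"
      by (rule level_inv_Fn(2)[OF level_inv, where \<beta> = \<epsilon>'])
        (use X_closed xk[OF k] dom_restrict_below[of "x k" \<alpha> \<gamma>] C_less[OF lim \<gamma>(1)] e' in \<open>simp_all del: dom_restrict\<close>)
    ultimately have "a k \<subseteq>\<^sub>m pieces \<alpha> (x k) (i k) (y k) \<gamma>" using g by (simp add: pieces_def)
    then show ?thesis by (rule map_le_trans[OF _ pc(2)[OF k \<gamma>(1) less_imp_le[OF \<gamma>(2)]]])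
  qed
  then show ?thesis using a(1) by blast
qed

text \<open>The \<kappa> many sets handed to \<open>C_hits\<close> are the sets
  \<open>guessed\<close> for all tuples of names, indexed through \<open>cd\<close>. A node of level
  \<alpha> in \<open>E_ge \<eta>\<close> is a value of \<open>Fn\<close> at some \<open>x\<close>
  represented by a name of height in \<open>C \<alpha>\<close>; cofinality at least \<eta> puts the
  names and starting nodes of a tuple below one \<rho>, and closure of \<alpha> under
  \<open>G\<close> puts the code of the tuple below \<alpha>.\<close>

lemma sealing_lemma:
  assumes \<tau>: "\<tau> < min \<eta> \<theta>" and w: "inj_on w (below \<tau>)" "\<And>k. k < \<tau> \<Longrightarrow> w k \<in> Tr \<beta>"
    and D: "\<And>d. d \<in> D \<Longrightarrow> d \<in> tup \<tau> (\<Union>\<epsilon>. Tr \<epsilon>)" and dense: "dense_above \<tau> \<beta> w D"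
  shows "\<exists>\<alpha>>\<beta>. \<forall>u\<in>tup \<tau> (Tr \<alpha>). (\<forall>k<\<tau>. w k \<subseteq>\<^sub>m u k) \<longrightarrow> (\<exists>d\<in>D. \<forall>k<\<tau>. d k \<subseteq>\<^sub>m u k)"
proof -
  let ?V = "tup \<tau> code_set"
  have cdq: "q = q'" if "q \<in> ?V" "q' \<in> ?V" "cd (\<tau>, q) = cd (\<tau>, q')" for q q'
    using inj_onD[OF cd that(3)] that \<tau> by auto
  \<comment> \<open>Indices that code no tuple of length \<tau> receive all of \<kappa>, which keeps
    every \<open>A j\<close> cofinal.\<close>
  define A where "A j = (if \<exists>q\<in>?V. cd (\<tau>, q) = j then guessed \<tau> \<beta> w D (THE q. q \<in> ?V \<and> cd (\<tau>, q) = j) else UNIV)" for j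
  have A: "A (cd (\<tau>, q)) = guessed \<tau> \<beta> w D q" if "q \<in> ?V" for q
  proof -
    have "(THE q'. q' \<in> ?V \<and> cd (\<tau>, q') = cd (\<tau>, q)) = q" using that cdq by blast
    then show ?thesis using that by (auto simp: A_def)
  qed
  have "\<exists>\<gamma>\<in>A j. \<beta>0 \<le> \<gamma>" for j \<beta>0
  proof (cases "\<exists>q\<in>?V. cd (\<tau>, q) = j")
    case True
    then obtain q where "q \<in> ?V" "cd (\<tau>, q) = j" by blast
    then show ?thesis using A[of q] guessed_unbounded[OF \<tau> _ D dense] by metis
  qed (auto simp: A_def)
  from C_hits[of A, OF this] have st: "stationary {\<alpha> \<in> E_ge \<eta> \<inter> St. \<forall>i<\<alpha>. is_sup {\<beta>\<in>C \<alpha>. succ_omega (C \<alpha> - below \<beta>) \<subseteq> A i} \<alpha>}" .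
  define Xl where "Xl \<delta> = (\<Union>\<xi>\<in>{..\<delta>}. {x \<in> X. dom x = below \<xi>})" for \<delta>
  define Tl where "Tl \<delta> = (\<Union>\<xi>\<in>{..\<delta>}. Tr \<xi>)" for \<delta>
  have "\<exists>l. \<forall>q\<in>tup \<tau> (Xl \<delta> \<times> below \<theta> \<times> Tl \<delta>). cd (\<tau>, q) < l" for \<delta>
  proof -
    have "small K (Xl \<delta> \<times> below \<theta> \<times> Tl \<delta>)"
      unfolding Xl_def Tl_def by (intro small_Times small_UN_le X_small Tr_small small_below)
    then have "small K ((\<lambda>q. cd (\<tau>, q)) ` tup \<tau> (Xl \<delta> \<times> below \<theta> \<times> Tl \<delta>))"
      using \<tau> by (intro small_image small_tup) auto
    from small_bounded[OF this] show ?thesis by blast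
  qed
  then obtain G where G: "\<And>\<delta> q. q \<in> tup \<tau> (Xl \<delta> \<times> below \<theta> \<times> Tl \<delta>) \<Longrightarrow> cd (\<tau>, q) < G \<delta>" by metis
  obtain \<alpha> where \<alpha>: "\<alpha> \<in> {\<alpha> \<in> E_ge \<eta> \<inter> St. \<forall>i<\<alpha>. is_sup {\<beta>\<in>C \<alpha>. succ_omega (C \<alpha> - below \<beta>) \<subseteq> A i} \<alpha>}"
    "\<beta> < \<alpha>" "\<And>\<delta>. \<delta> < \<alpha> \<Longrightarrow> G \<delta> < \<alpha>"
    by (rule stationary_meets_closure[OF st, of \<beta> G], rule that)
  then have \<alpha>E: "\<alpha> \<in> E_ge \<eta>" and \<alpha>S: "\<alpha> \<in> St" by auto
  have lim: "is_limit \<alpha>" using E_ge_limit[OF \<alpha>E eta_inf] .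
  show ?thesis
  proof (intro exI[of _ \<alpha>] conjI ballI impI \<alpha>(2))
    fix u assume u: "u \<in> tup \<tau> (Tr \<alpha>)" "\<forall>k<\<tau>. w k \<subseteq>\<^sub>m u k"
    have "\<exists>x i y z \<zeta> \<epsilon>. u k = Fn \<alpha> x i y \<and> x \<in> X \<and> dom x = below \<alpha> \<and> i < \<theta> \<and> \<epsilon> < \<alpha> \<and> y \<in> Tr \<epsilon> \<and>
      z \<in> X \<and> dom z = below \<zeta> \<and> \<zeta> \<in> C \<alpha> \<and> b \<alpha> z = x" if "k < \<tau>" for k
    proof -
      have "u k \<in> Tr \<alpha>" using u that by (simp add: tup_def)
      then obtain x i y \<epsilon> where *: "u k = Fn \<alpha> x i y" "x \<in> X" "dom x = below \<alpha>" "i < \<theta>" "\<epsilon> < \<alpha>" "y \<in> Tr \<epsilon>"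
        unfolding Tr_limit[OF lim] using \<alpha>E by blast
      moreover obtain z where "z \<in> restrX X (C \<alpha>)" "b \<alpha> z = x" using b_onto[OF \<alpha>S *(2,3)] by blast
      ultimately show ?thesis unfolding restrX_def by blast
    qed
    then obtain x i y z \<zeta> \<epsilon> where *: "\<And>k. k < \<tau> \<Longrightarrow> u k = Fn \<alpha> (x k) (i k) (y k) \<and> x k \<in> X \<and> dom (x k) = below \<alpha> \<and>
        i k < \<theta> \<and> \<epsilon> k < \<alpha> \<and> y k \<in> Tr (\<epsilon> k) \<and> z k \<in> X \<and> dom (z k) = below (\<zeta> k) \<and> \<zeta> k \<in> C \<alpha> \<and> b \<alpha> (z k) = x k"
      by metis
    have "\<forall>k<\<tau>. max (\<zeta> k) (\<epsilon> k) < \<alpha>" using * C_less[OF lim] by auto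
    then obtain \<rho>0 where \<rho>0: "\<rho>0 < \<alpha>" "\<forall>k<\<tau>. max (\<zeta> k) (\<epsilon> k) < \<rho>0"
      using E_ge_bounded[OF \<alpha>E eta_card, of \<tau> "\<lambda>k. max (\<zeta> k) (\<epsilon> k)"] \<tau> by auto
    define \<rho> where "\<rho> = max \<rho>0 \<beta>"
    have \<rho>: "\<rho> < \<alpha>" "\<beta> \<le> \<rho>" "\<And>k. k < \<tau> \<Longrightarrow> \<zeta> k \<le> \<rho> \<and> \<epsilon> k \<le> \<rho>"
      using \<rho>0 \<alpha>(2) by (auto simp: \<rho>_def less_imp_le le_max_iff_disj)
    define q where "q k = (if k < \<tau> then (z k, i k, y k) else undefined)" for k
    have "q \<in> tup \<tau> (Xl \<rho> \<times> below \<theta> \<times> Tl \<rho>)"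
    proof -
      have "(z k, i k, y k) \<in> Xl \<rho> \<times> below \<theta> \<times> Tl \<rho>" if "k < \<tau>" for k
      proof -
        have "z k \<in> Xl \<rho>" unfolding Xl_def using *[OF that] \<rho>(3)[OF that] by auto
        moreover have "y k \<in> Tl \<rho>" unfolding Tl_def using *[OF that] \<rho>(3)[OF that] by (intro UN_I[of "\<epsilon> k"]) auto
        ultimately show ?thesis using *[OF that] by simp
      qed
      then show ?thesis by (simp add: tup_def q_def)
    qed
    \<comment> \<open>At \<alpha> only the sets with index below \<alpha> are hit.\<close>
    then have "cd (\<tau>, q) < \<alpha>" using G \<alpha>(3)[OF \<rho>(1)] less_trans by blast
    moreover have "q \<in> ?V"
    proof -
      have "(z k, i k, y k) \<in> code_set" if "k < \<tau>" for k
        using *[OF that] dom_Tr[of "y k" "\<epsilon> k"] by (auto simp: seq_below_def)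
      then show ?thesis by (simp add: tup_def q_def)
    qed
    \<comment> \<open>The variable \<open>\<beta>''\<close> stands in for \<beta>, which the set
      comprehension would capture.\<close>
    ultimately have sup: "is_sup {\<beta>\<in>C \<alpha>. succ_omega (C \<alpha> - below \<beta>) \<subseteq> guessed \<tau> \<beta>'' w D q} \<alpha>" if "\<beta>'' = \<beta>" for \<beta>''
      using \<alpha>(1) A that by force
    have "\<exists>\<beta>'\<in>C \<alpha>. \<rho> < \<beta>' \<and> succ_omega (C \<alpha> - below \<beta>') \<subseteq> guessed \<tau> \<beta> w D q"
    proof (rule ccontr)
      assume "\<not> ?thesis"
      then have "\<forall>\<beta>'\<in>{\<beta>'\<in>C \<alpha>. succ_omega (C \<alpha> - below \<beta>') \<subseteq> guessed \<tau> \<beta> w D q}. \<beta>' \<le> \<rho>"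
        using not_le by blast
      then have "\<alpha> \<le> \<rho>" using sup[OF refl] unfolding is_sup_def by blast
      then show False using \<rho>(1) by simp
    qed
    then obtain \<beta>' where \<beta>': "\<beta>' \<in> C \<alpha>" "\<rho> < \<beta>'" "succ_omega (C \<alpha> - below \<beta>') \<subseteq> guessed \<tau> \<beta> w D q" by blast
    show "\<exists>d\<in>D. \<forall>k<\<tau>. d k \<subseteq>\<^sub>m u k"
    proof (rule sealed_at[OF \<tau> w \<alpha>E \<alpha>(2) u(1)])
      show "w k \<subseteq>\<^sub>m u k" if "k < \<tau>" for k using u(2) that by blast
      show "q k = (z k, i k, y k)" if "k < \<tau>" for k using that by (simp add: q_def)
      show "z k \<in> X \<and> dom (z k) = below (\<zeta> k) \<and> \<zeta> k \<in> C \<alpha> \<and> b \<alpha> (z k) = x k" if "k < \<tau>" for k using *[OF that] by blast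
      show "u k = Fn \<alpha> (x k) (i k) (y k)" if "k < \<tau>" for k using *[OF that] by blast
      show "x k \<in> X \<and> dom (x k) = below \<alpha> \<and> i k < \<theta> \<and> y k \<in> Tr (\<epsilon> k)" if "k < \<tau>" for k using *[OF that] by blast
    qed (use \<rho> \<beta>' in blast)+
  qed
qed

end

section \<open>From nodes to a tree on \<open>\<kappa>\<close>\<close>

text \<open>Sufficient conditions for \<open>rk\<close> to be the height: it rises along
  \<open>R\<close>, takes every smaller value below each element, and orders the predecessors of an
  element. Well-foundedness comes from the values being ordinals.\<close>

definition ranked :: "'n set \<Rightarrow> ('n \<Rightarrow> 'n \<Rightarrow> bool) \<Rightarrow> ('n \<Rightarrow> 'k::wellorder) \<Rightarrow> bool" where
  "ranked T R rk \<longleftrightarrow> (\<forall>x y. R x y \<longrightarrow> x \<in> T \<and> y \<in> T \<and> rk x < rk y) \<and>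
     (\<forall>x y z. R x y \<longrightarrow> R y z \<longrightarrow> R x z) \<and>
     (\<forall>z\<in>T. \<forall>\<beta><rk z. \<exists>y. R y z \<and> rk y = \<beta>) \<and>
     (\<forall>x y z. R x z \<longrightarrow> R y z \<longrightarrow> rk x \<le> rk y \<longrightarrow> x = y \<or> R x y)"

lemma rankedD:
  assumes "ranked T R rk"
  shows "R x y \<Longrightarrow> x \<in> T" "R x y \<Longrightarrow> y \<in> T" "R x y \<Longrightarrow> rk x < rk y" "R x y \<Longrightarrow> R y z \<Longrightarrow> R x z"
    "z \<in> T \<Longrightarrow> \<beta> < rk z \<Longrightarrow> \<exists>y. R y z \<and> rk y = \<beta>"
    "R x z \<Longrightarrow> R y z \<Longrightarrow> rk x \<le> rk y \<Longrightarrow> x = y \<or> R x y"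
  using assms unfolding ranked_def by blast+

lemma ranked_comparable: "ranked T R rk \<Longrightarrow> R x z \<Longrightarrow> R y z \<Longrightarrow> x = y \<or> R x y \<or> R y x"
  using rankedD(6)[of T R rk x z y] rankedD(6)[of T R rk y z x] by (metis linear)

lemma ranked_is_tree:
  assumes "ranked T R (rk :: 'n \<Rightarrow> 'k::wellorder)"
  shows "is_tree T R"
  unfolding is_tree_def
proof (intro conjI allI impI ballI)
  note R = rankedD[OF assms]
  fix x y z
  show "R x y \<Longrightarrow> x \<in> T" "R x y \<Longrightarrow> y \<in> T" "R x y \<Longrightarrow> R y z \<Longrightarrow> R x z" by (rule R; assumption)+
  show "\<not> R x x" using R(3)[of x x] by blast
  show "R y x \<Longrightarrow> R z x \<Longrightarrow> y = z \<or> R y z \<or> R z y" by (rule ranked_comparable[OF assms])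
  fix A assume "A \<subseteq> {y. R y x}" "A \<noteq> {}"
  then have ex: "\<exists>r. \<exists>a\<in>A. rk a = r" by blast
  obtain m where m: "m \<in> A" "rk m = (LEAST r. \<exists>a\<in>A. rk a = r)" using LeastI_ex[OF ex] by blast
  have "\<not> R a m" if "a \<in> A" for a
  proof
    assume "R a m"
    then have "rk a < rk m" by (rule R(3))
    moreover have "rk m \<le> rk a" unfolding m(2) by (rule Least_le) (use that in blast)
    ultimately show False by simp
  qed
  then show "\<exists>m\<in>A. \<forall>a\<in>A. \<not> R a m" using m(1) by blast
qed

text \<open>An increasing enumeration of the predecessors satisfies
  \<open>rk (f \<beta>) = \<beta>\<close> by induction on \<beta>: a smaller rank would repeat an
  earlier value, a larger one would leave a predecessor of rank \<beta> without a place. Conversely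
  the predecessors are enumerated by their ranks.\<close>

lemma ranked_ht_is:
  assumes rT: "ranked T R (rk :: 'n \<Rightarrow> 'k::wellorder)" and x: "x \<in> T"
  shows "ht_is T R x \<alpha> \<longleftrightarrow> rk x = (\<alpha>::'k)"
proof
  note R = rankedD[OF rT]
  assume "ht_is T R x \<alpha>"
  then obtain f where f: "bij_betw f (below \<alpha>) {y. R y x}"
    "\<forall>\<beta>\<in>below \<alpha>. \<forall>\<beta>'\<in>below \<alpha>. \<beta> < \<beta>' \<longrightarrow> R (f \<beta>) (f \<beta>')" unfolding ht_is_def by blast
  have fR: "R (f \<beta>) x" if "\<beta> < \<alpha>" for \<beta> using f(1) that by (auto simp: bij_betw_def)
  have surj: "\<exists>\<beta><\<alpha>. f \<beta> = y" if "R y x" for y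
  proof -
    have "y \<in> f ` below \<alpha>" using f(1) that by (simp add: bij_betw_def)
    then show ?thesis by auto
  qed
  have rkf: "rk (f \<beta>) = \<beta>" if "\<beta> < \<alpha>" for \<beta>
    using that
  proof (induction \<beta> rule: less_induct)
    case (less \<beta>)
    have 1: "\<not> rk (f \<beta>) < \<beta>"
    proof
      assume l: "rk (f \<beta>) < \<beta>"
      then have "rk (f \<beta>) < \<alpha>" using less.prems by (rule less_trans)
      then have "rk (f (rk (f \<beta>))) = rk (f \<beta>)" using less.IH l by blast
      moreover have "R (f (rk (f \<beta>))) (f \<beta>)" using f(2) l \<open>rk (f \<beta>) < \<alpha>\<close> less.prems by simp
      ultimately show False using R(3)[of "f (rk (f \<beta>))" "f \<beta>"] by simp
    qed
    have 2: "\<not> \<beta> < rk (f \<beta>)"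
    proof
      assume "\<beta> < rk (f \<beta>)"
      then obtain y where y: "R y (f \<beta>)" "rk y = \<beta>" using R(5)[OF R(1)[OF fR[OF less.prems]]] by blast
      then have "R y x" using R(4) fR[OF less.prems] by blast
      then obtain \<beta>' where \<beta>': "\<beta>' < \<alpha>" "f \<beta>' = y" using surj by blast
      consider "\<beta>' < \<beta>" | "\<beta>' = \<beta>" | "\<beta> < \<beta>'" by (rule linorder_cases)
      then show False
      proof cases
        case 1
        then show False using less.IH[OF 1 \<beta>'(1)] \<beta>'(2) y(2) by simp
      next
        case 2
        then show False using y(1) \<beta>'(2) R(3) by blast
      next
        case 3
        then have "R (f \<beta>) (f \<beta>')" using f(2) less.prems \<beta>'(1) by simp
        then have "rk (f \<beta>) < rk y" using R(3) \<beta>'(2) by blast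
        then show False using R(3)[OF y(1)] by (rule less_asym)
      qed
    qed
    show ?case using 1 2 by (simp add: not_less)
  qed
  show "rk x = \<alpha>"
  proof (rule antisym)
    show "rk x \<le> \<alpha>"
    proof (rule ccontr)
      assume "\<not> rk x \<le> \<alpha>"
      then obtain y where "R y x" "rk y = \<alpha>" using R(5)[OF x] not_le by blast
      moreover from this(1) obtain \<beta> where "\<beta> < \<alpha>" "f \<beta> = y" using surj by blast
      ultimately show False using rkf[of \<beta>] by simp
    qed
    show "\<alpha> \<le> rk x"
    proof (rule ccontr)
      assume "\<not> \<alpha> \<le> rk x"
      then have "rk x < \<alpha>" by simp
      then have "rk (f (rk x)) = rk x" "R (f (rk x)) x" by (rule rkf, rule fR)
      then show False using R(3)[of "f (rk x)" x] by simp
    qed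
  qed
next
  note R = rankedD[OF rT]
  assume rk: "rk x = \<alpha>"
  define f where "f \<beta> = (SOME y. R y x \<and> rk y = \<beta>)" for \<beta>
  have f: "R (f \<beta>) x \<and> rk (f \<beta>) = \<beta>" if "\<beta> < \<alpha>" for \<beta>
    unfolding f_def by (rule someI_ex) (rule R(5)[OF x], use rk that in simp)
  have mono: "R (f \<beta>) (f \<beta>')" if "\<beta> < \<beta>'" "\<beta>' < \<alpha>" for \<beta> \<beta>'
  proof -
    have b: "\<beta> < \<alpha>" using that by (rule less_trans)
    have "f \<beta> = f \<beta>' \<or> R (f \<beta>) (f \<beta>')"
      by (rule R(6)[OF conjunct1[OF f[OF b]] conjunct1[OF f[OF that(2)]]])
        (unfold conjunct2[OF f[OF b]] conjunct2[OF f[OF that(2)]], rule less_imp_le[OF that(1)])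
    moreover have "f \<beta> \<noteq> f \<beta>'"
    proof
      assume "f \<beta> = f \<beta>'"
      then have "rk (f \<beta>) = rk (f \<beta>')" by (rule arg_cong)
      then show False unfolding conjunct2[OF f[OF b]] conjunct2[OF f[OF that(2)]] using that(1) by simp
    qed
    ultimately show ?thesis by blast
  qed
  have "inj_on f (below \<alpha>)"
  proof (rule inj_onI)
    fix \<beta> \<beta>' assume *: "\<beta> \<in> below \<alpha>" "\<beta>' \<in> below \<alpha>" "f \<beta> = f \<beta>'"
    have "\<beta> = rk (f \<beta>)" using *(1) f[of \<beta>] by simp
    also have "\<dots> = rk (f \<beta>')" unfolding *(3) ..
    also have "\<dots> = \<beta>'" using *(2) f[of \<beta>'] by simp
    finally show "\<beta> = \<beta>'" .
  qed
  moreover have "f ` below \<alpha> = {y. R y x}"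
  proof (intro equalityI subsetI)
    fix y assume "y \<in> {y. R y x}"
    then have y: "R y x" by simp
    have l: "rk y < \<alpha>" using R(3)[OF y] rk by simp
    have "y = f (rk y)"
      using R(6)[OF y conjunct1[OF f[OF l]]] f[OF l] R(3)[of y "f (rk y)"] by auto
    then show "y \<in> f ` below \<alpha>" using l by (intro image_eqI[of _ _ "rk y"]) auto
  qed (use f in auto)
  ultimately show "ht_is T R x \<alpha>" unfolding ht_is_def bij_betw_def using mono by (intro exI[of _ f]) auto
qed

lemma ranked_level:
  assumes "ranked T R (rk :: 'n \<Rightarrow> 'k::wellorder)"
  shows "level T R \<alpha> = {x\<in>T. rk x = \<alpha>}"
  unfolding level_def using ranked_ht_is[OF assms] by blast

text \<open>An antichain of bounded rank lies in a small union of small levels, so it is enough to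
  bound ranks.\<close>

lemma (in regular_uncountable) souslin_ranked:
  fixes rk :: "'n \<Rightarrow> 'k"
  assumes r: "ranked T R rk"
    and ne: "\<And>\<alpha>. \<exists>x\<in>T. rk x = \<alpha>" and sm: "\<And>\<alpha>. small K {x\<in>T. rk x = \<alpha>}"
    and branch: "\<And>B. B \<subseteq> T \<Longrightarrow> \<forall>x\<in>B. \<forall>y\<in>B. x = y \<or> R x y \<or> R y x \<Longrightarrow> \<forall>\<alpha>. \<exists>x\<in>B. rk x = \<alpha> \<Longrightarrow> False"
    and antichain: "\<And>A. A \<subseteq> T \<Longrightarrow> \<forall>x\<in>A. \<forall>y\<in>A. x \<noteq> y \<longrightarrow> \<not> R x y \<Longrightarrow> \<exists>\<alpha>. \<forall>x\<in>A. rk x \<le> \<alpha>"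
  shows "souslin K T R"
  unfolding souslin_def
proof (intro conjI notI)
  have "{x\<in>T. rk x = \<alpha>} \<noteq> {}" for \<alpha> using ne[of \<alpha>] by blast
  moreover have "\<forall>x\<in>T. \<exists>\<alpha>::'k. ht_is T R x \<alpha>" using ranked_ht_is[OF r] by blast
  ultimately show "kappa_tree K T R"
    unfolding kappa_tree_def ranked_level[OF r]
    using ranked_is_tree[OF r] sm by (simp add: small_def)
next
  assume "\<exists>B\<subseteq>T. (\<forall>x\<in>B. \<forall>y\<in>B. x = y \<or> R x y \<or> R y x) \<and> (\<forall>\<alpha>::'k. B \<inter> level T R \<alpha> \<noteq> {})"
  then obtain B where B: "B \<subseteq> T" "\<forall>x\<in>B. \<forall>y\<in>B. x = y \<or> R x y \<or> R y x" "\<forall>\<alpha>::'k. B \<inter> level T R \<alpha> \<noteq> {}" by blast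
  show False by (rule branch[OF B(1,2)]) (use B(3) in \<open>auto simp: ranked_level[OF r]\<close>)
next
  assume "\<exists>A\<subseteq>T. (\<forall>x\<in>A. \<forall>y\<in>A. x \<noteq> y \<longrightarrow> \<not> R x y) \<and> |UNIV::'k set| \<le>o |A|"
  then obtain A where A: "A \<subseteq> T" "\<forall>x\<in>A. \<forall>y\<in>A. x \<noteq> y \<longrightarrow> \<not> R x y" "|UNIV::'k set| \<le>o |A|" by blast
  obtain \<alpha> where "\<forall>x\<in>A. rk x \<le> \<alpha>" using antichain[OF A(1,2)] by blast
  then have sub: "A \<subseteq> (\<Union>\<beta>\<in>{..\<alpha>}. {x\<in>T. rk x = \<beta>})" using A(1) by auto
  have "small K A" by (rule small_subset[OF small_UN_le[OF sm] sub])
  then show False using A(3) not_ordLess_ordLeq by (auto simp: small_def)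
qed

context sealed_tree
begin

text \<open>An antichain element \<open>a\<close> above the sealed level restricts to a tuple \<open>u\<close> there, which lies
  above an element of the dense set.  As \<open>a\<close> lies above that element too, the latter lies above an
  element of the antichain, which differs from \<open>a\<close> because its level is lower.\<close>

lemma antichain_bounded:
  assumes \<tau>: "\<tau> < min \<eta> \<theta>" "k0 < \<tau>" and w: "inj_on w (below \<tau>)" "\<And>k. k < \<tau> \<Longrightarrow> w k \<in> Tr \<beta>"
    and A: "\<And>a. a \<in> A \<Longrightarrow> \<exists>\<delta>. a \<in> tup \<tau> (Tr \<delta>)"
    and Aw: "\<And>a \<delta> k. a \<in> A \<Longrightarrow> a \<in> tup \<tau> (Tr \<delta>) \<Longrightarrow> \<beta> \<le> \<delta> \<Longrightarrow> k < \<tau> \<Longrightarrow> w k \<subseteq>\<^sub>m a k"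
    and anti: "\<And>a a' \<delta> \<delta>'. a \<in> A \<Longrightarrow> a' \<in> A \<Longrightarrow> a \<in> tup \<tau> (Tr \<delta>) \<Longrightarrow> a' \<in> tup \<tau> (Tr \<delta>') \<Longrightarrow> \<delta>' < \<delta> \<Longrightarrow>
      \<exists>k<\<tau>. \<not> a' k \<subseteq>\<^sub>m a k"
  shows "\<exists>\<alpha>. \<forall>a\<in>A. \<forall>\<delta>. a \<in> tup \<tau> (Tr \<delta>) \<longrightarrow> \<delta> \<le> \<alpha>"
proof -
  define le where "le a d \<longleftrightarrow> (\<forall>k<\<tau>. a k \<subseteq>\<^sub>m d k)" for a d :: "'k \<Rightarrow> 'k node"
  \<comment> \<open>A tuple below some member of \<open>A\<close> is extended by that member, which
    is in \<open>D\<close> by the first alternative; any other tuple of nodes of one level is in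
    \<open>D\<close> by the second.\<close>
  define D where "D = {d. (\<exists>\<delta>. d \<in> tup \<tau> (Tr \<delta>)) \<and> ((\<exists>a\<in>A. le a d) \<or> (\<forall>a\<in>A. \<not> le d a))}"
  have "dense_above \<tau> \<beta> w D"
    unfolding dense_above_def
  proof (intro allI impI)
    fix \<delta> v assume v: "v \<in> tup \<tau> (Tr \<delta>)"
    have refl: "le v v" for v by (simp add: le_def)
    show "\<exists>d\<in>D. \<forall>k<\<tau>. v k \<subseteq>\<^sub>m d k"
    proof (cases "\<exists>a\<in>A. le v a")
      case True
      then obtain a where a: "a \<in> A" "le v a" by blast
      then have "a \<in> D" using A refl unfolding D_def by blast
      then show ?thesis using a(2) unfolding le_def by blast
    next
      case False
      then have "v \<in> D" using v unfolding D_def by blast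
      then show ?thesis using refl[of v] unfolding le_def by blast
    qed
  qed
  moreover have "d \<in> tup \<tau> (\<Union>\<epsilon>. Tr \<epsilon>)" if "d \<in> D" for d
    using that unfolding D_def tup_def by blast
  ultimately obtain \<alpha> where \<alpha>: "\<beta> < \<alpha>" "\<forall>u\<in>tup \<tau> (Tr \<alpha>). (\<forall>k<\<tau>. w k \<subseteq>\<^sub>m u k) \<longrightarrow> (\<exists>d\<in>D. \<forall>k<\<tau>. d k \<subseteq>\<^sub>m u k)"
    using sealing_lemma[OF \<tau>(1) w, of D] by blast
  have "\<delta> \<le> \<alpha>" if a: "a \<in> A" "a \<in> tup \<tau> (Tr \<delta>)" for a \<delta>
  proof (rule ccontr)
    assume "\<not> \<delta> \<le> \<alpha>"
    then have d: "\<alpha> < \<delta>" "\<beta> \<le> \<delta>" using \<alpha>(1) by auto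
    have aT: "a k \<in> Tr \<delta>" if "k < \<tau>" for k using a(2) that by (simp add: tup_def)
    define u where "u k = (if k < \<tau> then a k |` below \<alpha> else undefined)" for k
    have uT: "u k \<in> Tr \<alpha>" if "k < \<tau>" for k
      using restrict_Tr[OF aT[OF that] less_imp_le[OF d(1)]] that by (simp add: u_def)
    have "w k \<subseteq>\<^sub>m u k" if "k < \<tau>" for k
      unfolding u_def using that Aw[OF a d(2) that] dom_Tr[OF w(2)[OF that]] \<alpha>(1)
      by (simp add: map_le_restrictI)
    moreover have "u \<in> tup \<tau> (Tr \<alpha>)" using uT by (simp add: tup_def u_def)
    ultimately obtain e where e: "e \<in> D" "le e u" using \<alpha>(2) unfolding le_def by blast
    have "le u a" by (simp add: le_def u_def)
    then have "le e a" using e(2) unfolding le_def by (blast intro: map_le_trans)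
    \<comment> \<open>\<open>e\<close> lies below the member \<open>a\<close> of \<open>A\<close>,
      so the second alternative in \<open>D\<close> fails for it.\<close>
    then obtain a' where a': "a' \<in> A" "le a' e" using e(1) a(1) unfolding D_def by blast
    have a'u: "le a' u" and a'a: "le a' a" using a'(2) e(2) \<open>le e a\<close> unfolding le_def by (blast intro: map_le_trans)+
    obtain \<delta>' where \<delta>': "a' \<in> tup \<tau> (Tr \<delta>')" using A a'(1) by blast
    then have "a' k0 \<in> Tr \<delta>'" using \<tau>(2) by (simp add: tup_def)
    then have "below \<delta>' \<subseteq> below \<alpha>"
      using map_le_implies_dom_le[of "a' k0" "u k0"] a'u \<tau>(2) dom_Tr uT[OF \<tau>(2)] unfolding le_def by metis
    then have "\<delta>' < \<delta>" using d(1) by auto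
    from anti[OF a(1) a'(1) a(2) \<delta>' this] show False using a'a unfolding le_def by blast
  qed
  then show ?thesis by blast
qed

end

section \<open>The tree as a subset of \<kappa>\<close>

locale coded_tree = sealed_tree K \<eta> \<theta> X C b psi Om e0 e1 St cd
  for K :: "'k::wellorder itself" and \<eta> \<theta> X C b psi Om e0 e1 St cd +
  fixes h :: "'k node \<Rightarrow> 'k"
  assumes h_inj: "inj_on h {t. seq_below t}"
begin

definition N :: "'k set" where "N = h ` (\<Union>\<alpha>. Tr \<alpha>)"
definition dec :: "'k \<Rightarrow> 'k node" where "dec = inv_into (\<Union>\<alpha>. Tr \<alpha>) h"
definition rk :: "'k \<Rightarrow> 'k" where "rk a = (THE \<alpha>. dec a \<in> Tr \<alpha>)"
definition R :: "'k \<Rightarrow> 'k \<Rightarrow> bool" where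
  "R a c \<longleftrightarrow> a \<in> N \<and> c \<in> N \<and> rk a < rk c \<and> dec a \<subseteq>\<^sub>m dec c"

lemma dec_h [simp]:
  assumes "t \<in> Tr \<alpha>"
  shows "dec (h t) = t"
proof -
  have "(\<Union>\<alpha>. Tr \<alpha>) \<subseteq> {t. seq_below t}" using dom_Tr by (auto simp: seq_below_def)
  then have "inj_on h (\<Union>\<alpha>. Tr \<alpha>)" using h_inj inj_on_subset by blast
  then show ?thesis unfolding dec_def using assms by (intro inv_into_f_f) auto
qed

lemma rk_eq: "dec a \<in> Tr \<alpha> \<Longrightarrow> rk a = \<alpha>"
  unfolding rk_def using Tr_level_unique by (intro the_equality) blast+

lemma h_props: "t \<in> Tr \<alpha> \<Longrightarrow> h t \<in> N" "t \<in> Tr \<alpha> \<Longrightarrow> rk (h t) = \<alpha>"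
  using rk_eq[of "h t" \<alpha>] by (auto simp: N_def)

lemma dec_props: assumes "a \<in> N" shows "dec a \<in> Tr (rk a)" "h (dec a) = a"
proof -
  obtain t \<alpha> where "t \<in> Tr \<alpha>" "a = h t" using assms by (auto simp: N_def)
  then show "dec a \<in> Tr (rk a)" "h (dec a) = a" using h_props by simp_all
qed

lemma dec_inj: "a \<in> N \<Longrightarrow> c \<in> N \<Longrightarrow> dec a = dec c \<Longrightarrow> a = c"
  using dec_props(2) by metis

lemma dom_dec: "a \<in> N \<Longrightarrow> dom (dec a) = below (rk a)"
  using dom_Tr dec_props(1) by blast

lemma rk_level: "{a \<in> N. rk a = \<alpha>} = h ` Tr \<alpha>"
proof (intro equalityI subsetI)
  fix a assume "a \<in> {a \<in> N. rk a = \<alpha>}"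
  then show "a \<in> h ` Tr \<alpha>" using dec_props[of a] by (intro image_eqI[of _ _ "dec a"]) auto
qed (use h_props in auto)

lemma R_restrict:
  assumes "a \<in> N" "\<beta> < rk a"
  shows "R (h (dec a |` below \<beta>)) a" "rk (h (dec a |` below \<beta>)) = \<beta>" "dec (h (dec a |` below \<beta>)) = dec a |` below \<beta>"
proof -
  have t: "dec a |` below \<beta> \<in> Tr \<beta>" using restrict_Tr[OF dec_props(1)[OF assms(1)]] assms(2) by simp
  then show "rk (h (dec a |` below \<beta>)) = \<beta>" "dec (h (dec a |` below \<beta>)) = dec a |` below \<beta>"
    using h_props(2) by simp_all
  then show "R (h (dec a |` below \<beta>)) a" using h_props(1)[OF t] assms by (simp add: R_def)
qed

lemma ranked_R: "ranked N R rk"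
  unfolding ranked_def
proof (intro conjI allI impI ballI)
  fix x y z
  show "R x y \<Longrightarrow> x \<in> N" "R x y \<Longrightarrow> y \<in> N" "R x y \<Longrightarrow> rk x < rk y" by (simp_all add: R_def)
  show "R x y \<Longrightarrow> R y z \<Longrightarrow> R x z" unfolding R_def using map_le_trans less_trans by blast
  show "\<exists>y. R y z \<and> rk y = \<beta>" if "z \<in> N" "\<beta> < rk z" for \<beta> using R_restrict[OF that] by blast
  assume R: "R x z" "R y z" "rk x \<le> rk y"
  then have N: "x \<in> N" "y \<in> N" by (auto simp: R_def)
  have le: "dec x \<subseteq>\<^sub>m dec y"
    using map_le_chain[OF _ _ dom_dec[OF N(1)] dom_dec[OF N(2)] R(3), of "dec z"] R(1,2) by (auto simp: R_def)
  show "x = y \<or> R x y"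
  proof (cases "rk x = rk y")
    case True
    then have "dec x = dec y" using map_le_eq[OF le dom_dec[OF N(1)]] dom_dec[OF N(2)] by simp
    then show ?thesis using dec_inj N by blast
  next
    case False
    then show ?thesis using le N R(3) by (simp add: R_def less_le)
  qed
qed

lemma R_D: "R x y \<Longrightarrow> x \<in> N" "R x y \<Longrightarrow> y \<in> N" "R x y \<Longrightarrow> rk x < rk y" "R x y \<Longrightarrow> dec x \<subseteq>\<^sub>m dec y"
  by (simp_all add: R_def)

lemma compatible_down:
  assumes "compatible R f w" "R y f"
  shows "compatible R y w"
  using assms rankedD(4)[OF ranked_R] ranked_comparable[OF ranked_R] unfolding compatible_def by metis

text \<open>The case of tuples of length one above the root. Within \<open>'k\<close> the ordinals
  zero and one are \<open>z\<close> and \<open>o1\<close>.\<close>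

lemma antichain_nodes:
  assumes A: "A \<subseteq> N" "\<forall>x\<in>A. \<forall>y\<in>A. x \<noteq> y \<longrightarrow> \<not> R x y"
  shows "\<exists>\<alpha>. \<forall>a\<in>A. rk a \<le> \<alpha>"
proof -
  define z :: 'k where "z = (LEAST z. True)"
  have z: "z \<le> \<alpha>" for \<alpha> unfolding z_def by (rule Least_le) simp
  then have nz: "\<not> \<alpha> < z" for \<alpha> by (simp add: not_less)
  have inf: "infinite (below (min \<eta> \<theta>))" using eta_inf theta by (auto simp: regular_ord_def min_def)
  have "\<exists>o1 < min \<eta> \<theta>. below o1 = {z}"
  proof -
    define o1 where "o1 = (LEAST x. z < x)"
    have o1: "z < o1" unfolding o1_def using LeastI_ex[of "\<lambda>x. z < x"] no_max by blast
    have below: "below o1 = {z}"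
    proof (intro equalityI subsetI)
      fix x assume "x \<in> below o1"
      then have "\<not> z < x" using not_less_Least[of x "\<lambda>x. z < x"] by (simp add: o1_def)
      then show "x \<in> {z}" using z[of x] by auto
    qed (use o1 in simp)
    have "\<not> min \<eta> \<theta> \<le> o1"
    proof
      assume "min \<eta> \<theta> \<le> o1"
      then have "below (min \<eta> \<theta>) \<subseteq> {z}" using below by (metis below_subset)
      then show False using inf finite_subset by blast
    qed
    then show ?thesis using below by (intro exI[of _ o1]) (simp only: not_le simp_thms)
  qed
  then obtain o1 where o1: "o1 < min \<eta> \<theta>" "below o1 = {z}" by blast
  have k: "k < o1 \<longleftrightarrow> k = z" for k using o1(2) by (metis mem_below singleton_iff)
  have Tz: "Tr z = {Map.empty}" by (rule Tr_zero) (simp add: nz)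
  define tp where "tp a k = (if k < o1 then dec a else undefined)" for a k
  have tp: "tp a \<in> tup o1 (Tr \<delta>) \<longleftrightarrow> rk a = \<delta>" if "a \<in> N" for a \<delta>
    using dec_props(1)[OF that] rk_eq[of a \<delta>] by (auto simp: tup_def tp_def k)
  have "\<exists>\<alpha>. \<forall>a\<in>tp ` A. \<forall>\<delta>. a \<in> tup o1 (Tr \<delta>) \<longrightarrow> \<delta> \<le> \<alpha>"
  proof (rule antichain_bounded[of o1 z "\<lambda>k. Map.empty" z])
    show "inj_on (\<lambda>k. Map.empty :: 'k node) (below o1)" unfolding o1(2) by simp
    show "\<exists>\<delta>. a \<in> tup o1 (Tr \<delta>)" if "a \<in> tp ` A" for a using that tp A(1) by blast
    fix a a' \<delta> \<delta>' assume a: "a \<in> tp ` A" "a' \<in> tp ` A" "a \<in> tup o1 (Tr \<delta>)" "a' \<in> tup o1 (Tr \<delta>')" "\<delta>' < \<delta>"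
    obtain c where c: "c \<in> A" "a = tp c" using a(1) by blast
    obtain c' where c': "c' \<in> A" "a' = tp c'" using a(2) by blast
    have N: "c \<in> N" "c' \<in> N" using c(1) c'(1) A(1) by auto
    have r: "rk c = \<delta>" "rk c' = \<delta>'" using a(3,4) tp N unfolding c(2) c'(2) by blast+
    then have "c' \<noteq> c" using a(5) by auto
    then have "\<not> R c' c" using A(2) c(1) c'(1) by blast
    then have "\<not> dec c' \<subseteq>\<^sub>m dec c" using r a(5) N by (simp add: R_def)
    then show "\<exists>k < o1. \<not> a' k \<subseteq>\<^sub>m a k" by (intro exI[of _ z]) (simp add: c(2) c'(2) tp_def k)
  qed (use o1(1) k Tz in simp_all)
  then obtain \<alpha> where \<alpha>: "\<forall>a\<in>tp ` A. \<forall>\<delta>. a \<in> tup o1 (Tr \<delta>) \<longrightarrow> \<delta> \<le> \<alpha>" ..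
  have "rk a \<le> \<alpha>" if "a \<in> A" for a
  proof -
    have "tp a \<in> tup o1 (Tr (rk a))" using tp A(1) that by blast
    then show ?thesis using \<alpha> that by blast
  qed
  then show ?thesis by blast
qed

text \<open>Every node splits since \<open>e0 \<noteq> e1\<close>. The nodes
  \<open>sib \<alpha>\<close>, which leave a cofinal branch just above level \<alpha>, would form an
  antichain of unbounded rank.\<close>

lemma no_branch:
  assumes B: "B \<subseteq> N" "\<forall>x\<in>B. \<forall>y\<in>B. x = y \<or> R x y \<or> R y x" "\<forall>\<alpha>. \<exists>x\<in>B. rk x = \<alpha>"
  shows False
proof -
  obtain p where p: "\<And>\<alpha>. p \<alpha> \<in> B" "\<And>\<alpha>. rk (p \<alpha>) = \<alpha>" using B(3) by metis
  have pN: "p \<alpha> \<in> N" for \<alpha> using p(1) B(1) by blast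
  have pR: "R (p \<alpha>) (p \<beta>)" if "\<alpha> < \<beta>" for \<alpha> \<beta>
  proof -
    have "p \<alpha> \<noteq> p \<beta>" using p(2) that by (metis less_irrefl)
    moreover have "\<not> R (p \<beta>) (p \<alpha>)" using R_D(3)[of "p \<beta>" "p \<alpha>"] p(2) that by auto
    ultimately show ?thesis using B(2) p(1) by blast
  qed
  define sc where "sc \<alpha> = (LEAST \<beta>. \<alpha> < \<beta>)" for \<alpha> :: 'k
  have sc: "sucof (sc \<alpha>) \<alpha>" for \<alpha>
    unfolding sucof_def sc_def using LeastI_ex[of "\<lambda>\<beta>. \<alpha> < \<beta>"] no_max Least_le[of "\<lambda>\<beta>. \<alpha> < \<beta>"] by blast
  have sc_less: "\<alpha> < sc \<alpha>" for \<alpha> using sc by (simp add: sucof_def)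
  have "\<exists>\<xi>. (\<xi> = e0 \<or> \<xi> = e1) \<and> dec (p (sc \<alpha>)) \<alpha> \<noteq> Some \<xi>" for \<alpha>
    using e01 by (metis option.inject)
  then obtain \<xi> where \<xi>: "\<And>\<alpha>. \<xi> \<alpha> = e0 \<or> \<xi> \<alpha> = e1" "\<And>\<alpha>. dec (p (sc \<alpha>)) \<alpha> \<noteq> Some (\<xi> \<alpha>)" by metis
  define sib where "sib \<alpha> = (dec (p \<alpha>))(\<alpha> \<mapsto> \<xi> \<alpha>)" for \<alpha>
  have sT: "sib \<alpha> \<in> Tr (sc \<alpha>)" for \<alpha>
    unfolding Tr_suc[OF sc] sib_def using dec_props(1)[OF pN, of \<alpha>] p(2)[of \<alpha>] \<xi>(1)[of \<alpha>] by auto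
  have "\<not> R (h (sib \<alpha>)) (h (sib \<beta>))" for \<alpha> \<beta>
  proof
    assume "R (h (sib \<alpha>)) (h (sib \<beta>))"
    then have r: "sc \<alpha> < sc \<beta>" "sib \<alpha> \<subseteq>\<^sub>m sib \<beta>" using R_D(3,4) h_props(2)[OF sT] dec_h[OF sT] by fastforce+
    have "\<alpha> < \<beta>"
    proof (rule ccontr)
      assume "\<not> \<alpha> < \<beta>"
      then have "\<beta> < sc \<alpha>" using sc_less[of \<alpha>] by auto
      then have "sc \<beta> \<le> sc \<alpha>" using sc[of \<beta>] by (simp add: sucof_def)
      then show False using r(1) by simp
    qed
    then have le: "sc \<alpha> \<le> \<beta>" using sc[of \<alpha>] by (simp add: sucof_def)
    have "sib \<beta> \<alpha> = Some (\<xi> \<alpha>)" using r(2) by (auto simp: map_le_def sib_def)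
    \<comment> \<open>\<open>sib \<beta>\<close> still follows the branch at \<alpha>, where
      \<open>sib \<alpha>\<close> has left it.\<close>
    then have "dec (p \<beta>) \<alpha> = Some (\<xi> \<alpha>)" using less_imp_neq[OF \<open>\<alpha> < \<beta>\<close>] by (simp add: sib_def)
    moreover have "dec (p (sc \<alpha>)) \<subseteq>\<^sub>m dec (p \<beta>)"
      using R_D(4)[OF pR[of "sc \<alpha>" \<beta>]] le by (cases "sc \<alpha> = \<beta>") auto
    moreover have "\<alpha> \<in> dom (dec (p (sc \<alpha>)))" using dom_dec[OF pN] p(2) sc_less by simp
    ultimately show False using \<xi>(2)[of \<alpha>] by (simp add: map_le_def)
  qed
  then have "\<exists>\<alpha>. \<forall>a\<in>range (\<lambda>\<alpha>. h (sib \<alpha>)). rk a \<le> \<alpha>"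
    by (intro antichain_nodes) (use h_props(1)[OF sT] in auto)
  then obtain \<alpha> where "rk (h (sib \<alpha>)) \<le> \<alpha>" by blast
  then show False using h_props(2)[OF sT] sc_less[of \<alpha>] by simp
qed

lemma Tr_nonempty: "\<exists>t. t \<in> Tr \<alpha>"
proof -
  define z :: 'k where "z = (LEAST z. True)"
  have z: "z \<le> \<alpha>" for \<alpha> unfolding z_def by (rule Least_le) simp
  then have "Tr z = {Map.empty}" by (intro Tr_zero) (simp add: not_less)
  then show ?thesis using Tr_extend[of Map.empty z \<alpha>] z by auto
qed

lemma souslin_nodes: "souslin K N R"
proof (rule souslin_ranked[OF ranked_R])
  show "\<exists>x\<in>N. rk x = \<alpha>" for \<alpha> using Tr_nonempty[of \<alpha>] h_props by blast
  show "small K {x \<in> N. rk x = \<alpha>}" for \<alpha> unfolding rk_level by (rule small_image[OF Tr_small])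
qed (use no_branch antichain_nodes in blast)+

lemma level_R: "level N R \<alpha> = {x\<in>N. rk x = \<alpha>}"
  by (rule ranked_level[OF ranked_R])

section \<open>Derived trees, completeness and the ascent path\<close>

lemma souslin_derived:
  assumes \<tau>: "k0 < \<tau>" "\<tau> < min \<eta> \<theta>" and w: "inj_on w (below \<tau>)" "w ` below \<tau> \<subseteq> level N R (\<beta>::'k)"
  shows "souslin K (derived_tree N R \<tau> w) (derived_rel N R \<tau> w)"
proof -
  \<comment> \<open>All coordinates of a node have the same rank, so any one of them supplies the
    rank function; projecting to it also turns a cofinal branch of the derived tree into one of the
    tree itself.\<close>
  let ?D = "derived_tree N R \<tau> w" and ?R = "derived_rel N R \<tau> w" and ?rk = "\<lambda>f. rk (f k0)"
  have wN: "w k \<in> N" "rk (w k) = \<beta>" if "k < \<tau>" for k using w(2) that by (auto simp: level_R image_subset_iff)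
  have mem: "f \<in> ?D \<longleftrightarrow> (\<forall>k. \<not> k < \<tau> \<longrightarrow> f k = undefined) \<and> (\<forall>k<\<tau>. f k \<in> N \<and> rk (f k) = ?rk f \<and> compatible R (f k) (w k))" for f
    unfolding derived_tree_def level_R using \<tau>(1) by auto
  have DN: "f k \<in> N" "rk (f k) = ?rk f" "compatible R (f k) (w k)" if "f \<in> ?D" "k < \<tau>" for f k
    using that mem by auto
  have D_out: "f k = undefined" if "f \<in> ?D" "\<not> k < \<tau>" for f k using that mem by auto
  have R_iff: "?R f g \<longleftrightarrow> f \<in> ?D \<and> g \<in> ?D \<and> (\<forall>k<\<tau>. R (f k) (g k))" for f g by (auto simp: derived_rel_def)
  have rD: "ranked ?D ?R ?rk"
    unfolding ranked_def
  proof (intro conjI allI impI ballI)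
    fix f g e
    show "?R f g \<Longrightarrow> f \<in> ?D" "?R f g \<Longrightarrow> g \<in> ?D" by (simp_all add: R_iff)
    show "?R f g \<Longrightarrow> ?rk f < ?rk g" using R_D(3) \<tau>(1) by (simp add: R_iff)
    show "?R f g \<Longrightarrow> ?R g e \<Longrightarrow> ?R f e" unfolding R_iff using rankedD(4)[OF ranked_R] by blast
    show "\<exists>y. ?R y f \<and> ?rk y = \<epsilon>" if f: "f \<in> ?D" and \<epsilon>: "\<epsilon> < ?rk f" for \<epsilon>
    proof -
      define y where "y k = (if k < \<tau> then h (dec (f k) |` below \<epsilon>) else undefined)" for k
      have yR: "R (y k) (f k)" and yrk: "rk (y k) = \<epsilon>" if "k < \<tau>" for k
        using R_restrict[OF DN(1)[OF f that], of \<epsilon>] DN(2)[OF f that] \<epsilon> that by (auto simp: y_def)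
      have "y \<in> ?D"
        unfolding mem using R_D(1)[OF yR] yrk \<tau>(1) compatible_down[OF DN(3)[OF f] yR] by (simp add: y_def)
      then show ?thesis using f yR yrk[OF \<tau>(1)] unfolding R_iff by blast
    qed
    assume fe: "?R f e" "?R g e" "?rk f \<le> ?rk g"
    then have fg: "f \<in> ?D" "g \<in> ?D" by (auto simp: R_iff)
    have c: "f k = g k \<or> R (f k) (g k)" if "k < \<tau>" for k
      using rankedD(6)[OF ranked_R, of "f k" "e k" "g k"] fe that DN(2)[OF fg(1) that] DN(2)[OF fg(2) that]
      by (simp add: R_iff)
    show "f = g \<or> ?R f g"
    proof (cases "?rk f = ?rk g")
      case True
      have "f k = g k" for k
      proof (cases "k < \<tau>")
        case k: True
        have "\<not> R (f k) (g k)" using R_D(3)[of "f k" "g k"] True DN(2)[OF fg(1) k] DN(2)[OF fg(2) k] by auto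
        then show ?thesis using c[OF k] by blast
      next
        case False
        then show ?thesis using D_out[OF fg(1)] D_out[OF fg(2)] by simp
      qed
      then show ?thesis by blast
    next
      case False
      have "f k \<noteq> g k" if "k < \<tau>" for k using False DN(2)[OF fg(1) that] DN(2)[OF fg(2) that] by auto
      then show ?thesis using c fg unfolding R_iff by blast
    qed
  qed
  define dc where "dc f k = (if k < \<tau> then dec (f k) else undefined)" for f k
  have dc: "dc f \<in> tup \<tau> (Tr \<delta>) \<longleftrightarrow> ?rk f = \<delta>" if "f \<in> ?D" for f \<delta>
  proof -
    have "dec (f k) \<in> Tr \<delta> \<longleftrightarrow> ?rk f = \<delta>" if "k < \<tau>" for k
      using dec_props(1)[OF DN(1)[OF \<open>f \<in> ?D\<close> that]] DN(2)[OF \<open>f \<in> ?D\<close> that] rk_eq[of "f k" \<delta>] by auto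
    then show ?thesis using \<tau>(1) by (auto simp: tup_def dc_def)
  qed
  have h_undef: "(\<lambda>k. if k < \<tau> then h (u k) else undefined) \<in> ?D"
    "?rk (\<lambda>k. if k < \<tau> then h (u k) else undefined) = \<alpha>"
    if u: "\<And>k. k < \<tau> \<Longrightarrow> u k \<in> Tr \<alpha>" "\<And>k. k < \<tau> \<Longrightarrow> u k \<subseteq>\<^sub>m dec (w k) \<or> dec (w k) \<subseteq>\<^sub>m u k" for u \<alpha>
  proof -
    have "compatible R (h (u k)) (w k)" if k: "k < \<tau>" for k
    proof -
      have d: "dec (h (u k)) = u k" "h (u k) \<in> N" "rk (h (u k)) = \<alpha>" using u(1)[OF k] h_props by auto
      have du: "dom (u k) = below \<alpha>" "dom (dec (w k)) = below \<beta>" using dom_Tr[OF u(1)[OF k]] dom_dec wN[OF k] by auto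
      consider "\<alpha> < \<beta>" | "\<alpha> = \<beta>" | "\<beta> < \<alpha>" by (rule linorder_cases)
      then show ?thesis
      proof cases
        case 1
        then have "u k \<subseteq>\<^sub>m dec (w k)" using u(2)[OF k] du map_le_implies_dom_le[of "dec (w k)" "u k"] by auto
        then have "R (h (u k)) (w k)" using d wN[OF k] 1 by (simp add: R_def)
        then show ?thesis by (simp add: compatible_def)
      next
        case 2
        then have "u k = dec (w k)" using u(2)[OF k] du map_le_eq by metis
        then show ?thesis using dec_props(2) wN[OF k] by (simp add: compatible_def)
      next
        case 3
        then have "dec (w k) \<subseteq>\<^sub>m u k" using u(2)[OF k] du map_le_implies_dom_le[of "u k" "dec (w k)"] by auto
        then have "R (w k) (h (u k))" using d wN[OF k] 3 by (simp add: R_def)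
        then show ?thesis by (simp add: compatible_def)
      qed
    qed
    then show "(\<lambda>k. if k < \<tau> then h (u k) else undefined) \<in> ?D"
      unfolding mem using h_props[OF u(1)] \<tau>(1) by simp
    show "?rk (\<lambda>k. if k < \<tau> then h (u k) else undefined) = \<alpha>" using h_props(2)[OF u(1)[OF \<tau>(1)]] \<tau>(1) by simp
  qed
  show ?thesis
  proof (rule souslin_ranked[OF rD])
    fix \<alpha>
    have "\<exists>u. u \<in> Tr \<alpha> \<and> (u \<subseteq>\<^sub>m dec (w k) \<or> dec (w k) \<subseteq>\<^sub>m u)" if k: "k < \<tau>" for k
    proof (cases "\<alpha> \<le> \<beta>")
      case True
      have "dec (w k) |` below \<alpha> \<in> Tr \<alpha>" using restrict_Tr[OF dec_props(1)[OF wN(1)[OF k]]] wN(2)[OF k] True by simp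
      then show ?thesis using restrict_map_le by blast
    next
      case False
      then have "\<beta> \<le> \<alpha>" by simp
      then show ?thesis using Tr_extend[OF dec_props(1)[OF wN(1)[OF k]], of \<alpha>] wN(2)[OF k] by auto
    qed
    then obtain u where u: "\<And>k. k < \<tau> \<Longrightarrow> u k \<in> Tr \<alpha> \<and> (u k \<subseteq>\<^sub>m dec (w k) \<or> dec (w k) \<subseteq>\<^sub>m u k)" by metis
    have uT: "u k \<in> Tr \<alpha>" "u k \<subseteq>\<^sub>m dec (w k) \<or> dec (w k) \<subseteq>\<^sub>m u k" if "k < \<tau>" for k using u[OF that] by blast+
    show "\<exists>f\<in>?D. ?rk f = \<alpha>"
    proof (rule bexI)
      show "?rk (\<lambda>k. if k < \<tau> then h (u k) else undefined) = \<alpha>" using uT by (rule h_undef(2))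
      show "(\<lambda>k. if k < \<tau> then h (u k) else undefined) \<in> ?D" using uT by (rule h_undef(1))
    qed
    have "small K (tup \<tau> (h ` Tr \<alpha>))" by (rule small_tup[OF small_image[OF Tr_small]]) (use \<tau>(2) in simp)
    moreover have "{f\<in>?D. ?rk f = \<alpha>} \<subseteq> tup \<tau> (h ` Tr \<alpha>)"
    proof
      fix f assume "f \<in> {f\<in>?D. ?rk f = \<alpha>}"
      then have f: "f \<in> ?D" "?rk f = \<alpha>" by auto
      have "f k \<in> h ` Tr \<alpha>" if "k < \<tau>" for k
        unfolding rk_level[symmetric] using DN(1,2)[OF f(1) that] f(2) by simp
      then show "f \<in> tup \<tau> (h ` Tr \<alpha>)" using D_out[OF f(1)] by (simp add: tup_def)
    qed
    ultimately show "small K {f\<in>?D. ?rk f = \<alpha>}" by (rule small_subset)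
  next
    fix B assume B: "B \<subseteq> ?D" "\<forall>f\<in>B. \<forall>g\<in>B. f = g \<or> ?R f g \<or> ?R g f" "\<forall>\<alpha>. \<exists>f\<in>B. ?rk f = \<alpha>"
    show False
    proof (rule no_branch[of "(\<lambda>f. f k0) ` B"])
      show "(\<lambda>f. f k0) ` B \<subseteq> N" using B(1) DN(1) \<tau>(1) by blast
      show "\<forall>x\<in>(\<lambda>f. f k0) ` B. \<forall>y\<in>(\<lambda>f. f k0) ` B. x = y \<or> R x y \<or> R y x"
      proof (intro ballI)
        fix x y assume "x \<in> (\<lambda>f. f k0) ` B" "y \<in> (\<lambda>f. f k0) ` B"
        then obtain f g where "f \<in> B" "g \<in> B" "x = f k0" "y = g k0" by blast
        moreover from this B(2) have "f = g \<or> ?R f g \<or> ?R g f" by blast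
        ultimately show "x = y \<or> R x y \<or> R y x" using \<tau>(1) unfolding R_iff by blast
      qed
      show "\<forall>\<alpha>. \<exists>x\<in>(\<lambda>f. f k0) ` B. rk x = \<alpha>" using B(3) by blast
    qed
  next
    fix A assume A: "A \<subseteq> ?D" "\<forall>f\<in>A. \<forall>g\<in>A. f \<noteq> g \<longrightarrow> \<not> ?R f g"
    have "\<exists>\<alpha>. \<forall>a\<in>dc ` A. \<forall>\<delta>. a \<in> tup \<tau> (Tr \<delta>) \<longrightarrow> \<delta> \<le> \<alpha>"
    proof (rule antichain_bounded[OF \<tau>(2,1), of "\<lambda>k. dec (w k)" \<beta>])
      show "inj_on (\<lambda>k. dec (w k)) (below \<tau>)"
      proof (rule inj_onI)
        fix k k' assume k: "k \<in> below \<tau>" "k' \<in> below \<tau>" "dec (w k) = dec (w k')"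
        then have "w k = w k'" using dec_inj wN(1) by simp
        then show "k = k'" using inj_onD[OF w(1)] k by blast
      qed
      show "dec (w k) \<in> Tr \<beta>" if "k < \<tau>" for k using dec_props(1)[OF wN(1)[OF that]] wN(2)[OF that] by simp
      show "\<exists>\<delta>. a \<in> tup \<tau> (Tr \<delta>)" if "a \<in> dc ` A" for a using that dc A(1) by blast
      show "dec (w k) \<subseteq>\<^sub>m a k" if a: "a \<in> dc ` A" "a \<in> tup \<tau> (Tr \<delta>)" "\<beta> \<le> \<delta>" "k < \<tau>" for a \<delta> k
      proof -
        obtain f where f: "f \<in> A" "a = dc f" using a(1) by blast
        then have fD: "f \<in> ?D" using A(1) by blast
        have "?rk f = \<delta>" using dc[OF fD] a(2) f(2) by blast
        then have "rk (w k) \<le> rk (f k)" using DN(2)[OF fD a(4)] wN(2)[OF a(4)] a(3) by simp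
        then have "f k = w k \<or> R (w k) (f k)"
          using DN(3)[OF fD a(4)] R_D(3)[of "f k" "w k"] unfolding compatible_def by auto
        then show ?thesis using R_D(4) a(4) by (auto simp: f(2) dc_def)
      qed
      fix a a' \<delta> \<delta>' assume a: "a \<in> dc ` A" "a' \<in> dc ` A" "a \<in> tup \<tau> (Tr \<delta>)" "a' \<in> tup \<tau> (Tr \<delta>')" "\<delta>' < \<delta>"
      obtain f where f: "f \<in> A" "a = dc f" using a(1) by blast
      obtain f' where f': "f' \<in> A" "a' = dc f'" using a(2) by blast
      have D: "f \<in> ?D" "f' \<in> ?D" using f f' A(1) by auto
      have r: "?rk f = \<delta>" "?rk f' = \<delta>'" using dc[OF D(1)] dc[OF D(2)] a(3,4) f(2) f'(2) by blast+
      then have "f' \<noteq> f" using a(5) by auto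
      then have "\<not> ?R f' f" using A(2) f(1) f'(1) by blast
      then obtain k where k: "k < \<tau>" "\<not> R (f' k) (f k)" using D unfolding R_iff by blast
      have "\<not> dec (f' k) \<subseteq>\<^sub>m dec (f k)"
        using k(2) DN(1,2)[OF D(1) k(1)] DN(1,2)[OF D(2) k(1)] r a(5) by (simp add: R_def)
      then show "\<exists>k<\<tau>. \<not> a' k \<subseteq>\<^sub>m a k" using k(1) by (intro exI[of _ k]) (simp add: f(2) f'(2) dc_def)
    qed
    then obtain \<alpha> where \<alpha>: "\<forall>a\<in>dc ` A. \<forall>\<delta>. a \<in> tup \<tau> (Tr \<delta>) \<longrightarrow> \<delta> \<le> \<alpha>" ..
    have "?rk f \<le> \<alpha>" if "f \<in> A" for f
    proof -
      have "f \<in> ?D" using A(1) that by blast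
      then have "dc f \<in> tup \<tau> (Tr (?rk f))" using dc by blast
      then show ?thesis using \<alpha> that by blast
    qed
    then show "\<exists>\<alpha>. \<forall>f\<in>A. ?rk f \<le> \<alpha>" by blast
  qed
qed

text \<open>Without a largest index, the ranks of the sequence are cofinal in some \<alpha> of
  cofinality below \<eta>; there every branch was added, in particular the union of the
  sequence.\<close>

lemma eta_complete_nodes: "eta_complete N R \<eta>"
  unfolding eta_complete_def
proof (intro allI impI)
  fix \<gamma> and s :: "'k \<Rightarrow> 'k"
  assume \<gamma>: "\<gamma> < \<eta>" and sN: "\<forall>\<beta><\<gamma>. s \<beta> \<in> N" and sR: "\<forall>\<beta> \<beta>'. \<beta> < \<beta>' \<longrightarrow> \<beta>' < \<gamma> \<longrightarrow> R (s \<beta>) (s \<beta>')"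
  show "\<exists>t\<in>N. \<forall>\<beta><\<gamma>. s \<beta> = t \<or> R (s \<beta>) t"
  proof (cases "\<exists>\<beta>0<\<gamma>. \<forall>\<beta><\<gamma>. \<beta> \<le> \<beta>0")
    case True
    then obtain \<beta>0 where \<beta>0: "\<beta>0 < \<gamma>" "\<forall>\<beta><\<gamma>. \<beta> \<le> \<beta>0" by blast
    have "s \<beta> = s \<beta>0 \<or> R (s \<beta>) (s \<beta>0)" if "\<beta> < \<gamma>" for \<beta> using \<beta>0 sR that by (metis le_less)
    then show ?thesis using sN \<beta>0(1) by blast
  next
    case False
    then have up: "\<exists>\<beta>'<\<gamma>. \<beta> < \<beta>'" if "\<beta> < \<gamma>" for \<beta> using that by (meson not_le)
    show ?thesis
    proof (cases "\<exists>\<beta>. \<beta> < \<gamma>")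
      case False
      obtain t where "t \<in> Tr \<gamma>" using Tr_nonempty by blast
      then have "h t \<in> N" by (rule h_props(1))
      then show ?thesis using False by blast
    next
      case True
      then obtain \<beta>1 where \<beta>1: "\<beta>1 < \<gamma>" by blast
      define A where "A = (\<lambda>\<beta>. rk (s \<beta>)) ` below \<gamma>"
      have "small K A" unfolding A_def by (rule small_image[OF small_below])
      then obtain l where l: "\<forall>a\<in>A. a < l" using small_bounded by blast
      define \<alpha> where "\<alpha> = (LEAST \<alpha>. \<forall>a\<in>A. a < \<alpha>)"
      have A\<alpha>: "\<forall>a\<in>A. a < \<alpha>" unfolding \<alpha>_def by (rule LeastI[of _ l]) (rule l)
      have cof: "\<exists>a\<in>A. \<xi> < a" if "\<xi> < \<alpha>" for \<xi>
      proof -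
        have "\<not> (\<forall>a\<in>A. a < \<xi>)" using that unfolding \<alpha>_def by (rule not_less_Least)
        then obtain \<beta> where \<beta>: "\<beta> < \<gamma>" "\<xi> \<le> rk (s \<beta>)" unfolding A_def by (auto simp: not_less)
        obtain \<beta>' where \<beta>': "\<beta>' < \<gamma>" "\<beta> < \<beta>'" using up[OF \<beta>(1)] by blast
        then have "rk (s \<beta>) < rk (s \<beta>')" using sR R_D(3) by blast
        then show ?thesis using \<beta>(2) \<beta>'(1) by (intro bexI[of _ "rk (s \<beta>')"]) (auto simp: A_def)
      qed
      have cof': "\<exists>\<beta><\<gamma>. \<xi> < rk (s \<beta>)" if "\<xi> < \<alpha>" for \<xi>
        using cof[OF that] unfolding A_def by auto
      have "rk (s \<beta>1) < \<alpha>" using A\<alpha> \<beta>1 by (auto simp: A_def)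
      then have lim: "is_limit \<alpha>" unfolding is_limit_def using cof A\<alpha> by blast
      have "\<alpha> \<notin> E_ge \<eta>"
      proof
        assume "\<alpha> \<in> E_ge \<eta>"
        moreover have "A \<subseteq> below \<alpha>" using A\<alpha> by auto
        moreover have "\<forall>\<beta><\<alpha>. \<exists>\<delta>\<in>A. \<beta> \<le> \<delta>" using cof less_imp_le by blast
        ultimately have "|below \<eta>| \<le>o |A|" unfolding E_ge_def by blast
        also have "|A| \<le>o |below \<gamma>|" unfolding A_def by (rule card_of_image)
        also have "|below \<gamma>| <o |below \<eta>|" by (rule is_card_less[OF eta_card \<gamma>])
        finally show False by (simp add: ordLess_irreflexive)
      qed
      define S where "S = (\<lambda>\<beta>. dec (s \<beta>)) ` below \<gamma>"
      have le: "dec (s \<beta>) \<subseteq>\<^sub>m Umap S" if "\<beta> < \<gamma>" for \<beta>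
      proof (rule map_le_Umap)
        fix t t' assume "t \<in> S" "t' \<in> S"
        then obtain \<delta> \<delta>' where d: "\<delta> < \<gamma>" "\<delta>' < \<gamma>" "t = dec (s \<delta>)" "t' = dec (s \<delta>')" by (auto simp: S_def)
        consider "\<delta> < \<delta>'" | "\<delta> = \<delta>'" | "\<delta>' < \<delta>" by (rule linorder_cases)
        then show "t \<subseteq>\<^sub>m t' \<or> t' \<subseteq>\<^sub>m t"
        proof cases
          case 1
          then show ?thesis using sR d R_D(4) by blast
        next
          case 3
          then show ?thesis using sR d R_D(4) by blast
        qed (use d in simp)
      qed (use that in \<open>simp add: S_def\<close>)
      have dd: "dom (dec (s \<beta>)) = below (rk (s \<beta>))" if "\<beta> < \<gamma>" for \<beta> using dom_dec sN that by blast
      have "dom (Umap S) = below \<alpha>"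
      proof (intro equalityI subsetI)
        fix \<xi> assume "\<xi> \<in> dom (Umap S)"
        then obtain t where t: "t \<in> S" "\<xi> \<in> dom t" unfolding dom_Umap by blast
        obtain \<beta> where \<beta>: "\<beta> < \<gamma>" "t = dec (s \<beta>)" using t(1) by (auto simp: S_def)
        have "\<xi> < rk (s \<beta>)" using t(2) dd[OF \<beta>(1)] unfolding \<beta>(2) by simp
        moreover have "rk (s \<beta>) < \<alpha>" using A\<alpha> \<beta>(1) by (simp add: A_def)
        ultimately have "\<xi> < rk (s \<beta>)" "rk (s \<beta>) < \<alpha>" .
        then show "\<xi> \<in> below \<alpha>" by simp
      next
        fix \<xi> assume "\<xi> \<in> below \<alpha>"
        then have "\<xi> < \<alpha>" by simp
        from cof'[OF this] obtain \<beta> where \<beta>: "\<beta> < \<gamma>" "\<xi> < rk (s \<beta>)" by blast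
        have "\<xi> \<in> dom (dec (s \<beta>))" unfolding dd[OF \<beta>(1)] using \<beta>(2) by simp
        moreover have "dec (s \<beta>) \<in> S" unfolding S_def using \<beta>(1) by simp
        ultimately show "\<xi> \<in> dom (Umap S)" unfolding dom_Umap by (rule UN_I[rotated])
      qed
      moreover have "Umap S |` below \<xi> \<in> Tr \<xi>" if "\<xi> < \<alpha>" for \<xi>
      proof -
        obtain \<beta> where \<beta>: "\<beta> < \<gamma>" "\<xi> < rk (s \<beta>)" using cof'[OF \<open>\<xi> < \<alpha>\<close>] by blast
        have "Umap S |` below (rk (s \<beta>)) = dec (s \<beta>)" by (rule map_le_restrict_below[OF le[OF \<beta>(1)] dd[OF \<beta>(1)]])
        then have "Umap S |` below \<xi> = dec (s \<beta>) |` below \<xi>"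
          using \<beta>(2) by (metis less_imp_le min_absorb2 restrict_below_below)
        moreover have "s \<beta> \<in> N" using sN \<beta>(1) by blast
        ultimately show ?thesis using restrict_Tr[OF dec_props(1) less_imp_le[OF \<beta>(2)]] by simp
      qed
      ultimately have u: "Umap S \<in> Tr \<alpha>" unfolding Tr_limit[OF lim] using \<open>\<alpha> \<notin> E_ge \<eta>\<close> by blast
      have "R (s \<beta>) (h (Umap S))" if "\<beta> < \<gamma>" for \<beta>
        unfolding R_def using h_props[OF u] dec_h[OF u] le[OF that] sN that A\<alpha> by (auto simp: A_def)
      then show ?thesis using h_props(1)[OF u] by blast
    qed
  qed
qed

definition apath :: "'k node \<Rightarrow> 'k \<Rightarrow> 'k" where
  "apath x i = h (Fn (THE \<alpha>. dom x = below \<alpha>) x i Map.empty)"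

text \<open>If two sequences differ at \<delta>, the successor clause writes their values at
  position \<delta> on the next level, for every index; for all but boundedly many indices these
  entries persist up to \<alpha>, so the nodes differ.\<close>

lemma ascent_path_nodes: "ascent_path N R \<theta> X apath"
proof -
  define z :: 'k where "z = (LEAST z. True)"
  have z: "z \<le> \<alpha>" for \<alpha> unfolding z_def by (rule Least_le) simp
  then have T0: "Map.empty \<in> Tr z" by (subst Tr_zero) (auto simp: not_less)
  have ap: "apath x i = h (Fn \<alpha> x i Map.empty)" if "dom x = below \<alpha>" for x i \<alpha>
    using that by (simp add: apath_def)
  have FT: "Fn \<alpha> x i Map.empty \<in> Tr \<alpha>" if "x \<in> X" "dom x = below \<alpha>" "i < \<theta>" for x \<alpha> i
    using level_inv_Fn(1)[OF level_inv that(1,2) z T0 that(3)] .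
  have up: "cobounded \<theta> {i. Fn \<beta> (x |` below \<beta>) i Map.empty \<subseteq>\<^sub>m Fn \<alpha> x i Map.empty}"
    if "x \<in> X" "dom x = below \<alpha>" "\<beta> \<le> \<alpha>" for x \<alpha> \<beta>
    by (rule level_inv_cobounded[OF level_inv that(1,2) T0 z that(3)])
  have val: "cobounded \<theta> {i. Fn \<alpha> x i Map.empty \<delta> = x \<delta>}" if x: "x \<in> X" "dom x = below \<alpha>" "\<delta> < \<alpha>" for x \<alpha> \<delta>
  proof -
    define \<epsilon> where "\<epsilon> = (LEAST \<beta>. \<delta> < \<beta>)"
    have s: "sucof \<epsilon> \<delta>"
      unfolding sucof_def \<epsilon>_def using LeastI_ex[of "\<lambda>\<beta>. \<delta> < \<beta>"] no_max Least_le[of "\<lambda>\<beta>. \<delta> < \<beta>"] by blast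
    then have e: "\<epsilon> \<le> \<alpha>" "\<delta> < \<epsilon>" using x(3) by (auto simp: sucof_def)
    have ne: "dom (Map.empty :: 'k node) \<noteq> below \<epsilon>" using e(2) by auto
    have v: "Fn \<epsilon> (x |` below \<epsilon>) i Map.empty \<delta> = x \<delta>" for i
      unfolding Fn_suc[OF s ne] using e(2) by (simp del: restrict_below_below)
    have "\<delta> \<in> dom x" unfolding x(2) using x(3) by simp
    show ?thesis
    proof (rule cobounded_mono[OF up[OF x(1,2) e(1)]])
      fix i assume "i \<in> {i. Fn \<epsilon> (x |` below \<epsilon>) i Map.empty \<subseteq>\<^sub>m Fn \<alpha> x i Map.empty}"
      then have "Fn \<epsilon> (x |` below \<epsilon>) i Map.empty \<delta> = Fn \<alpha> x i Map.empty \<delta>"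
      proof -
        have "\<delta> \<in> dom (Fn \<epsilon> (x |` below \<epsilon>) i Map.empty)" using \<open>\<delta> \<in> dom x\<close> unfolding domIff v .
        with \<open>i \<in> _\<close> show ?thesis by (simp only: map_le_def mem_Collect_eq)
      qed
      then show "i \<in> {i. Fn \<alpha> x i Map.empty \<delta> = x \<delta>}" unfolding v by simp
    qed
  qed
  show ?thesis
    unfolding ascent_path_def
  proof (intro conjI ballI allI impI)
    fix x \<alpha> i assume "x \<in> X" "dom x = below \<alpha>" "i < \<theta>"
    then show "apath x i \<in> level N R \<alpha>" unfolding level_R ap[OF \<open>dom x = below \<alpha>\<close>] using h_props[OF FT] by simp
  next
    fix x y assume x: "x \<in> X" "y \<in> X" and le: "x \<subseteq>\<^sub>m y \<and> x \<noteq> y"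
    obtain \<alpha> where \<alpha>: "dom x = below \<alpha>" using X_dom x(1) by blast
    obtain \<beta> where \<beta>: "dom y = below \<beta>" using X_dom x(2) by blast
    have "\<alpha> \<le> \<beta>" using map_le_implies_dom_le[of x y] le \<alpha> \<beta> by simp
    moreover have "\<alpha> \<noteq> \<beta>" using map_le_eq[of x y \<alpha>] le \<alpha> \<beta> by auto
    ultimately have ab: "\<alpha> < \<beta>" by simp
    have xy: "y |` below \<alpha> = x" using map_le_restrict_below le \<alpha> by blast
    show "cobounded \<theta> {i. i < \<theta> \<and> R (apath x i) (apath y i)}"
    proof (rule cobounded_mono[OF up[OF x(2) \<beta> \<open>\<alpha> \<le> \<beta>\<close>]])
      fix i assume i: "i < \<theta>" "i \<in> {i. Fn \<alpha> (y |` below \<alpha>) i Map.empty \<subseteq>\<^sub>m Fn \<beta> y i Map.empty}"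
      note Fx = FT[OF x(1) \<alpha> i(1)] and Fy = FT[OF x(2) \<beta> i(1)]
      have "R (apath x i) (apath y i)"
        unfolding R_def ap[OF \<alpha>] ap[OF \<beta>] using h_props[OF Fx] h_props[OF Fy] dec_h[OF Fx] dec_h[OF Fy] ab i(2) xy by simp
      then show "i \<in> {i. i < \<theta> \<and> R (apath x i) (apath y i)}" using i(1) by simp
    qed
  next
    fix \<alpha> x y assume x: "x \<in> X" "y \<in> X" and \<alpha>: "dom x = below \<alpha>" "dom y = below \<alpha>" and "x \<noteq> y"
    obtain \<delta> where \<delta>: "x \<delta> \<noteq> y \<delta>" using \<open>x \<noteq> y\<close> by blast
    have "\<delta> < \<alpha>"
    proof (rule ccontr)
      assume "\<not> \<delta> < \<alpha>"
      then have "\<delta> \<notin> dom x" "\<delta> \<notin> dom y" unfolding \<alpha> by simp_all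
      then show False using \<delta> unfolding domIff by simp
    qed
    show "cobounded \<theta> {i. i < \<theta> \<and> apath x i \<noteq> apath y i}"
    proof (rule cobounded_mono[OF cobounded_Int[OF val[OF x(1) \<alpha>(1) \<open>\<delta> < \<alpha>\<close>] val[OF x(2) \<alpha>(2) \<open>\<delta> < \<alpha>\<close>]]])
      fix i assume i: "i < \<theta>" "i \<in> {i. Fn \<alpha> x i Map.empty \<delta> = x \<delta>} \<inter> {i. Fn \<alpha> y i Map.empty \<delta> = y \<delta>}"
      have "apath x i \<noteq> apath y i"
      proof
        assume "apath x i = apath y i"
        then have "dec (apath x i) = dec (apath y i)" by (rule arg_cong)
        then have "Fn \<alpha> x i Map.empty = Fn \<alpha> y i Map.empty"
          unfolding ap[OF \<alpha>(1)] ap[OF \<alpha>(2)] dec_h[OF FT[OF x(1) \<alpha>(1) i(1)]] dec_h[OF FT[OF x(2) \<alpha>(2) i(1)]] .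
        then have "Fn \<alpha> x i Map.empty \<delta> = Fn \<alpha> y i Map.empty \<delta>" by (rule fun_cong)
        moreover have "Fn \<alpha> x i Map.empty \<delta> = x \<delta>" "Fn \<alpha> y i Map.empty \<delta> = y \<delta>" using i(2) by blast+
        ultimately show False using \<delta> by metis
      qed
      then show "i \<in> {i. i < \<theta> \<and> apath x i \<noteq> apath y i}" using i(1) by simp
    qed
  qed
qed

end

section \<open>Souslin trees with ascent paths\<close>

definition seq_height :: "('k::wellorder \<Rightarrow> 'k option) \<Rightarrow> 'k" where
  "seq_height x = (THE \<alpha>. dom x = below \<alpha>)"

lemma seq_height_eq: "dom x = below \<alpha> \<Longrightarrow> seq_height x = \<alpha>"
  by (simp add: seq_height_def)

text \<open>Heights in the tree \<open>X\<close> are lengths of sequences, so the \<kappa>-tree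
  hypothesis says that for each \<alpha> the sequences of length \<alpha> form a nonempty small
  set.\<close>

lemma ranked_X_order:
  fixes X :: "('k::wellorder \<Rightarrow> 'k option) set"
  assumes Xseq: "\<forall>x\<in>X. seq_below x" and Xdc: "downward_closed X"
  shows "ranked X (X_order X) seq_height"
    and "level X (X_order X) \<alpha> = {x\<in>X. dom x = below \<alpha>}"
proof -
  have rk: "dom x = below (seq_height x)" if x: "x \<in> X" for x
  proof -
    obtain \<alpha> where d: "dom x = below \<alpha>" using Xseq x unfolding seq_below_def by blast
    show ?thesis unfolding seq_height_eq[OF d] by (rule d)
  qed
  have O: "X_order X x y \<longleftrightarrow> x \<in> X \<and> y \<in> X \<and> x \<subseteq>\<^sub>m y \<and> seq_height x < seq_height y" for x y
  proof -
    have "seq_height x \<noteq> seq_height y" if "x \<in> X" "y \<in> X" "x \<subseteq>\<^sub>m y" "x \<noteq> y"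
      using map_le_eq[OF that(3) rk[OF that(1)]] rk[OF that(2)] that(4) by auto
    moreover have "seq_height x \<le> seq_height y" if "x \<in> X" "y \<in> X" "x \<subseteq>\<^sub>m y"
      using map_le_implies_dom_le[OF that(3)] unfolding rk[OF that(1)] rk[OF that(2)] by simp
    ultimately show ?thesis unfolding X_order_def by (auto simp: less_le)
  qed
  show r: "ranked X (X_order X) seq_height"
    unfolding ranked_def
  proof (intro conjI allI impI ballI)
    fix x y z
    show "X_order X x y \<Longrightarrow> x \<in> X" "X_order X x y \<Longrightarrow> y \<in> X" "X_order X x y \<Longrightarrow> seq_height x < seq_height y"
      unfolding O by blast+
    show "X_order X x y \<Longrightarrow> X_order X y z \<Longrightarrow> X_order X x z"
      unfolding O by (blast intro: map_le_trans less_trans)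
    show "\<exists>y. X_order X y z \<and> seq_height y = \<beta>" if z: "z \<in> X" "\<beta> < seq_height z" for \<beta>
    proof -
      have "z |` below \<beta> \<in> X" using Xdc z(1) by (simp add: downward_closed_def)
      moreover have d: "seq_height (z |` below \<beta>) = \<beta>"
        by (rule seq_height_eq[OF dom_restrict_below[OF rk[OF z(1)] less_imp_le[OF z(2)]]])
      ultimately have "X_order X (z |` below \<beta>) z" unfolding O d using z by simp
      then show ?thesis using d by blast
    qed
    assume *: "X_order X x z" "X_order X y z" "seq_height x \<le> seq_height y"
    then have m: "x \<in> X" "y \<in> X" "x \<subseteq>\<^sub>m z" "y \<subseteq>\<^sub>m z" unfolding O by blast+
    have "x \<subseteq>\<^sub>m y" by (rule map_le_chain[OF m(3,4) rk[OF m(1)] rk[OF m(2)] *(3)])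
    then show "x = y \<or> X_order X x y" using m(1,2) by (auto simp: X_order_def)
  qed
  have "seq_height x = \<alpha> \<longleftrightarrow> dom x = below \<alpha>" if "x \<in> X" for x using rk[OF that] seq_height_eq by metis
  then show "level X (X_order X) \<alpha> = {x\<in>X. dom x = below \<alpha>}"
    unfolding ranked_level[OF r] by blast
qed

theorem theorem1p8:
  fixes \<theta> \<eta> \<chi> :: "'k::wellorder"
    and X :: "('k \<Rightarrow> 'k option) set"
  assumes kappa: "regular_type TYPE('k)"
    and theta: "regular_ord \<theta>"
    and eta_inf: "infinite (below \<eta>)" and eta_card: "is_card \<eta>"
    and exp: "\<forall>lam::'k. (card_of (SIGMA \<mu>:below \<eta>. funcs_to \<mu> lam), card_of (UNIV::'k set)) \<in> ordLess"
    and chi: "\<chi> = min \<eta> \<theta>"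
    and dia: "diamond TYPE('k)"
    and Xseq: "\<forall>x\<in>X. seq_below x"
    and Xdc: "downward_closed X"
    and Xtree: "kappa_tree TYPE('k) X (X_order X)"
    and Xresp: "respecting X (sqsub_nu \<theta>) UNIV {E_ge \<eta>}"
  shows "\<exists>(T::'k set) R. souslin TYPE('k) T R \<and> chi_free T R \<chi> \<and> eta_complete T R \<eta> \<and>
           (\<exists>f. ascent_path T R \<theta> X f)"
proof -
  \<comment> \<open>The infinite ordinal \<eta> witnesses that \<kappa> is uncountable.\<close>
  interpret tuple_arith "TYPE('k)" \<eta>
    by unfold_locales (use kappa eta_inf eta_card exp in auto)
  have lev: "level X (X_order X) \<alpha> = {x\<in>X. dom x = below \<alpha>}" for \<alpha> :: 'k
    by (rule ranked_X_order(2)[OF Xseq Xdc])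
  have X_level: "\<exists>x\<in>X. dom x = below \<alpha>" and X_small: "small TYPE('k) {x\<in>X. dom x = below \<alpha>}" for \<alpha>
    using Xtree unfolding kappa_tree_def lev small_def by blast+
  obtain St C b where
    onto: "\<forall>\<alpha>\<in>St. {x\<in>X. dom x = below \<alpha>} \<subseteq> b \<alpha> ` restrX X (C \<alpha>)" and
    P14: "P14 C (sqsub_nu \<theta>) UNIV {S \<inter> St | S. S \<in> {E_ge \<eta>}}" and
    coherent: "\<forall>\<alpha>' \<alpha>. \<forall>x\<in>restrX X (C \<alpha>'). x \<in> restrX X (C \<alpha>) \<longrightarrow>
        (\<forall>\<delta>. dom x = below \<delta> \<longrightarrow> C \<alpha> \<inter> {\<delta>..<\<alpha>'} = C \<alpha>' \<inter> {\<delta>..<\<alpha>'} \<longrightarrow>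
            b \<alpha>' x = b \<alpha> x |` below \<alpha>')"
    using Xresp unfolding respecting_def by blast
  note P14' = P14[unfolded P14_def]
  have C_club: "is_limit \<alpha> \<Longrightarrow> club_in (C \<alpha>) \<alpha>" for \<alpha>
    using conjunct1[OF P14'] by blast
  have C_sqsub: "\<beta> \<in> acc (C \<alpha>) \<Longrightarrow> sqsub_nu \<theta> (C \<beta>) (C \<alpha>)" for \<alpha> \<beta>
    using conjunct1[OF conjunct2[OF P14']] by blast
  have C_hits: "stationary {\<alpha> \<in> E_ge \<eta> \<inter> St. \<forall>i<\<alpha>. is_sup {\<beta>\<in>C \<alpha>. succ_omega (C \<alpha> - below \<beta>) \<subseteq> A i} \<alpha>}"
    if A: "\<And>i \<beta>. \<exists>\<gamma>\<in>A i. \<beta> \<le> \<gamma>" for A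
  proof -
    have "\<forall>i\<in>UNIV. \<forall>\<beta>. \<exists>\<gamma>\<in>A i. \<beta> \<le> \<gamma>" using A by blast
    from conjunct2[OF conjunct2[OF P14'], rule_format (no_asm), OF this, of "E_ge \<eta> \<inter> St"]
    show ?thesis by auto
  qed
  let ?nodes = "{t :: 'k node. seq_below t}"
  let ?codes = "?nodes \<times> (UNIV :: 'k set) \<times> ?nodes"
  let ?V = "SIGMA \<tau>:below (min \<eta> \<theta>). tup \<tau> ?codes"
  let ?U = "\<Union>\<tau>\<in>below \<eta>. tup \<tau> ?nodes"
  note nodes = card_seq_below[OF dia]
  obtain h :: "'k node \<Rightarrow> 'k" where h: "inj_on h ?nodes" using nodes card_of_ordLeq by metis
  have "|?codes| \<le>o |UNIV :: 'k set|"
    by (intro card_of_Sigma_ordLeq_infinite inf_UNIV nodes ballI ordLeq_refl card_of_Card_order)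
  then have "|SIGMA \<tau>:below \<eta>. tup \<tau> ?codes| \<le>o |UNIV :: 'k set|" by (rule tuples_ordLeq)
  moreover have "?V \<subseteq> (SIGMA \<tau>:below \<eta>. tup \<tau> ?codes)" by auto
  ultimately have V: "|?V| \<le>o |UNIV :: 'k set|" using card_of_mono1 ordLeq_transitive by blast
  then obtain cd :: "'k \<times> ('k \<Rightarrow> 'k node \<times> 'k \<times> 'k node) \<Rightarrow> 'k" where cd: "inj_on cd ?V"
    using card_of_ordLeq by metis
  have U: "|?U| \<le>o |UNIV :: 'k set|"
    using card_of_UNION_Sigma tuples_ordLeq[OF nodes] by (rule ordLeq_transitive)
  \<comment> \<open>\<open>diamond_guess\<close> needs a default value, hence a member of
    \<open>?V\<close>; the constant tuple of empty nodes serves.\<close>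
  obtain \<tau>0 where "\<tau>0 < min \<eta> \<theta>"
    using eta_inf regular_ord_nonempty[OF theta] by (metis finite.emptyI min_def ex_in_conv mem_below)
  moreover have "(\<lambda>k. if k < \<tau>0 then (Map.empty, \<tau>0, Map.empty) else undefined) \<in> tup \<tau>0 ?codes"
  proof -
    have z: "(LEAST z::'k. True) \<le> \<alpha>" for \<alpha> by (rule Least_le) simp
    have "below (LEAST z::'k. True) = {}" using leD[OF z] by (simp add: below_def)
    then have "dom (Map.empty :: 'k node) = below (LEAST z::'k. True)" by simp
    then have "(Map.empty :: 'k node) \<in> ?nodes" unfolding seq_below_def by blast
    then show ?thesis by (simp add: tup_def)
  qed
  ultimately have "(\<tau>0, \<lambda>k. if k < \<tau>0 then (Map.empty, \<tau>0, Map.empty) else undefined) \<in> ?V" by simp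
  then have ne: "?V \<noteq> {}" by (metis empty_iff)
  obtain Om :: "'k \<Rightarrow> ('k \<Rightarrow> 'k node) set" and psi where psi: "\<And>\<gamma>. psi \<gamma> \<in> ?V" and
    guess: "\<And>D s. D \<subseteq> ?U \<Longrightarrow> s \<in> ?V \<Longrightarrow>
      \<exists>g::('k \<Rightarrow> 'k node) \<Rightarrow> 'k. stationary {\<gamma>. psi \<gamma> = s \<and> Om \<gamma> \<subseteq> D \<and> (\<forall>d\<in>D. g d < \<gamma> \<longrightarrow> d \<in> Om \<gamma>)}"
    by (rule diamond_guess[OF dia U V ne], rule that)
  have psi_less: "fst (psi \<gamma>) < min \<eta> \<theta>" for \<gamma> using psi[of \<gamma>] by auto
  obtain e0 e1 :: 'k where "e0 < e1" using no_max by blast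
  interpret coded_tree "TYPE('k)" \<eta> \<theta> X C b psi Om e0 e1 St cd h
  proof unfold_locales
    show "\<exists>\<alpha>. dom x = below \<alpha>" if "x \<in> X" for x using Xseq that by (simp add: seq_below_def)
    show "x |` below \<beta> \<in> X" if "x \<in> X" for x \<beta> using Xdc that by (simp add: downward_closed_def)
    show "b \<beta> z = b \<alpha> z |` below \<beta>"
      if "z \<in> restrX X (C \<beta>)" "z \<in> restrX X (C \<alpha>)" "dom z = below \<delta>" "C \<alpha> \<inter> {\<delta>..<\<beta>} = C \<beta> \<inter> {\<delta>..<\<beta>}" for \<alpha> \<beta> z \<delta>
      using coherent that by blast
    show "fst (psi \<gamma>) < \<theta>" for \<gamma> using psi_less[of \<gamma>] by simp
    show "e0 \<noteq> e1" using \<open>e0 < e1\<close> by simp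
    show "\<exists>z\<in>restrX X (C \<alpha>). b \<alpha> z = x" if "\<alpha> \<in> St" "x \<in> X" "dom x = below \<alpha>" for \<alpha> x
      using onto that by blast
    show "\<exists>g. stationary {\<gamma>. psi \<gamma> = (\<tau>, q) \<and> Om \<gamma> \<subseteq> D \<and> (\<forall>d\<in>D. g d < \<gamma> \<longrightarrow> d \<in> Om \<gamma>)}"
      if "\<tau> < min \<eta> \<theta>" "q \<in> tup \<tau> ?codes" "D \<subseteq> tup \<tau> ?nodes" for \<tau> q D
    proof (rule guess)
      show "D \<subseteq> ?U" using that(1,3) by auto
      show "(\<tau>, q) \<in> ?V" using that(1,2) by simp
    qed
  qed (fact C_club theta X_level X_small C_sqsub C_hits cd h)+
  have "chi_free N R \<chi>"
    unfolding chi_free_def chi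
  proof (intro allI impI, elim exE conjE)
    fix \<tau> \<beta> :: 'k and w k0
    assume "\<tau> < min \<eta> \<theta>" "inj_on w (below \<tau>)" "w ` below \<tau> \<subseteq> level N R \<beta>" "k0 < \<tau>"
    then show "souslin TYPE('k) (derived_tree N R \<tau> w) (derived_rel N R \<tau> w)" using souslin_derived by blast
  qed
  then show ?thesis using souslin_nodes eta_complete_nodes ascent_path_nodes by blast
qed

end
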